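(* Let $G$ be a second countable locally compact group. Let $(X,\mu)$ be a standard Borel measure space with $\mu$ finite, let $1\le p<\infty$, and let $\pi:G\to O(L_p(X,\mu))$ be a (BL) orthogonal representation which is measure-preserving and ergodic. Let $\mathcal{F}_{L_\infty(X,\mu)}(G,\pi)=\{q\in[1,\infty) : H^1(G,\pi^q)=\{0\}\}$. Then: - $\mathcal{F}_{L_\infty(X,\mu)}(G,\pi)$ is an interval or is empty. - If $G$ has Kazhdan's property $(T)$, then $\mathcal{F}_{L_\infty(X,\mu)}(G,\pi)$ is an interval of the form $[1,p_c]$ for some $p_c>2$, or is equal to $[1,\infty)$.
   Context: $L_p(X,\mu)$ is the complex $L_p$-space; $O(L_p(X,\mu))$ is its group of bijective linear isometries. An orthogonal representation $\pi:G\to O(L_p(X,\mu))$ is a homomorphism such that $g\mapsto\pi(g)f$ is continuous for all $f$. It is called a (BL) representation if each $\pi(g)$ has the form $Uf(x)=h(x)\left(\frac{d\varphi*\mu}{d\mu}(x)\right)^{1/p}f(\varphi(x))$ with $h:X\to\mathbb{C}$ measurable of modulus one and $\varphi:X\to X$ a bijective $\mu$-class-preserving transformation (automatic for $p\ne2$ by Banach–Lamperti). The maps $\varphi$ give the associated action of $G$ on $(X,\mu)$; $\pi$ is called measure-preserving (resp. ergodic) if this action preserves $\mu$ (resp. is ergodic). The Mazur map is $M_{p,q}:L_p(X,\mu)\to L_q(X,\mu)$, $f=\mathrm{sg}(f)|f|\mapsto \mathrm{sg}(f)|f|^{p/q}$, where $\mathrm{sg}(f)$ has modulus one and $f=\mathrm{sg}(f)|f|$.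 For a (BL) representation $\pi=\pi^p$ on $L_p(X,\mu)$ and $1\le q<\infty$, $\pi^q(g)=M_{p,q}\circ\pi^p(g)\circ M_{q,p}$ is a (BL) orthogonal representation of $G$ on $L_q(X,\mu)$ (same $h$ and $\varphi$, with exponent $1/q$). For an orthogonal representation $\rho$ of $G$ on a Banach space $E$, a 1-cocycle is a continuous $b:G\to E$ with $b(gh)=b(g)+\rho(g)b(h)$ for all $g,h\in G$; a coboundary is a cocycle of the form $b(g)=f-\rho(g)f$ with $f\in E$; $H^1(G,\rho)$ is the quotient of cocycles by coboundaries. *)

theory Defs
  imports "HOL-Analysis.Analysis" "HOL-Library.Function_Algebras"
begin

section \<open>Standard Borel spaces and complex Lp spaces\<close>

definition standard_borel :: "'x measure \<Rightarrow> bool" where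
  "standard_borel M \<longleftrightarrow>
     (\<exists>T. completely_metrizable_space T \<and> second_countable T \<and> topspace T = space M \<and>
          sets M = sigma_sets (space M) {U. openin T U})"

text \<open>
  Elements of the Lp space are represented by functions; equality in the Lp space is equality
  almost everywhere, and every condition below is imposed up to almost everywhere equality.
\<close>

definition Lp :: "real \<Rightarrow> 'x measure \<Rightarrow> ('x \<Rightarrow> complex) set" where
  "Lp p M = {f \<in> borel_measurable M. integrable M (\<lambda>x. norm (f x) powr p)}"

definition Lp_norm :: "real \<Rightarrow> 'x measure \<Rightarrow> ('x \<Rightarrow> complex) \<Rightarrow> real" where
  "Lp_norm p M f = (LINT x|M. norm (f x) powr p) powr (1 / p)"

definition ae_eq :: "'x measure \<Rightarrow> ('x \<Rightarrow> complex) \<Rightarrow> ('x \<Rightarrow> complex) \<Rightarrow> bool" where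
  "ae_eq M f g \<longleftrightarrow> (AE x in M. f x = g x)"

definition Lp_continuous ::
    "real \<Rightarrow> 'x measure \<Rightarrow> ('g::topological_space \<Rightarrow> 'x \<Rightarrow> complex) \<Rightarrow> bool" where
  "Lp_continuous p M F \<longleftrightarrow>
     (\<forall>g\<^sub>0. ((\<lambda>g. Lp_norm p M (\<lambda>x. F g x - F g\<^sub>0 x)) \<longlongrightarrow> 0) (at g\<^sub>0))"

text \<open>The group of bijective linear isometries; injectivity follows from preservation of the norm.\<close>

definition Lp_isometry ::
    "real \<Rightarrow> 'x measure \<Rightarrow> (('x \<Rightarrow> complex) \<Rightarrow> ('x \<Rightarrow> complex)) \<Rightarrow> bool" where
  "Lp_isometry p M U \<longleftrightarrow>
     (\<forall>f\<in>Lp p M. U f \<in> Lp p M) \<and>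
     (\<forall>f\<in>Lp p M. \<forall>f'\<in>Lp p M. ae_eq M f f' \<longrightarrow> ae_eq M (U f) (U f')) \<and>
     (\<forall>f\<in>Lp p M. \<forall>f'\<in>Lp p M. ae_eq M (U (\<lambda>x. f x + f' x)) (\<lambda>x. U f x + U f' x)) \<and>
     (\<forall>c. \<forall>f\<in>Lp p M. ae_eq M (U (\<lambda>x. c * f x)) (\<lambda>x. c * U f x)) \<and>
     (\<forall>f\<in>Lp p M. Lp_norm p M (U f) = Lp_norm p M f) \<and>
     (\<forall>f'\<in>Lp p M. \<exists>f\<in>Lp p M. ae_eq M (U f) f')"

section \<open>Orthogonal representations\<close>

text \<open>
  Groups are given by the library class of (not necessarily commutative) topological groups,
  whose group law is written additively.
\<close>

definition orthogonal_representation ::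
    "real \<Rightarrow> 'x measure \<Rightarrow> ('g::topological_group_add \<Rightarrow> ('x \<Rightarrow> complex) \<Rightarrow> ('x \<Rightarrow> complex)) \<Rightarrow> bool"
  where
  "orthogonal_representation p M \<pi> \<longleftrightarrow>
     (\<forall>g. Lp_isometry p M (\<pi> g)) \<and>
     (\<forall>g h. \<forall>f\<in>Lp p M. ae_eq M (\<pi> (g + h) f) (\<pi> g (\<pi> h f))) \<and>
     (\<forall>f\<in>Lp p M. Lp_continuous p M (\<lambda>g. \<pi> g f))"

text \<open>
  The measure whose density with respect to \<open>M\<close> enters the Banach--Lamperti formula is
  \<open>A \<mapsto> M (\<phi> A)\<close>, the image of \<open>M\<close> under the inverse of \<open>\<phi>\<close>: this is the choice that makes
  \<open>f \<mapsto> h \<cdot> density\<^bsup>1/p\<^esup> \<cdot> (f \<circ> \<phi>)\<close> isometric.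
\<close>

definition pullback_measure :: "'x measure \<Rightarrow> ('x \<Rightarrow> 'x) \<Rightarrow> 'x measure" where
  "pullback_measure M \<phi> = distr M M (the_inv_into (space M) \<phi>)"

definition class_preserving :: "'x measure \<Rightarrow> ('x \<Rightarrow> 'x) \<Rightarrow> bool" where
  "class_preserving M \<phi> \<longleftrightarrow>
     bij_betw \<phi> (space M) (space M) \<and> \<phi> \<in> measurable M M \<and>
     the_inv_into (space M) \<phi> \<in> measurable M M \<and>
     absolutely_continuous M (pullback_measure M \<phi>) \<and>
     absolutely_continuous (pullback_measure M \<phi>) M"

definition BL_form ::
    "real \<Rightarrow> 'x measure \<Rightarrow> (('x \<Rightarrow> complex) \<Rightarrow> ('x \<Rightarrow> complex)) \<Rightarrow>
     ('x \<Rightarrow> complex) \<Rightarrow> ('x \<Rightarrow> 'x) \<Rightarrow> bool" where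
  "BL_form p M U h \<phi> \<longleftrightarrow>
     h \<in> borel_measurable M \<and> (\<forall>x\<in>space M. norm (h x) = 1) \<and> class_preserving M \<phi> \<and>
     (\<forall>f\<in>Lp p M. ae_eq M (U f)
        (\<lambda>x. h x * of_real (enn2real (RN_deriv M (pullback_measure M \<phi>) x) powr (1 / p)) * f (\<phi> x)))"

text \<open>
  \<open>\<phi>\<close> is the associated action: \<open>\<phi> g\<close> is determined by \<open>\<pi> g\<close> up to null sets, and
  \<open>\<phi> (g + h) = \<phi> h \<circ> \<phi> g\<close> holds almost everywhere.
\<close>

definition BL_representation ::
    "real \<Rightarrow> 'x measure \<Rightarrow> ('g::topological_group_add \<Rightarrow> ('x \<Rightarrow> complex) \<Rightarrow> ('x \<Rightarrow> complex)) \<Rightarrow>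
     ('g \<Rightarrow> 'x \<Rightarrow> complex) \<Rightarrow> ('g \<Rightarrow> 'x \<Rightarrow> 'x) \<Rightarrow> bool" where
  "BL_representation p M \<pi> h \<phi> \<longleftrightarrow>
     orthogonal_representation p M \<pi> \<and> (\<forall>g. BL_form p M (\<pi> g) (h g) (\<phi> g))"

definition measure_preserving_action :: "'x measure \<Rightarrow> ('g \<Rightarrow> 'x \<Rightarrow> 'x) \<Rightarrow> bool" where
  "measure_preserving_action M \<phi> \<longleftrightarrow> (\<forall>g. \<phi> g \<in> measurable M M \<and> distr M M (\<phi> g) = M)"

text \<open>Invariance of sets is understood modulo null sets, as the action is only defined so.\<close>

definition ergodic_action :: "'x measure \<Rightarrow> ('g \<Rightarrow> 'x \<Rightarrow> 'x) \<Rightarrow> bool" where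
  "ergodic_action M \<phi> \<longleftrightarrow>
     (\<forall>A\<in>sets M. (\<forall>g. AE x in M. \<phi> g x \<in> A \<longleftrightarrow> x \<in> A) \<longrightarrow>
        emeasure M A = 0 \<or> emeasure M (space M - A) = 0)"

definition mazur :: "real \<Rightarrow> real \<Rightarrow> ('x \<Rightarrow> complex) \<Rightarrow> ('x \<Rightarrow> complex)" where
  "mazur p q f = (\<lambda>x. sgn (f x) * of_real (norm (f x) powr (p / q)))"

definition mazur_conj ::
    "real \<Rightarrow> real \<Rightarrow> ('g \<Rightarrow> ('x \<Rightarrow> complex) \<Rightarrow> ('x \<Rightarrow> complex)) \<Rightarrow>
     'g \<Rightarrow> ('x \<Rightarrow> complex) \<Rightarrow> ('x \<Rightarrow> complex)" where
  "mazur_conj p q \<pi> g = mazur p q \<circ> \<pi> g \<circ> mazur q p"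

section \<open>First cohomology\<close>

definition cocycles ::
    "real \<Rightarrow> 'x measure \<Rightarrow> ('g::topological_group_add \<Rightarrow> ('x \<Rightarrow> complex) \<Rightarrow> ('x \<Rightarrow> complex)) \<Rightarrow>
     ('g \<Rightarrow> 'x \<Rightarrow> complex) set" where
  "cocycles p M \<rho> =
     {b. (\<forall>g. b g \<in> Lp p M) \<and> Lp_continuous p M b \<and>
         (\<forall>g h. ae_eq M (b (g + h)) (\<lambda>x. b g x + \<rho> g (b h) x))}"

definition coboundaries ::
    "real \<Rightarrow> 'x measure \<Rightarrow> ('g::topological_group_add \<Rightarrow> ('x \<Rightarrow> complex) \<Rightarrow> ('x \<Rightarrow> complex)) \<Rightarrow>
     ('g \<Rightarrow> 'x \<Rightarrow> complex) set" where
  "coboundaries p M \<rho> =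
     {b \<in> cocycles p M \<rho>. \<exists>f\<in>Lp p M. \<forall>g. ae_eq M (b g) (\<lambda>x. f x - \<rho> g f x)}"

text \<open>The zero element of the quotient is the coset \<open>coboundaries p M \<rho>\<close>.\<close>

definition H1 ::
    "real \<Rightarrow> 'x measure \<Rightarrow> ('g::topological_group_add \<Rightarrow> ('x \<Rightarrow> complex) \<Rightarrow> ('x \<Rightarrow> complex)) \<Rightarrow>
     ('g \<Rightarrow> 'x \<Rightarrow> complex) set set" where
  "H1 p M \<rho> = cocycles p M \<rho> //
     {(b, c). b \<in> cocycles p M \<rho> \<and> c \<in> cocycles p M \<rho> \<and>
              (\<lambda>g x. b g x - c g x) \<in> coboundaries p M \<rho>}"

definition fixed_point_spectrum ::
    "real \<Rightarrow> 'x measure \<Rightarrow> ('g::topological_group_add \<Rightarrow> ('x \<Rightarrow> complex) \<Rightarrow> ('x \<Rightarrow> complex)) \<Rightarrow>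
     real set" where
  "fixed_point_spectrum p M \<pi> =
     {q. 1 \<le> q \<and> H1 q M (mazur_conj p q \<pi>) = {coboundaries q M (mazur_conj p q \<pi>)}}"

section \<open>Property (T)\<close>

text \<open>
  A complex Hilbert space is carried by a linear subspace \<open>H\<close> of an ambient complex vector space;
  nothing is required of the inner product \<open>ip\<close> outside \<open>H\<close>.
\<close>

locale complex_hilbert_space = vector_space smul
  for smul :: "complex \<Rightarrow> 'v::ab_group_add \<Rightarrow> 'v" +
  fixes H :: "'v set" and ip :: "'v \<Rightarrow> 'v \<Rightarrow> complex"
  assumes subspace_H: "subspace H"
    and ip_add: "\<And>x y z. \<lbrakk>x \<in> H; y \<in> H; z \<in> H\<rbrakk> \<Longrightarrow> ip (x + y) z = ip x z + ip y z"
    and ip_scale: "\<And>c x y. \<lbrakk>x \<in> H; y \<in> H\<rbrakk> \<Longrightarrow> ip (smul c x) y = c * ip x y"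
    and ip_cnj: "\<And>x y. \<lbrakk>x \<in> H; y \<in> H\<rbrakk> \<Longrightarrow> ip y x = cnj (ip x y)"
    and ip_pos: "\<And>x. \<lbrakk>x \<in> H; x \<noteq> 0\<rbrakk> \<Longrightarrow> 0 < Re (ip x x)"
    and complete_H: "\<And>s :: nat \<Rightarrow> 'v. \<lbrakk>range s \<subseteq> H;
        \<And>e. 0 < e \<Longrightarrow> \<exists>N. \<forall>m\<ge>N. \<forall>n\<ge>N. sqrt (Re (ip (s m - s n) (s m - s n))) < e\<rbrakk>
        \<Longrightarrow> \<exists>l\<in>H. (\<lambda>n. sqrt (Re (ip (s n - l) (s n - l)))) \<longlonglongrightarrow> 0"

definition ip_norm :: "('v \<Rightarrow> 'v \<Rightarrow> complex) \<Rightarrow> 'v \<Rightarrow> real" where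
  "ip_norm ip v = sqrt (Re (ip v v))"

definition unitary_representation ::
    "(complex \<Rightarrow> 'v::ab_group_add \<Rightarrow> 'v) \<Rightarrow> 'v set \<Rightarrow> ('v \<Rightarrow> 'v \<Rightarrow> complex) \<Rightarrow>
     ('g::topological_group_add \<Rightarrow> 'v \<Rightarrow> 'v) \<Rightarrow> bool" where
  "unitary_representation smul H ip U \<longleftrightarrow>
     complex_hilbert_space smul H ip \<and>
     (\<forall>g. bij_betw (U g) H H \<and>
        (\<forall>v\<in>H. \<forall>w\<in>H. U g (v + w) = U g v + U g w) \<and>
        (\<forall>c. \<forall>v\<in>H. U g (smul c v) = smul c (U g v)) \<and>
        (\<forall>v\<in>H. \<forall>w\<in>H. ip (U g v) (U g w) = ip v w)) \<and>
     (\<forall>g h. \<forall>v\<in>H. U (g + h) v = U g (U h v)) \<and>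
     (\<forall>v\<in>H. \<forall>g\<^sub>0. ((\<lambda>g. ip_norm ip (U g v - U g\<^sub>0 v)) \<longlongrightarrow> 0) (at g\<^sub>0))"

text \<open>
  Kazhdan's property (T): some compact set \<open>Q\<close> and some \<open>\<epsilon> > 0\<close> are such that every unitary
  representation with a \<open>(Q, \<epsilon>)\<close>-invariant vector has a nonzero invariant vector.
  Since one cannot quantify over types inside a formula, the Hilbert spaces are taken inside the
  set of functions \<open>'g \<Rightarrow> complex\<close>, with an arbitrary scalar multiplication and inner product.
  This is no restriction: the closed invariant subspace generated by a \<open>(Q, \<epsilon>)\<close>-invariant vector
  \<open>\<xi>\<close> is linearly isomorphic to a space of functions on the group via
  \<open>v \<mapsto> (\<lambda>g. \<langle>v, U g \<xi>\<rangle>)\<close>.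
\<close>

definition property_T :: "'g::topological_group_add itself \<Rightarrow> bool" where
  "property_T _ \<longleftrightarrow>
     (\<exists>(Q :: 'g set) \<epsilon>. compact Q \<and> 0 < \<epsilon> \<and>
        (\<forall>smul (H :: ('g \<Rightarrow> complex) set) ip (U :: 'g \<Rightarrow> ('g \<Rightarrow> complex) \<Rightarrow> ('g \<Rightarrow> complex)).
           unitary_representation smul H ip U \<and>
           (\<exists>\<xi>\<in>H. \<xi> \<noteq> 0 \<and> (\<forall>g\<in>Q. ip_norm ip (U g \<xi> - \<xi>) < \<epsilon> * ip_norm ip \<xi>)) \<longrightarrow>
           (\<exists>\<eta>\<in>H. \<eta> \<noteq> 0 \<and> (\<forall>g. U g \<eta> = \<eta>))))"

end

theory Submission
  imports Defs
begin

text \<open>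
  Since the action preserves the measure, the Mazur conjugates \<open>\<pi>\<^sup>q\<close> are all given by one formula,
  \<open>f \<mapsto> h g * (f \<circ> \<phi> g)\<close>, which makes sense for every measurable \<open>f\<close> (locale \<open>twisted_action\<close>, operator
  \<open>koop\<close>). As \<open>M\<close> is finite, a cocycle with exponent \<open>q\<close> is also one for every smaller exponent, and
  by ergodicity an invariant measurable function has constant modulus, so that primitives are unique up
  to bounded functions. The question becomes whether a primitive has the right integrability.

  \<^emph>\<open>Interval.\<close> Let \<open>q\<^sub>1 \<le> q \<le> q\<^sub>2\<close> and let cocycles be trivial for \<open>q\<^sub>1\<close> and \<open>q\<^sub>2\<close>. A cocycle for \<open>q\<close>
  has a primitive \<open>f\<close> in \<open>L\<^sub>q\<^sub>1\<close>. The map \<open>z \<mapsto> sgn z * \<bar>z\<bar>\<^sup>q\<^sup>/\<^sup>q\<^sup>2\<close> is Hoelder continuous and commutes with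
  rotations, hence the displacements of its composition \<open>F\<close> with \<open>f\<close> form a cocycle for \<open>q\<^sub>2\<close>. So \<open>F\<close>
  agrees up to a bounded function with an element of \<open>L\<^sub>q\<^sub>2\<close>, which means that \<open>f\<close> lies in \<open>L\<^sub>q\<close>
  (\<open>cocycles_trivial_between\<close>).

  \<^emph>\<open>Property (T).\<close> Here cocycles are trivial for every exponent, so the spectrum is all of \<open>[1, \<infinity>)\<close>.
  First, every cocycle \<open>b\<close> has a measurable primitive (\<open>exists_primitive\<close>). The isometries
  \<open>w \<mapsto> h g x * w + b g x\<close> of the plane define a measure-preserving skew product on \<open>M \<times> \<complex>\<close>. The
  indicator of a large disc bundle is almost invariant under it, because the displacement of a disc
  of radius \<open>R\<close> has relative size \<open>O (\<bar>b g x\<bar> / R)\<close> and \<open>b\<close> is bounded in \<open>L\<^sub>1\<close> on the compact Kazhdan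
  set. Property (T) gives an invariant vector, whose squared modulus is an equivariant family of mass
  distributions on the plane; a suitable centre of these is an equivariant section, that is, a
  primitive.

  Second, property (T) gives a spectral gap for the twisted Koopman representation on \<open>L\<^sub>2\<close>
  (\<open>spectral_gap\<close>). Applied to \<open>sgn f * \<bar>f\<bar>\<^sup>q\<^sup>/\<^sup>2\<close>, with \<open>f\<close> replaced by bounded approximations, it
  bounds the \<open>q\<close>-th moment of a measurable \<open>f\<close> in terms of the \<open>q\<close>-th moments of its displacements
  (\<open>primitive_in_Lp\<close>).

  Property (T) is stated for Hilbert spaces of functions on the group. A concrete representation on
  \<open>L\<^sub>2\<close> of a measure space is brought into that form by sending a vector \<open>v\<close> of the cyclic subspace of
  \<open>\<xi>\<close> to its matrix coefficient \<open>k \<mapsto> \<langle>v, U k \<xi>\<rangle>\<close> (\<open>kazhdan_invariant_vector\<close>).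
\<close>

section \<open>Square-integrable functions\<close>

definition L2 :: "'y measure \<Rightarrow> ('y \<Rightarrow> complex) set" where
  "L2 N = {v \<in> borel_measurable N. integrable N (\<lambda>y. (norm (v y))\<^sup>2)}"

definition sqnorm :: "'y measure \<Rightarrow> ('y \<Rightarrow> complex) \<Rightarrow> real" where
  "sqnorm N v = (LINT y|N. (norm (v y))\<^sup>2)"

definition inner2 :: "'y measure \<Rightarrow> ('y \<Rightarrow> complex) \<Rightarrow> ('y \<Rightarrow> complex) \<Rightarrow> complex" where
  "inner2 N v w = (LINT y|N. v y * cnj (w y))"

lemma borel_measurable_cnj [measurable (raw)]:
  "f \<in> borel_measurable N \<Longrightarrow> (\<lambda>y. cnj (f y)) \<in> borel_measurable N"
  by (rule measurable_compose[OF _ borel_measurable_continuous_onI[of cnj]]) (auto intro: continuous_intros)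

lemma L2_integrable: "v \<in> L2 N \<Longrightarrow> integrable N (\<lambda>y. (norm (v y))\<^sup>2)"
  by (auto simp: L2_def)

lemma norm_add_sq_le: "(norm (a + b :: complex))\<^sup>2 \<le> 2 * (norm a)\<^sup>2 + 2 * (norm b)\<^sup>2"
proof -
  have "(norm (a + b))\<^sup>2 \<le> (norm a + norm b)\<^sup>2"
    by (intro power_mono norm_triangle_ineq) auto
  also have "\<dots> \<le> 2 * (norm a)\<^sup>2 + 2 * (norm b)\<^sup>2"
    using sum_squares_bound[of "norm a" "norm b"] by (simp add: power2_sum)
  finally show ?thesis .
qed

lemma L2_add:
  assumes "v \<in> L2 N" "w \<in> L2 N"
  shows "v + w \<in> L2 N"
proof -
  have [measurable]: "v \<in> borel_measurable N" "w \<in> borel_measurable N"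
    using assms by (auto simp: L2_def)
  have "integrable N (\<lambda>y. (norm (v y + w y))\<^sup>2)"
    by (rule Bochner_Integration.integrable_bound[where f = "\<lambda>y. 2 * (norm (v y))\<^sup>2 + 2 * (norm (w y))\<^sup>2"])
       (use assms norm_add_sq_le in \<open>auto simp: L2_def\<close>)
  then show ?thesis by (auto simp: L2_def plus_fun_def)
qed

lemma L2_scale: "v \<in> L2 N \<Longrightarrow> (\<lambda>y. c * v y) \<in> L2 N"
  by (auto simp: L2_def norm_mult power_mult_distrib)

lemma L2_zero: "0 \<in> L2 N"
  by (auto simp: L2_def zero_fun_def)

lemma L2_uminus: "v \<in> L2 N \<Longrightarrow> - v \<in> L2 N"
  by (auto simp: L2_def fun_Compl_def)

lemma L2_diff: "v \<in> L2 N \<Longrightarrow> w \<in> L2 N \<Longrightarrow> v - w \<in> L2 N"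
  using L2_add[OF _ L2_uminus, of v N w] by simp

lemma sqnorm_nonneg [simp]: "0 \<le> sqnorm N v"
  by (simp add: sqnorm_def)

lemma sqnorm_add_le:
  assumes "v \<in> L2 N" "w \<in> L2 N"
  shows "sqnorm N (v + w) \<le> 2 * sqnorm N v + 2 * sqnorm N w"
proof -
  have "sqnorm N (v + w) \<le> (LINT y|N. 2 * (norm (v y))\<^sup>2 + 2 * (norm (w y))\<^sup>2)"
    unfolding sqnorm_def using L2_add[OF assms] assms
    by (intro integral_mono) (auto simp: L2_def intro: norm_add_sq_le)
  then show ?thesis using assms by (simp add: sqnorm_def L2_def)
qed

lemma sqnorm_uminus [simp]: "sqnorm N (- v) = sqnorm N v"
  by (simp add: sqnorm_def)

lemma sqnorm_minus_commute: "sqnorm N (v - w) = sqnorm N (w - v)"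
  by (simp add: sqnorm_def norm_minus_commute)

lemma sqnorm_scale: "sqnorm N (\<lambda>y. c * v y) = (norm c)\<^sup>2 * sqnorm N v"
  by (simp add: sqnorm_def norm_mult power_mult_distrib)

lemma sqnorm_eq_0_iff:
  assumes "v \<in> L2 N"
  shows "sqnorm N v = 0 \<longleftrightarrow> (AE y in N. v y = 0)"
  using integral_nonneg_eq_0_iff_AE[OF L2_integrable[OF assms]] by (simp add: sqnorm_def)

lemma integrable_inner2:
  assumes "v \<in> L2 N" "w \<in> L2 N"
  shows "integrable N (\<lambda>y. v y * cnj (w y))"
proof -
  have [measurable]: "v \<in> borel_measurable N" "w \<in> borel_measurable N"
    using assms by (auto simp: L2_def)
  show ?thesis
  proof (rule Bochner_Integration.integrable_bound[where f = "\<lambda>y. (norm (v y))\<^sup>2 + (norm (w y))\<^sup>2"])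
    show "AE y in N. norm (v y * cnj (w y)) \<le> norm ((norm (v y))\<^sup>2 + (norm (w y))\<^sup>2)"
    proof (rule AE_I2)
      fix y
      have "2 * (norm (v y) * norm (w y)) \<le> (norm (v y))\<^sup>2 + (norm (w y))\<^sup>2"
        using sum_squares_bound[of "norm (v y)" "norm (w y)"] by (simp add: mult.assoc)
      moreover have "0 \<le> norm (v y) * norm (w y)" by simp
      ultimately have "norm (v y) * norm (w y) \<le> (norm (v y))\<^sup>2 + (norm (w y))\<^sup>2" by linarith
      then show "norm (v y * cnj (w y)) \<le> norm ((norm (v y))\<^sup>2 + (norm (w y))\<^sup>2)"
        by (simp add: norm_mult)
    qed
    show "(\<lambda>y. v y * cnj (w y)) \<in> borel_measurable N"
      by measurable
  qed (use assms in \<open>auto simp: L2_def\<close>)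
qed

lemma inner2_add_left:
  "u \<in> L2 N \<Longrightarrow> v \<in> L2 N \<Longrightarrow> w \<in> L2 N \<Longrightarrow> inner2 N (u + v) w = inner2 N u w + inner2 N v w"
  unfolding inner2_def
  by (simp add: distrib_right integrable_inner2 flip: Bochner_Integration.integral_add)

lemma inner2_add_right:
  "u \<in> L2 N \<Longrightarrow> v \<in> L2 N \<Longrightarrow> w \<in> L2 N \<Longrightarrow> inner2 N u (v + w) = inner2 N u v + inner2 N u w"
  unfolding inner2_def
  by (simp add: distrib_left integrable_inner2 flip: Bochner_Integration.integral_add)

lemma inner2_scale_left: "inner2 N (\<lambda>y. c * v y) w = c * inner2 N v w"
  unfolding inner2_def by (simp add: mult.assoc)

lemma inner2_scale_right: "inner2 N v (\<lambda>y. c * w y) = cnj c * inner2 N v w"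
  unfolding inner2_def by (simp add: mult.left_commute)

lemma inner2_cnj: "inner2 N w v = cnj (inner2 N v w)"
  unfolding inner2_def Bochner_Integration.integral_cnj[symmetric] by (simp add: mult.commute)

lemma inner2_self: "inner2 N v v = of_real (sqnorm N v)"
  unfolding inner2_def sqnorm_def integral_complex_of_real[symmetric]
  by (simp only: complex_norm_square)

lemma inner2_cong_AE:
  assumes "v \<in> L2 N" "v' \<in> L2 N" "w \<in> L2 N" "w' \<in> L2 N"
    and "AE y in N. v y = v' y" "AE y in N. w y = w' y"
  shows "inner2 N v w = inner2 N v' w'"
  unfolding inner2_def
  by (rule integral_cong_AE)
     (use assms integrable_inner2 in \<open>auto intro!: borel_measurable_integrable\<close>)

lemma sqnorm_cong_AE:
  assumes "v \<in> L2 N" "v' \<in> L2 N" "AE y in N. v y = v' y"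
  shows "sqnorm N v = sqnorm N v'"
  using inner2_cong_AE[OF assms(1,2,1,2,3,3)] by (simp add: inner2_self)

lemma norm_inner2_le:
  assumes v: "v \<in> L2 N" and w: "w \<in> L2 N"
  shows "(norm (inner2 N v w))\<^sup>2 \<le> sqnorm N v * sqnorm N w"
proof -
  let ?c = "norm (inner2 N v w)" and ?a = "sqnorm N v" and ?b = "sqnorm N w"
  have bound: "2 * ?c \<le> t * ?a + ?b / t" if t: "0 < t" for t
  proof -
    have pt: "2 * norm (v y * cnj (w y)) \<le> t * (norm (v y))\<^sup>2 + (norm (w y))\<^sup>2 / t" for y
    proof -
      have "0 \<le> (t * norm (v y) - norm (w y))\<^sup>2 / t" using t by simp
      also have "\<dots> = t * (norm (v y))\<^sup>2 + (norm (w y))\<^sup>2 / t - 2 * (norm (v y) * norm (w y))"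
        using t by (simp add: power2_diff field_simps power2_eq_square)
      finally show ?thesis by (simp add: norm_mult)
    qed
    have "2 * ?c \<le> 2 * (LINT y|N. norm (v y * cnj (w y)))"
      unfolding inner2_def using integral_norm_bound by simp
    also have "\<dots> = (LINT y|N. 2 * norm (v y * cnj (w y)))" by simp
    also have "\<dots> \<le> (LINT y|N. t * (norm (v y))\<^sup>2 + (norm (w y))\<^sup>2 / t)"
      using v w by (intro integral_mono pt integrable_mult_right integrable_norm integrable_inner2)
                   (auto simp: L2_def)
    also have "\<dots> = t * ?a + ?b / t"
      using v w by (simp add: sqnorm_def L2_def)
    finally show ?thesis .
  qed
  have zero: "?c = 0" if "?a = 0 \<or> ?b = 0"
  proof -
    have "AE y in N. v y * cnj (w y) = 0"
      using that sqnorm_eq_0_iff[OF v] sqnorm_eq_0_iff[OF w] by (auto elim: AE_mp)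
    then have "inner2 N v w = 0" unfolding inner2_def by (rule integral_eq_zero_AE)
    then show ?thesis by simp
  qed
  show ?thesis
  proof (cases "?a = 0 \<or> ?b = 0")
    case True
    with zero show ?thesis by auto
  next
    case False
    then have a: "0 < ?a" and b: "0 < ?b" using sqnorm_nonneg[of N] by (auto simp: order_le_less)
    define s where "s = sqrt ?a" define r where "r = sqrt ?b"
    have sr: "0 < s" "0 < r" "?a = s\<^sup>2" "?b = r\<^sup>2" using a b by (auto simp: s_def r_def)
    have "2 * ?c \<le> r / s * ?a + ?b / (r / s)" using bound[of "r / s"] sr by simp
    also have "\<dots> = 2 * (s * r)" using sr(1,2) by (simp add: sr(3,4) power2_eq_square)
    finally have "?c \<le> s * r" by simp
    then have "?c\<^sup>2 \<le> (s * r)\<^sup>2" by (rule power_mono) simp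
    then show ?thesis by (simp add: sr(3,4) power_mult_distrib)
  qed
qed

lemma sqnorm_nn_integral: "(\<integral>\<^sup>+p. ennreal ((norm (v p))\<^sup>2) \<partial>N) = ennreal (sqnorm N v)" if "v \<in> L2 N"
  using that unfolding sqnorm_def by (intro nn_integral_eq_integral) (auto simp: L2_def)

lemma L2I_nn_integral:
  fixes v :: "'y \<Rightarrow> complex"
  assumes "v \<in> borel_measurable N" "(\<integral>\<^sup>+p. ennreal ((norm (v p))\<^sup>2) \<partial>N) < \<infinity>"
  shows "v \<in> L2 N"
  using assms unfolding L2_def by (auto intro!: integrableI_bounded)

lemma L2_fatou:
  assumes v: "\<And>n. v n \<in> L2 N" and l[measurable]: "l \<in> borel_measurable N"
    and lim: "AE y in N. (\<lambda>n. v n y) \<longlonglongrightarrow> l y"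
    and bd: "eventually (\<lambda>n. sqnorm N (v n) \<le> B) sequentially"
  shows "l \<in> L2 N" "sqnorm N l \<le> B"
proof -
  have [measurable]: "v n \<in> borel_measurable N" for n using v by (auto simp: L2_def)
  have B0: "0 \<le> B"
  proof -
    obtain n where "sqnorm N (v n) \<le> B"
      using bd by (auto simp: eventually_sequentially)
    then show ?thesis using sqnorm_nonneg[of N "v n"] by linarith
  qed
  have nn: "(\<integral>\<^sup>+ y. ennreal ((norm (v n y))\<^sup>2) \<partial>N) = ennreal (sqnorm N (v n))" for n
    by (rule sqnorm_nn_integral[OF v])
  have "(\<integral>\<^sup>+ y. ennreal ((norm (l y))\<^sup>2) \<partial>N) = (\<integral>\<^sup>+ y. liminf (\<lambda>n. ennreal ((norm (v n y))\<^sup>2)) \<partial>N)"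
  proof (rule nn_integral_cong_AE)
    show "AE y in N. ennreal ((norm (l y))\<^sup>2) = liminf (\<lambda>n. ennreal ((norm (v n y))\<^sup>2))"
      using lim
    proof eventually_elim
      case (elim y)
      then have "(\<lambda>n. ennreal ((norm (v n y))\<^sup>2)) \<longlonglongrightarrow> ennreal ((norm (l y))\<^sup>2)"
        by (intro tendsto_ennrealI tendsto_intros)
      then show ?case by (rule lim_imp_Liminf[OF sequentially_bot, symmetric])
    qed
  qed
  also have "\<dots> \<le> liminf (\<lambda>n. \<integral>\<^sup>+ y. ennreal ((norm (v n y))\<^sup>2) \<partial>N)"
    by (rule nn_integral_liminf) simp
  also have "\<dots> \<le> liminf (\<lambda>n. ennreal B)"
    unfolding nn by (intro Liminf_mono) (use bd in \<open>auto elim!: eventually_mono intro: ennreal_leI\<close>)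
  also have "\<dots> = ennreal B" by (simp add: Liminf_const)
  finally have le: "(\<integral>\<^sup>+ y. ennreal ((norm (l y))\<^sup>2) \<partial>N) \<le> ennreal B" .
  then have int: "integrable N (\<lambda>y. (norm (l y))\<^sup>2)"
    by (intro integrableI_bounded) (auto simp: le_less_trans)
  then show "l \<in> L2 N" by (auto simp: L2_def)
  have "(\<integral>\<^sup>+ y. ennreal ((norm (l y))\<^sup>2) \<partial>N) = ennreal (sqnorm N l)"
    unfolding sqnorm_def by (intro nn_integral_eq_integral int) auto
  with le B0 show "sqnorm N l \<le> B" by simp
qed

text \<open>
  Riesz--Fischer. Along a subsequence with \<open>\<parallel>s\<^sub>k\<^sub>+\<^sub>1 - s\<^sub>k\<parallel>\<^sup>2 \<le> 8\<^sup>-\<^sup>k\<close> the series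
  \<open>\<Sum> 4\<^sup>k \<bar>s\<^sub>k\<^sub>+\<^sub>1 - s\<^sub>k\<bar>\<^sup>2\<close> has finite integral, so almost everywhere the increments are
  dominated by a multiple of \<open>2\<^sup>-\<^sup>k\<close> and the subsequence converges; Fatou's lemma identifies
  the limit.
\<close>

lemma L2_complete:
  assumes s: "\<And>n. s n \<in> L2 N"
    and cauchy: "\<And>e. 0 < e \<Longrightarrow> \<exists>K. \<forall>m\<ge>K. \<forall>n\<ge>K. sqnorm N (s m - s n) < e"
  shows "\<exists>l\<in>L2 N. (\<lambda>n. sqnorm N (s n - l)) \<longlonglongrightarrow> 0"
proof -
  have [measurable]: "s n \<in> borel_measurable N" for n using s by (auto simp: L2_def)
  obtain K where K: "\<And>k m n. K k \<le> m \<Longrightarrow> K k \<le> n \<Longrightarrow> sqnorm N (s m - s n) < (1/8)^k"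
    using cauchy[of "(1/8)^_"] by (metis zero_less_divide_1_iff zero_less_numeral zero_less_power)
  \<comment> \<open>The summand \<open>k\<close> makes the subsequence strictly increasing.\<close>
  define r where "r k = (\<Sum>i\<le>k. K i) + k" for k
  have rK: "K k \<le> r k" for k
    unfolding r_def using member_le_sum[of k "{..k}" K] by simp
  have r_Suc: "r k < r (Suc k)" for k by (simp add: r_def)
  then have r: "strict_mono r" by (simp add: strict_mono_Suc_iff)
  define d where "d k = s (r (Suc k)) - s (r k)" for k
  have [measurable]: "d k \<in> borel_measurable N" for k
    by (simp add: d_def fun_diff_def)
  have d: "d k \<in> L2 N" for k unfolding d_def by (intro L2_diff s)
  have dK: "sqnorm N (d k) \<le> (1/8)^k" for k
    unfolding d_def using rK[of k] r_Suc[of k] by (intro less_imp_le[OF K]) linarith+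
  have "(\<integral>\<^sup>+ y. (\<Sum>k. ennreal (4^k * (norm (d k y))\<^sup>2)) \<partial>N)
      = (\<Sum>k. \<integral>\<^sup>+ y. ennreal (4^k * (norm (d k y))\<^sup>2) \<partial>N)"
    by (rule nn_integral_suminf) simp
  also have "\<dots> \<le> (\<Sum>k. ennreal ((1/2)^k))"
  proof (rule suminf_le)
    fix k
    have "(\<integral>\<^sup>+ y. ennreal (4^k * (norm (d k y))\<^sup>2) \<partial>N) = ennreal (4^k * sqnorm N (d k))"
      unfolding sqnorm_def using d[of k]
      by (subst nn_integral_eq_integral) (auto simp: L2_def)
    also have "\<dots> \<le> ennreal (4^k * (1/8)^k)"
      by (intro ennreal_leI mult_left_mono dK) simp
    also have "4^k * (1/8)^k = ((1/2)^k :: real)"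
      by (simp add: flip: power_mult_distrib)
    finally show "(\<integral>\<^sup>+ y. ennreal (4^k * (norm (d k y))\<^sup>2) \<partial>N) \<le> ennreal ((1/2)^k)" .
  qed auto
  also have "\<dots> = ennreal (\<Sum>k. (1/2)^k)"
    by (rule suminf_ennreal2) (auto intro: summable_geometric)
  also have "\<dots> < \<infinity>" by simp
  finally have "AE y in N. (\<Sum>k. ennreal (4^k * (norm (d k y))\<^sup>2)) \<noteq> \<infinity>"
    by (intro nn_integral_PInf_AE) auto
  then have conv: "AE y in N. convergent (\<lambda>k. s (r k) y)"
  proof eventually_elim
    case (elim y)
    define C where "C = enn2real (\<Sum>k. ennreal (4^k * (norm (d k y))\<^sup>2))"
    have C1: "0 \<le> C" unfolding C_def by (rule enn2real_nonneg)
    have C2: "(\<Sum>k. ennreal (4^k * (norm (d k y))\<^sup>2)) = ennreal C"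
      unfolding C_def using elim
      by (intro ennreal_enn2real[symmetric]) (simp only: top.not_eq_extremum infinity_ennreal_def)
    have dC: "norm (d k y) \<le> sqrt C * (1/2)^k" for k
    proof -
      have "(\<Sum>i\<in>{k}. ennreal (4^i * (norm (d i y))\<^sup>2)) \<le> (\<Sum>i. ennreal (4^i * (norm (d i y))\<^sup>2))"
        by (intro sum_le_suminf summableI) simp_all
      then have "ennreal (4^k * (norm (d k y))\<^sup>2) \<le> ennreal C"
        by (simp only: C2 sum.insert sum.empty finite.emptyI empty_iff not_False_eq_True add_0_right)
      then have "4^k * (norm (d k y))\<^sup>2 \<le> C" by (simp only: ennreal_le_iff[OF C1])
      then have "(2^k * norm (d k y))\<^sup>2 \<le> C"
        using power_mult_distrib[of "2::real" 2 k]
        by (simp add: power_mult_distrib power2_eq_square[of "2^k"] )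
      then have "2^k * norm (d k y) \<le> sqrt C" by (rule real_le_rsqrt)
      then show ?thesis by (simp add: field_simps power_one_over)
    qed
    have "summable (\<lambda>k. d k y)"
      by (rule summable_comparison_test'[where g = "\<lambda>k. sqrt C * (1/2)^k" and N = 0])
         (auto intro: dC summable_mult summable_geometric)
    then have "convergent (\<lambda>n. \<Sum>k<n. d k y)" by (simp add: summable_iff_convergent)
    moreover have "(\<Sum>k<n. d k y) = s (r n) y - s (r 0) y" for n
      unfolding d_def fun_diff_def by (rule sum_lessThan_telescope)
    ultimately have "convergent (\<lambda>n. (s (r n) y - s (r 0) y) + s (r 0) y)"
      by (intro convergent_add convergent_const) simp
    then show ?case by simp
  qed
  define l where "l y = lim (\<lambda>k. s (r k) y)" for y
  have [measurable]: "l \<in> borel_measurable N" unfolding l_def by measurable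
  have lim: "AE y in N. (\<lambda>k. s (r k) y) \<longlonglongrightarrow> l y"
    using conv by eventually_elim (simp add: l_def convergent_LIMSEQ_iff)
  have close: "l - s n \<in> L2 N \<and> sqnorm N (l - s n) \<le> e"
    if "0 < e" "\<And>m. M0 \<le> m \<Longrightarrow> sqnorm N (s m - s n) < e" for n e M0
  proof -
    have ev: "eventually (\<lambda>k. sqnorm N (s (r k) - s n) \<le> e) sequentially"
      using eventually_ge_at_top[of M0]
      by eventually_elim (meson less_imp_le order_trans r seq_suble that(2))
    have lim': "AE y in N. (\<lambda>k. (s (r k) - s n) y) \<longlonglongrightarrow> (l - s n) y"
      using lim by eventually_elim (auto intro: tendsto_intros)
    have "l - s n \<in> borel_measurable N" by (simp add: fun_diff_def)
    from L2_fatou[OF L2_diff[OF s s] this lim' ev] show ?thesis by blast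
  qed
  obtain K1 where K1: "\<forall>m\<ge>K1. \<forall>n\<ge>K1. sqnorm N (s m - s n) < 1" using cauchy[of 1] by auto
  have "l - s K1 \<in> L2 N" using close[of 1 K1 K1] K1 by auto
  from L2_add[OF this s[of K1]] have l: "l \<in> L2 N" by simp
  have "(\<lambda>n. sqnorm N (s n - l)) \<longlonglongrightarrow> 0"
  proof (rule LIMSEQ_I)
    fix e :: real assume e: "0 < e"
    obtain K2 where "\<forall>m\<ge>K2. \<forall>n\<ge>K2. sqnorm N (s m - s n) < e/2"
      using cauchy[of "e/2"] e by auto
    then have "sqnorm N (l - s n) \<le> e/2" if "K2 \<le> n" for n
      using close[of "e/2" K2 n] e that by auto
    then show "\<exists>K. \<forall>n\<ge>K. norm (sqnorm N (s n - l) - 0) < e"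
      using e by (intro exI[of _ K2]) (force simp: sqnorm_minus_commute[of N _ l])
  qed
  with l show ?thesis by blast
qed

section \<open>Powers of the modulus\<close>

lemma norm_add_powr_le:
  fixes a b :: complex
  assumes "0 \<le> q"
  shows "norm (a + b) powr q \<le> 2 powr q * (norm a powr q + norm b powr q)"
proof -
  let ?m = "max (norm a) (norm b)"
  have "norm (a + b) \<le> 2 * ?m" using norm_triangle_ineq[of a b] by linarith
  then have "norm (a + b) powr q \<le> (2 * ?m) powr q" using assms by (intro powr_mono2) auto
  also have "\<dots> = 2 powr q * ?m powr q" by (simp add: powr_mult)
  also have "?m powr q \<le> norm a powr q + norm b powr q"
    by (cases "norm a \<le> norm b") (auto simp: max_def)
  finally show ?thesis by simp
qed

lemma norm_diff_powr_le:
  fixes a b :: complex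
  assumes "0 \<le> q"
  shows "norm (a - b) powr q \<le> 2 powr q * (norm a powr q + norm b powr q)"
  using norm_add_powr_le[OF assms, of a "- b"] by simp

lemma Lp_integrable: "f \<in> Lp q N \<Longrightarrow> integrable N (\<lambda>x. norm (f x) powr q)"
  by (simp add: Lp_def)

lemma LpI_bound:
  assumes "f \<in> borel_measurable N" "integrable N g" "AE x in N. norm (f x) powr q \<le> g x"
  shows "f \<in> Lp q N"
proof -
  have [measurable]: "f \<in> borel_measurable N" by fact
  have "integrable N (\<lambda>x. norm (f x) powr q)"
    by (rule Bochner_Integration.integrable_bound[OF assms(2)]) (use assms(3) in \<open>auto elim!: eventually_mono\<close>)
  then show ?thesis by (simp add: Lp_def)
qed

lemma Lp_add:
  assumes "0 \<le> q" "f \<in> Lp q N" "g \<in> Lp q N"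
  shows "(\<lambda>x. f x + g x) \<in> Lp q N"
proof (rule LpI_bound)
  show "integrable N (\<lambda>x. 2 powr q * (norm (f x) powr q + norm (g x) powr q))"
    using assms by (auto simp: Lp_def)
qed (use assms norm_add_powr_le in \<open>auto simp: Lp_def\<close>)

lemma Lp_diff:
  assumes "0 \<le> q" "f \<in> Lp q N" "g \<in> Lp q N"
  shows "(\<lambda>x. f x - g x) \<in> Lp q N"
proof (rule LpI_bound)
  show "integrable N (\<lambda>x. 2 powr q * (norm (f x) powr q + norm (g x) powr q))"
    using assms by (auto simp: Lp_def)
qed (use assms norm_diff_powr_le in \<open>auto simp: Lp_def\<close>)

lemma Lp_cong_AE:
  assumes "f \<in> Lp q N" "g \<in> borel_measurable N" "AE x in N. f x = g x"
  shows "g \<in> Lp q N"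
  by (rule LpI_bound[OF assms(2) Lp_integrable[OF assms(1)]])
     (use assms(3) in \<open>auto elim!: eventually_mono\<close>)

lemma Lp_continuous_iff:
  fixes F :: "'g::topological_space \<Rightarrow> 'y \<Rightarrow> complex"
  assumes q: "0 < q"
  shows "Lp_continuous q N F \<longleftrightarrow>
    (\<forall>g\<^sub>0. ((\<lambda>g. LINT x|N. norm (F g x - F g\<^sub>0 x) powr q) \<longlongrightarrow> 0) (at g\<^sub>0))"
proof -
  have "((\<lambda>g. I g powr (1 / q)) \<longlongrightarrow> 0) G \<longleftrightarrow> (I \<longlongrightarrow> 0) G" if I: "\<And>g. 0 \<le> I g"
    for I :: "'g \<Rightarrow> real" and G
  proof
    assume "((\<lambda>g. I g powr (1 / q)) \<longlongrightarrow> 0) G"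
    then have "((\<lambda>g. (I g powr (1 / q)) powr q) \<longlongrightarrow> 0 powr q) G"
      using q by (intro tendsto_powr' tendsto_const) auto
    then show "(I \<longlongrightarrow> 0) G" using q I by (simp add: powr_powr)
  next
    assume "(I \<longlongrightarrow> 0) G"
    then have "((\<lambda>g. I g powr (1 / q)) \<longlongrightarrow> 0 powr (1 / q)) G"
      using q I by (intro tendsto_powr' tendsto_const) auto
    then show "((\<lambda>g. I g powr (1 / q)) \<longlongrightarrow> 0) G" using q by simp
  qed
  then show ?thesis by (simp add: Lp_continuous_def Lp_norm_def)
qed

text \<open>
  Compares exponents over a finite measure: after integration the first summand is as small as desired.
\<close>

lemma powr_le_interpolate:
  fixes y :: real
  assumes "0 \<le> y" "0 < q" "q \<le> q'" "0 < e"
  shows "y powr q \<le> e powr q + e powr (q - q') * y powr q'"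
proof (cases "y \<le> e")
  case True
  then have "y powr q \<le> e powr q" using assms by (intro powr_mono2) auto
  then show ?thesis by (simp add: add_increasing2)
next
  case False
  then have "1 \<le> y / e" "0 < y" using assms by auto
  then have "(y / e) powr q \<le> (y / e) powr q'" using assms by (intro powr_mono) auto
  then have "e powr q * (y / e) powr q \<le> e powr q * (y / e) powr q'" by (intro mult_left_mono) auto
  also have "e powr q * (y / e) powr q = y powr q"
    using assms \<open>0 < y\<close> by (simp add: powr_divide)
  also have "e powr q * (y / e) powr q' = e powr (q - q') * y powr q'"
    using assms \<open>0 < y\<close> by (simp add: powr_divide powr_diff)
  finally show ?thesis using powr_ge_zero[of e q] by linarith
qed

context finite_measure
begin

lemma Lp_mono:
  assumes "0 < q" "q \<le> q'" "f \<in> Lp q' M"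
  shows "f \<in> Lp q M"
proof (rule LpI_bound)
  show "integrable M (\<lambda>x. 1 powr q + 1 powr (q - q') * norm (f x) powr q')"
    using assms by (auto simp: Lp_def)
  show "AE x in M. norm (f x) powr q \<le> 1 powr q + 1 powr (q - q') * norm (f x) powr q'"
    using assms by (intro AE_I2 powr_le_interpolate) auto
qed (use assms in \<open>auto simp: Lp_def\<close>)

lemma integral_powr_tendsto_0_mono:
  assumes q: "0 < q" "q \<le> q'" and F: "\<And>g. F g \<in> Lp q' M"
    and lim: "((\<lambda>g. LINT x|M. norm (F g x) powr q') \<longlongrightarrow> 0) G"
  shows "((\<lambda>g. LINT x|M. norm (F g x) powr q) \<longlongrightarrow> 0) G"
proof (rule tendstoI)
  fix e :: real assume e: "0 < e"
  define m where "m = measure M (space M)"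
  define d where "d = (e / (2 * (m + 1))) powr (1 / q)"
  have m: "0 \<le> m" by (simp add: m_def)
  have d: "0 < d" using e m by (auto simp: d_def)
  have dq: "d powr q = e / (2 * (m + 1))" using e m q by (simp add: d_def powr_powr)
  have "m * d powr q \<le> e / 2" unfolding dq using e m by (simp add: field_simps)
  have "((\<lambda>g. d powr (q - q') * (LINT x|M. norm (F g x) powr q')) \<longlongrightarrow> d powr (q - q') * 0) G"
    by (intro tendsto_intros lim)
  then have "eventually (\<lambda>g. d powr (q - q') * (LINT x|M. norm (F g x) powr q') < e / 2) G"
    using e by (intro order_tendstoD(2)) auto
  then show "eventually (\<lambda>g. dist (LINT x|M. norm (F g x) powr q) 0 < e) G"
  proof eventually_elim
    case (elim g)
    have "(LINT x|M. norm (F g x) powr q) \<le> (LINT x|M. d powr q + d powr (q - q') * norm (F g x) powr q')"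
      using q d F[of g] Lp_mono[OF q F[of g]]
      by (intro integral_mono powr_le_interpolate) (auto simp: Lp_def)
    also have "\<dots> = m * d powr q + d powr (q - q') * (LINT x|M. norm (F g x) powr q')"
      using F[of g] by (simp add: Lp_def m_def)
    also have "\<dots> < e" using elim \<open>m * d powr q \<le> e / 2\<close> by simp
    finally show ?case by simp
  qed
qed

end

lemma integral_powr_bounded_on_compact:
  fixes b :: "'g::topological_space \<Rightarrow> 'y \<Rightarrow> complex"
  assumes "compact Q" and q: "0 \<le> q" and b: "\<And>g. b g \<in> Lp q N"
    and cont: "\<And>g\<^sub>0. ((\<lambda>g. LINT x|N. norm (b g x - b g\<^sub>0 x) powr q) \<longlongrightarrow> 0) (at g\<^sub>0)"
  shows "\<exists>B. \<forall>g\<in>Q. (LINT x|N. norm (b g x) powr q) \<le> B"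
proof -
  define I where "I g = (LINT x|N. norm (b g x) powr q)" for g
  have "\<exists>U B. open U \<and> g\<^sub>0 \<in> U \<and> (\<forall>g\<in>U. I g \<le> B)" for g\<^sub>0
  proof -
    have "eventually (\<lambda>g. (LINT x|N. norm (b g x - b g\<^sub>0 x) powr q) < 1) (at g\<^sub>0)"
      using order_tendstoD(2)[OF cont, of 1] by simp
    then obtain U where U: "open U" "g\<^sub>0 \<in> U"
        "\<And>g. g \<in> U \<Longrightarrow> g \<noteq> g\<^sub>0 \<Longrightarrow> (LINT x|N. norm (b g x - b g\<^sub>0 x) powr q) < 1"
      unfolding eventually_at_topological by blast
    have "I g \<le> 2 powr q * (1 + I g\<^sub>0)" if "g \<in> U" for g
    proof -
      have "I g \<le> (LINT x|N. 2 powr q * (norm (b g x - b g\<^sub>0 x) powr q + norm (b g\<^sub>0 x) powr q))"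
        unfolding I_def
      proof (rule integral_mono)
        show "norm (b g x) powr q \<le> 2 powr q * (norm (b g x - b g\<^sub>0 x) powr q + norm (b g\<^sub>0 x) powr q)" for x
          using norm_add_powr_le[OF q, of "b g x - b g\<^sub>0 x" "b g\<^sub>0 x"] by simp
      qed (use b Lp_diff[OF q b b] in \<open>auto simp: Lp_def\<close>)
      also have "\<dots> = 2 powr q * ((LINT x|N. norm (b g x - b g\<^sub>0 x) powr q) + I g\<^sub>0)"
        unfolding I_def using b Lp_diff[OF q b b] by (simp add: Lp_def)
      also have "\<dots> \<le> 2 powr q * (1 + I g\<^sub>0)"
        using U(3)[OF that] by (cases "g = g\<^sub>0") auto
      finally show ?thesis .
    qed
    with U(1,2) show ?thesis
      by (intro exI[of _ U] exI[of _ "2 powr q * (1 + I g\<^sub>0)"] conjI ballI)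
  qed
  then obtain U B where UB: "\<And>g\<^sub>0. open (U g\<^sub>0)" "\<And>g\<^sub>0. g\<^sub>0 \<in> U g\<^sub>0" "\<And>g\<^sub>0 g. g \<in> U g\<^sub>0 \<Longrightarrow> I g \<le> B g\<^sub>0"
    by metis
  obtain S where S: "finite S" "Q \<subseteq> (\<Union>g\<^sub>0\<in>S. U g\<^sub>0)"
    using compactE_image[OF \<open>compact Q\<close>, of Q U] UB(1,2) by (metis UN_I subsetI)
  have "I g \<le> (\<Sum>g\<^sub>0\<in>S. \<bar>B g\<^sub>0\<bar>)" if g: "g \<in> Q" for g
  proof -
    obtain g\<^sub>0 where g0: "g\<^sub>0 \<in> S" "g \<in> U g\<^sub>0" using S g by blast
    then have "I g \<le> \<bar>B g\<^sub>0\<bar>" using UB(3)[of g g\<^sub>0] by linarith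
    also have "\<dots> \<le> (\<Sum>g\<^sub>0\<in>S. \<bar>B g\<^sub>0\<bar>)" using S g0 by (intro member_le_sum) auto
    finally show ?thesis .
  qed
  then show ?thesis unfolding I_def by blast
qed

section \<open>Kazhdan pairs\<close>

definition kazhdan_pair :: "'g::topological_group_add set \<Rightarrow> real \<Rightarrow> bool" where
  "kazhdan_pair Q \<epsilon> \<longleftrightarrow> compact Q \<and> 0 < \<epsilon> \<and>
     (\<forall>smul (H :: ('g \<Rightarrow> complex) set) ip (U :: 'g \<Rightarrow> ('g \<Rightarrow> complex) \<Rightarrow> ('g \<Rightarrow> complex)).
        unitary_representation smul H ip U \<and>
        (\<exists>\<xi>\<in>H. \<xi> \<noteq> 0 \<and> (\<forall>g\<in>Q. ip_norm ip (U g \<xi> - \<xi>) < \<epsilon> * ip_norm ip \<xi>)) \<longrightarrow>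
        (\<exists>\<eta>\<in>H. \<eta> \<noteq> 0 \<and> (\<forall>g. U g \<eta> = \<eta>)))"

lemma property_T_iff_kazhdan_pair: "property_T TYPE('g::topological_group_add) \<longleftrightarrow> (\<exists>Q \<epsilon>. kazhdan_pair (Q :: 'g set) \<epsilon>)"
  unfolding property_T_def kazhdan_pair_def ..

lemma kazhdan_pair_compact: "kazhdan_pair Q \<epsilon> \<Longrightarrow> compact Q"
  and kazhdan_pair_pos: "kazhdan_pair Q \<epsilon> \<Longrightarrow> 0 < \<epsilon>"
  by (auto simp: kazhdan_pair_def)

lemma kazhdan_pairD:
  fixes H :: "('g::topological_group_add \<Rightarrow> complex) set"
  assumes "kazhdan_pair (Q :: 'g set) \<epsilon>" "unitary_representation smul H ip U"
    and "\<exists>\<xi>\<in>H. \<xi> \<noteq> 0 \<and> (\<forall>g\<in>Q. ip_norm ip (U g \<xi> - \<xi>) < \<epsilon> * ip_norm ip \<xi>)"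
  shows "\<exists>\<eta>\<in>H. \<eta> \<noteq> 0 \<and> (\<forall>g. U g \<eta> = \<eta>)"
  using assms(1)[unfolded kazhdan_pair_def, THEN conjunct2, THEN conjunct2] assms(2,3) by blast

section \<open>Twisted Koopman operators\<close>

locale twisted_action =
  fixes N :: "'y measure" and \<theta> :: "'g::topological_group_add \<Rightarrow> 'y \<Rightarrow> complex" and T :: "'g \<Rightarrow> 'y \<Rightarrow> 'y"
  assumes T_measurable [measurable]: "\<And>g. T g \<in> measurable N N"
    and T_preserves: "\<And>g. distr N N (T g) = N"
    and \<theta>_measurable [measurable]: "\<And>g. \<theta> g \<in> borel_measurable N"
    and \<theta>_norm: "\<And>g y. y \<in> space N \<Longrightarrow> norm (\<theta> g y) = 1"
    and T_0: "AE y in N. T 0 y = y"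
    and \<theta>_0: "AE y in N. \<theta> 0 y = 1"
    and T_add: "\<And>g k. AE y in N. T (g + k) y = T k (T g y)"
    and \<theta>_add: "\<And>g k. AE y in N. \<theta> (g + k) y = \<theta> g y * \<theta> k (T g y)"
begin

definition koop :: "'g \<Rightarrow> ('y \<Rightarrow> complex) \<Rightarrow> 'y \<Rightarrow> complex" where
  "koop g v = (\<lambda>y. \<theta> g y * v (T g y))"

lemma AE_T: "(AE y in N. P y) \<Longrightarrow> (AE y in N. P (T g y))"
proof -
  assume "AE y in N. P y"
  then have "AE y in distr N N (T g). P y" unfolding T_preserves .
  then show ?thesis by (rule AE_distrD[OF T_measurable])
qed

lemma integrable_T:
  fixes f :: "'y \<Rightarrow> real"
  assumes "f \<in> borel_measurable N"
  shows "integrable N (\<lambda>y. f (T g y)) \<longleftrightarrow> integrable N f"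
  using integrable_distr_eq[OF T_measurable assms, of g] by (simp add: T_preserves)

lemma koop_measurable [measurable (raw)]: "v \<in> borel_measurable N \<Longrightarrow> koop g v \<in> borel_measurable N"
  unfolding koop_def using measurable_compose[OF T_measurable, of v borel g] by measurable

lemma norm_koop: "y \<in> space N \<Longrightarrow> norm (koop g v y) = norm (v (T g y))"
  by (simp add: koop_def norm_mult \<theta>_norm)

lemma koop_plus: "koop g (v + w) = koop g v + koop g w"
  by (simp add: koop_def fun_eq_iff distrib_left)

lemma koop_diff: "koop g (v - w) = koop g v - koop g w"
  by (simp add: koop_def fun_eq_iff right_diff_distrib)

lemma koop_scale: "koop g (\<lambda>y. c * v y) = (\<lambda>y. c * koop g v y)"
  by (simp add: koop_def fun_eq_iff mult.left_commute)

lemma koop_0: "AE y in N. koop 0 v y = v y"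
  using T_0 \<theta>_0 by eventually_elim (simp add: koop_def)

lemma koop_add: "AE y in N. koop (g + k) v y = koop g (koop k v) y"
  using T_add[of g k] \<theta>_add[of g k] by eventually_elim (simp add: koop_def mult.assoc)

lemma koop_L2: "v \<in> L2 N \<Longrightarrow> koop g v \<in> L2 N"
proof -
  assume v: "v \<in> L2 N"
  then have "integrable N (\<lambda>y. (norm (v (T g y)))\<^sup>2)"
    using integrable_T[of "\<lambda>y. (norm (v y))\<^sup>2" g] by (auto simp: L2_def)
  then have "integrable N (\<lambda>y. (norm (koop g v y))\<^sup>2)"
    by (rule Bochner_Integration.integrable_cong[THEN iffD2, rotated -1]) (auto simp: norm_koop)
  with v show ?thesis by (auto simp: L2_def)
qed

lemma inner2_koop:
  assumes "v \<in> L2 N" "w \<in> L2 N"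
  shows "inner2 N (koop g v) (koop g w) = inner2 N v w"
proof -
  have [measurable]: "v \<in> borel_measurable N" "w \<in> borel_measurable N"
    using assms by (auto simp: L2_def)
  have "inner2 N (koop g v) (koop g w) = (LINT y|N. v (T g y) * cnj (w (T g y)))"
    unfolding inner2_def
  proof (rule Bochner_Integration.integral_cong[OF refl])
    fix y assume "y \<in> space N"
    then have "\<theta> g y * cnj (\<theta> g y) = 1"
      using \<theta>_norm[of y g] by (simp flip: complex_norm_square)
    then show "koop g v y * cnj (koop g w y) = v (T g y) * cnj (w (T g y))"
      by (simp add: koop_def algebra_simps)
  qed
  also have "\<dots> = (LINT y|distr N N (T g). v y * cnj (w y))"
    by (rule integral_distr[symmetric]) auto
  finally show ?thesis by (simp add: T_preserves inner2_def)
qed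

lemma sqnorm_koop: "v \<in> L2 N \<Longrightarrow> sqnorm N (koop g v) = sqnorm N v"
  using inner2_koop[of v v g] by (simp add: inner2_self)

lemma inner2_koop_shift:
  assumes "v \<in> L2 N" "w \<in> L2 N"
  shows "inner2 N (koop g v) (koop k w) = inner2 N v (koop (- g + k) w)"
proof -
  have "inner2 N (koop g v) (koop k w) = inner2 N (koop g v) (koop g (koop (- g + k) w))"
    using koop_add[of g "- g + k" w] assms
    by (intro inner2_cong_AE) (auto intro!: koop_L2 simp flip: add.assoc)
  then show ?thesis using assms by (simp add: inner2_koop koop_L2)
qed

section \<open>Cyclic subspaces and property (T)\<close>

text \<open>
  The closed invariant subspace generated by \<open>\<xi>\<close>. Presenting it as a least set turns statements
  about all its elements, such as continuity of the orbit maps and orthogonality, into rule inductions.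
\<close>

inductive_set cyclic :: "('y \<Rightarrow> complex) \<Rightarrow> ('y \<Rightarrow> complex) set" for \<xi> where
  orbit: "koop g \<xi> \<in> cyclic \<xi>"
| scale: "v \<in> cyclic \<xi> \<Longrightarrow> (\<lambda>y. c * v y) \<in> cyclic \<xi>"
| plus: "v \<in> cyclic \<xi> \<Longrightarrow> w \<in> cyclic \<xi> \<Longrightarrow> v + w \<in> cyclic \<xi>"
| limit: "v \<in> L2 N \<Longrightarrow> (\<And>e. 0 < e \<Longrightarrow> \<exists>s. s \<in> cyclic \<xi> \<and> sqnorm N (v - s) < (e::real)) \<Longrightarrow> v \<in> cyclic \<xi>"

lemma cyclic_L2:
  assumes "v \<in> cyclic \<xi>" "\<xi> \<in> L2 N"
  shows "v \<in> L2 N"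
  using assms by induction (auto intro: koop_L2 L2_scale L2_add)

lemma cyclic_cong:
  assumes "\<xi> \<in> L2 N" "v \<in> cyclic \<xi>" "w \<in> L2 N" "AE y in N. w y = v y"
  shows "w \<in> cyclic \<xi>"
proof (rule cyclic.limit)
  have "sqnorm N (w - v) = 0"
    using assms cyclic_L2[of v \<xi>] by (subst sqnorm_eq_0_iff) (auto intro: L2_diff)
  then show "\<exists>s. s \<in> cyclic \<xi> \<and> sqnorm N (w - s) < e" if "0 < e" for e
    using that assms by (intro exI[of _ v]) auto
qed fact

lemma cyclic_uminus: "v \<in> cyclic \<xi> \<Longrightarrow> - v \<in> cyclic \<xi>"
  using cyclic.scale[of v \<xi> "- 1"] by (simp add: fun_Compl_def)

lemma cyclic_diff: "v \<in> cyclic \<xi> \<Longrightarrow> w \<in> cyclic \<xi> \<Longrightarrow> v - w \<in> cyclic \<xi>"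
  using cyclic.plus[OF _ cyclic_uminus, of v \<xi> w] by simp

lemma cyclic_zero: "0 \<in> cyclic \<xi>"
  using cyclic.scale[OF cyclic.orbit, of 0] by (simp add: zero_fun_def)

lemma cyclic_koop:
  assumes "v \<in> cyclic \<xi>" "\<xi> \<in> L2 N"
  shows "koop g v \<in> cyclic \<xi>"
  using assms
proof induction
  case (orbit k)
  show ?case
    by (rule cyclic_cong[OF orbit.prems cyclic.orbit[of "g + k"]])
       (use koop_add[of g k \<xi>] orbit.prems in \<open>auto intro: koop_L2\<close>)
next
  case (limit v)
  show ?case
  proof (rule cyclic.limit)
    show "koop g v \<in> L2 N" using limit by (auto intro: koop_L2)
    fix e :: real assume "0 < e"
    then obtain s where s: "s \<in> cyclic \<xi>" "koop g s \<in> cyclic \<xi>" "sqnorm N (v - s) < e"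
      using limit by blast
    moreover have "sqnorm N (koop g v - koop g s) = sqnorm N (v - s)"
      using s(1) limit by (simp add: sqnorm_koop L2_diff cyclic_L2 flip: koop_diff)
    ultimately show "\<exists>s. s \<in> cyclic \<xi> \<and> sqnorm N (koop g v - s) < e" by (intro exI[of _ "koop g s"]) simp
  qed
qed (auto simp: koop_scale koop_plus intro: cyclic.intros)

lemma cyclic_orthogonal:
  assumes "v \<in> cyclic \<xi>" "\<xi> \<in> L2 N" "w \<in> L2 N"
    and "\<And>k. inner2 N w (koop k \<xi>) = 0"
  shows "inner2 N w v = 0"
  using assms
proof induction
  case (limit v)
  show ?case
  proof (rule ccontr)
    assume nz: "inner2 N w v \<noteq> 0"
    define c where "c = (norm (inner2 N w v))\<^sup>2"
    have c: "0 < c" using nz by (simp add: c_def)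
    have pos: "0 < c / (sqnorm N w + 1)" using c by (simp add: add_nonneg_pos)
    then obtain s where s: "s \<in> cyclic \<xi>" "inner2 N w s = 0" "sqnorm N (v - s) < c / (sqnorm N w + 1)"
      using limit by blast
    have sL: "s \<in> L2 N" using s limit cyclic_L2 by blast
    have "inner2 N w v = inner2 N w (v - s)"
      using inner2_add_right[of w N "v - s" s] limit sL s by (simp add: L2_diff)
    then have "c \<le> sqnorm N w * sqnorm N (v - s)"
      unfolding c_def using norm_inner2_le[of w N "v - s"] limit sL by (simp add: L2_diff)
    also have "\<dots> \<le> sqnorm N w * (c / (sqnorm N w + 1))"
      using s by (intro mult_left_mono) auto
    also have "\<dots> < c"
      using c sqnorm_nonneg[of N w] add_nonneg_pos[of "sqnorm N w" 1]
      by (simp add: pos_divide_less_eq distrib_left mult.commute)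
    finally show False by simp
  qed
qed (auto simp: inner2_scale_right inner2_add_right cyclic_L2)

lemma cyclic_continuous:
  assumes "v \<in> cyclic \<xi>" "\<xi> \<in> L2 N"
    and "\<And>g\<^sub>0. ((\<lambda>g. sqnorm N (koop g \<xi> - koop g\<^sub>0 \<xi>)) \<longlongrightarrow> 0) (at g\<^sub>0)"
  shows "((\<lambda>g. sqnorm N (koop g v - koop g\<^sub>0 v)) \<longlongrightarrow> 0) (at g\<^sub>0)"
  using assms
proof (induction arbitrary: g\<^sub>0)
  case (orbit k)
  have shift: "filterlim (\<lambda>g. g + k) (at (g\<^sub>0 + k)) (at g\<^sub>0)"
    by (intro filterlim_atI tendsto_intros) (simp add: eventually_at_filter)
  have "((\<lambda>g. sqnorm N (koop (g + k) \<xi> - koop (g\<^sub>0 + k) \<xi>)) \<longlongrightarrow> 0) (at g\<^sub>0)"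
    using filterlim_compose[OF orbit(2) shift] .
  moreover have "sqnorm N (koop (g + k) \<xi> - koop (g\<^sub>0 + k) \<xi>)
      = sqnorm N (koop g (koop k \<xi>) - koop g\<^sub>0 (koop k \<xi>))" for g
  proof (rule sqnorm_cong_AE)
    show "AE y in N. (koop (g + k) \<xi> - koop (g\<^sub>0 + k) \<xi>) y
        = (koop g (koop k \<xi>) - koop g\<^sub>0 (koop k \<xi>)) y"
      using koop_add[of g k \<xi>] koop_add[of g\<^sub>0 k \<xi>] by eventually_elim simp
  qed (use orbit in \<open>auto intro: L2_diff koop_L2\<close>)
  ultimately show ?case by (simp add: fun_diff_def)
next
  case (scale v c)
  have "sqnorm N (koop g (\<lambda>y. c * v y) - koop g\<^sub>0 (\<lambda>y. c * v y))
      = (norm c)\<^sup>2 * sqnorm N (koop g v - koop g\<^sub>0 v)" for g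
    unfolding sqnorm_scale[symmetric] koop_scale
    by (simp add: fun_diff_def right_diff_distrib)
  moreover have "((\<lambda>g. (norm c)\<^sup>2 * sqnorm N (koop g v - koop g\<^sub>0 v)) \<longlongrightarrow> (norm c)\<^sup>2 * 0) (at g\<^sub>0)"
    using scale by (intro tendsto_intros) (auto simp: fun_diff_def)
  ultimately show ?case by (simp add: fun_diff_def)
next
  case (plus v w)
  show ?case
  proof (rule tendsto_sandwich[OF always_eventually always_eventually tendsto_const])
    show "\<forall>g. sqnorm N (koop g (v + w) - koop g\<^sub>0 (v + w))
        \<le> 2 * sqnorm N (koop g v - koop g\<^sub>0 v) + 2 * sqnorm N (koop g w - koop g\<^sub>0 w)"
    proof
      fix g
      have "koop g (v + w) - koop g\<^sub>0 (v + w) = (koop g v - koop g\<^sub>0 v) + (koop g w - koop g\<^sub>0 w)"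
        by (simp add: koop_plus)
      then show "sqnorm N (koop g (v + w) - koop g\<^sub>0 (v + w))
          \<le> 2 * sqnorm N (koop g v - koop g\<^sub>0 v) + 2 * sqnorm N (koop g w - koop g\<^sub>0 w)"
        using plus cyclic_L2 by (auto intro!: sqnorm_add_le L2_diff koop_L2)
    qed
    have "((\<lambda>g. 2 * sqnorm N (koop g v - koop g\<^sub>0 v) + 2 * sqnorm N (koop g w - koop g\<^sub>0 w))
        \<longlongrightarrow> 2 * 0 + 2 * 0) (at g\<^sub>0)"
      using plus by (intro tendsto_intros) (auto simp: fun_diff_def)
    then show "((\<lambda>g. 2 * sqnorm N (koop g v - koop g\<^sub>0 v) + 2 * sqnorm N (koop g w - koop g\<^sub>0 w))
        \<longlongrightarrow> 0) (at g\<^sub>0)" by simp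
  qed simp
next
  case (limit v)
  show ?case
  proof (rule tendstoI)
    fix e :: real assume e: "0 < e"
    then obtain s where s: "s \<in> cyclic \<xi>" "((\<lambda>g. sqnorm N (koop g s - koop g\<^sub>0 s)) \<longlongrightarrow> 0) (at g\<^sub>0)"
        "sqnorm N (v - s) < e / 12"
      using limit by (metis divide_pos_pos zero_less_numeral)
    have sL: "s \<in> L2 N" and vs: "v - s \<in> L2 N" using s limit cyclic_L2 L2_diff by blast+
    have "eventually (\<lambda>g. sqnorm N (koop g s - koop g\<^sub>0 s) < e / 12) (at g\<^sub>0)"
      using order_tendstoD(2)[OF s(2), of "e / 12"] e by simp
    then show "eventually (\<lambda>g. dist (sqnorm N (koop g v - koop g\<^sub>0 v)) 0 < e) (at g\<^sub>0)"
    proof eventually_elim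
      case (elim g)
      have split: "koop g v - koop g\<^sub>0 v
          = (koop g (v - s) + (koop g s - koop g\<^sub>0 s)) + - koop g\<^sub>0 (v - s)"
        by (simp add: koop_diff)
      have "sqnorm N (koop g v - koop g\<^sub>0 v)
          \<le> 2 * sqnorm N (koop g (v - s) + (koop g s - koop g\<^sub>0 s)) + 2 * sqnorm N (- koop g\<^sub>0 (v - s))"
        unfolding split using limit(1) sL vs by (intro sqnorm_add_le L2_add L2_diff koop_L2 L2_uminus)
      also have "\<dots> \<le> 2 * (2 * sqnorm N (koop g (v - s)) + 2 * sqnorm N (koop g s - koop g\<^sub>0 s))
          + 2 * sqnorm N (- koop g\<^sub>0 (v - s))"
        using sL vs by (intro add_right_mono mult_left_mono sqnorm_add_le) (auto intro!: L2_diff koop_L2)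
      also have "\<dots> = 6 * sqnorm N (v - s) + 4 * sqnorm N (koop g s - koop g\<^sub>0 s)"
        using vs by (simp add: sqnorm_koop)
      also have "\<dots> < e" using elim s(3) e by linarith
      finally show ?case by simp
    qed
  qed
qed

text \<open>
  Matrix coefficients against the orbit of \<open>\<xi>\<close> realise the cyclic subspace, modulo null functions,
  as a space of functions on the group, on which the operators become left translations.
\<close>

definition matrix_coeff :: "('y \<Rightarrow> complex) \<Rightarrow> ('y \<Rightarrow> complex) \<Rightarrow> 'g \<Rightarrow> complex" where
  "matrix_coeff \<xi> v = (\<lambda>k. inner2 N v (koop k \<xi>))"

context
  fixes \<xi>
  assumes \<xi>: "\<xi> \<in> L2 N"
begin

lemma coeff_add: "v \<in> L2 N \<Longrightarrow> w \<in> L2 N \<Longrightarrow> matrix_coeff \<xi> (v + w) = matrix_coeff \<xi> v + matrix_coeff \<xi> w"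
  by (simp add: matrix_coeff_def fun_eq_iff inner2_add_left koop_L2 \<xi>)

lemma coeff_scale: "matrix_coeff \<xi> (\<lambda>y. c * v y) = (\<lambda>k. c * matrix_coeff \<xi> v k)"
  by (simp add: matrix_coeff_def inner2_scale_left)

lemma coeff_diff: "v \<in> L2 N \<Longrightarrow> w \<in> L2 N \<Longrightarrow> matrix_coeff \<xi> (v - w) = matrix_coeff \<xi> v - matrix_coeff \<xi> w"
  using coeff_add[of "v - w" w] by (simp add: L2_diff)

lemma coeff_koop: "v \<in> L2 N \<Longrightarrow> matrix_coeff \<xi> (koop g v) = (\<lambda>k. matrix_coeff \<xi> v (- g + k))"
  by (simp add: matrix_coeff_def fun_eq_iff inner2_koop_shift \<xi>)

lemma coeff_eq_0:
  assumes "v \<in> cyclic \<xi>" "matrix_coeff \<xi> v = 0"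
  shows "sqnorm N v = 0"
proof -
  have "inner2 N v v = 0"
    using assms by (intro cyclic_orthogonal[OF assms(1) \<xi>]) (auto simp: cyclic_L2 \<xi> matrix_coeff_def fun_eq_iff)
  then show ?thesis by (simp add: inner2_self)
qed

lemma coeff_eq_iff:
  assumes "v \<in> cyclic \<xi>" "w \<in> cyclic \<xi>"
  shows "matrix_coeff \<xi> v = matrix_coeff \<xi> w \<longleftrightarrow> (AE y in N. v y = w y)"
proof
  assume "matrix_coeff \<xi> v = matrix_coeff \<xi> w"
  then have "sqnorm N (v - w) = 0"
    using assms by (intro coeff_eq_0 cyclic_diff) (auto simp: coeff_diff cyclic_L2 \<xi>)
  then show "AE y in N. v y = w y"
    using assms by (subst (asm) sqnorm_eq_0_iff) (auto simp: L2_diff cyclic_L2 \<xi>)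
next
  assume "AE y in N. v y = w y"
  then show "matrix_coeff \<xi> v = matrix_coeff \<xi> w"
    using assms unfolding matrix_coeff_def by (intro ext inner2_cong_AE) (auto simp: cyclic_L2 \<xi> koop_L2)
qed

definition rep :: "('g \<Rightarrow> complex) \<Rightarrow> 'y \<Rightarrow> complex" where
  "rep a = (SOME v. v \<in> cyclic \<xi> \<and> matrix_coeff \<xi> v = a)"

lemma rep: "a \<in> matrix_coeff \<xi> ` cyclic \<xi> \<Longrightarrow> rep a \<in> cyclic \<xi>"
  and coeff_rep: "a \<in> matrix_coeff \<xi> ` cyclic \<xi> \<Longrightarrow> matrix_coeff \<xi> (rep a) = a"
proof -
  assume "a \<in> matrix_coeff \<xi> ` cyclic \<xi>"
  then have "\<exists>v. v \<in> cyclic \<xi> \<and> matrix_coeff \<xi> v = a" by auto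
  from someI_ex[OF this] show "rep a \<in> cyclic \<xi>" "matrix_coeff \<xi> (rep a) = a" by (auto simp: rep_def)
qed

lemma rep_coeff: "v \<in> cyclic \<xi> \<Longrightarrow> AE y in N. rep (matrix_coeff \<xi> v) y = v y"
  by (subst coeff_eq_iff[symmetric]) (auto simp: coeff_rep rep)

definition coeff_inner :: "('g \<Rightarrow> complex) \<Rightarrow> ('g \<Rightarrow> complex) \<Rightarrow> complex" where
  "coeff_inner a b = inner2 N (rep a) (rep b)"

lemma coeff_inner:
  assumes "v \<in> cyclic \<xi>" "w \<in> cyclic \<xi>"
  shows "coeff_inner (matrix_coeff \<xi> v) (matrix_coeff \<xi> w) = inner2 N v w"
  unfolding coeff_inner_def using assms
  by (intro inner2_cong_AE rep_coeff) (auto intro!: cyclic_L2[OF _ \<xi>] rep)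

lemma coeff_norm: "v \<in> cyclic \<xi> \<Longrightarrow> ip_norm coeff_inner (matrix_coeff \<xi> v) = sqrt (sqnorm N v)"
  by (simp add: ip_norm_def coeff_inner inner2_self)

lemma complex_hilbert_space_coeff:
  "complex_hilbert_space (\<lambda>c a k. c * a k) (matrix_coeff \<xi> ` cyclic \<xi>) coeff_inner"
proof -
  interpret vs: vector_space "\<lambda>c a (k::'g). c * a k :: complex"
    by standard (auto simp: fun_eq_iff algebra_simps)
  note L = cyclic_L2[OF _ \<xi>]
  show ?thesis
  proof
    show "vs.subspace (matrix_coeff \<xi> ` cyclic \<xi>)"
    proof (rule vs.subspaceI)
      have "matrix_coeff \<xi> 0 = 0" by (auto simp: matrix_coeff_def inner2_def)
      then show "0 \<in> matrix_coeff \<xi> ` cyclic \<xi>" using cyclic_zero by (metis imageI)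
    next
      fix a b assume "a \<in> matrix_coeff \<xi> ` cyclic \<xi>" "b \<in> matrix_coeff \<xi> ` cyclic \<xi>"
      then obtain v w where "v \<in> cyclic \<xi>" "w \<in> cyclic \<xi>" "a = matrix_coeff \<xi> v" "b = matrix_coeff \<xi> w" by auto
      then show "a + b \<in> matrix_coeff \<xi> ` cyclic \<xi>"
        by (auto intro!: image_eqI[of _ _ "v + w"] simp: coeff_add L cyclic.plus)
    next
      fix c a assume "a \<in> matrix_coeff \<xi> ` cyclic \<xi>"
      then obtain v where "v \<in> cyclic \<xi>" "a = matrix_coeff \<xi> v" by auto
      then show "(\<lambda>k. c * a k) \<in> matrix_coeff \<xi> ` cyclic \<xi>"
        by (auto intro!: image_eqI[of _ _ "\<lambda>y. c * v y"] cyclic.scale simp: coeff_scale)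
    qed
  next
    fix a b d assume "a \<in> matrix_coeff \<xi> ` cyclic \<xi>" "b \<in> matrix_coeff \<xi> ` cyclic \<xi>" "d \<in> matrix_coeff \<xi> ` cyclic \<xi>"
    then obtain u v w where
        "u \<in> cyclic \<xi>" "v \<in> cyclic \<xi>" "w \<in> cyclic \<xi>" "a = matrix_coeff \<xi> u" "b = matrix_coeff \<xi> v" "d = matrix_coeff \<xi> w"
      by auto
    then show "coeff_inner (a + b) d = coeff_inner a d + coeff_inner b d"
      by (simp add: coeff_inner cyclic.plus L inner2_add_left flip: coeff_add)
  next
    fix c a b assume "a \<in> matrix_coeff \<xi> ` cyclic \<xi>" "b \<in> matrix_coeff \<xi> ` cyclic \<xi>"
    then obtain u v where "u \<in> cyclic \<xi>" "v \<in> cyclic \<xi>" "a = matrix_coeff \<xi> u" "b = matrix_coeff \<xi> v"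
      by auto
    then show "coeff_inner (\<lambda>k. c * a k) b = c * coeff_inner a b"
      by (simp add: coeff_inner cyclic.scale inner2_scale_left flip: coeff_scale)
  next
    fix a b
    show "coeff_inner b a = cnj (coeff_inner a b)"
      unfolding coeff_inner_def by (rule inner2_cnj)
  next
    fix a :: "'g \<Rightarrow> complex" assume "a \<in> matrix_coeff \<xi> ` cyclic \<xi>" "a \<noteq> 0"
    then obtain v where v: "v \<in> cyclic \<xi>" "a = matrix_coeff \<xi> v" by auto
    have "sqnorm N v \<noteq> 0"
    proof
      assume "sqnorm N v = 0"
      then have "AE y in N. v y = 0 y" using v by (simp add: sqnorm_eq_0_iff L)
      then have "a = matrix_coeff \<xi> 0" using v cyclic_zero by (simp add: coeff_eq_iff)
      also have "\<dots> = 0" by (auto simp: matrix_coeff_def inner2_def)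
      finally show False using \<open>a \<noteq> 0\<close> by simp
    qed
    then show "0 < Re (coeff_inner a a)"
      using v by (simp add: coeff_inner inner2_self less_le)
  next
    fix s :: "nat \<Rightarrow> 'g \<Rightarrow> complex"
    assume s: "range s \<subseteq> matrix_coeff \<xi> ` cyclic \<xi>"
      and cauchy: "\<And>e. 0 < e \<Longrightarrow> \<exists>K. \<forall>m\<ge>K. \<forall>n\<ge>K. sqrt (Re (coeff_inner (s m - s n) (s m - s n))) < e"
    define v where "v n = rep (s n)" for n
    have v: "v n \<in> cyclic \<xi>" "s n = matrix_coeff \<xi> (v n)" for n
      using s by (auto simp: v_def rep coeff_rep range_subsetD)
    have norm: "Re (coeff_inner (matrix_coeff \<xi> (v n) - matrix_coeff \<xi> w) (matrix_coeff \<xi> (v n) - matrix_coeff \<xi> w)) = sqnorm N (v n - w)"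
      if "w \<in> cyclic \<xi>" for n w
      using v that by (simp add: coeff_inner inner2_self cyclic_diff L flip: coeff_diff)
    have "\<exists>l\<in>L2 N. (\<lambda>n. sqnorm N (v n - l)) \<longlonglongrightarrow> 0"
    proof (rule L2_complete)
      show "v n \<in> L2 N" for n using v by (auto intro: L)
      fix e :: real assume "0 < e"
      then obtain K where K: "\<forall>m\<ge>K. \<forall>n\<ge>K. sqrt (Re (coeff_inner (s m - s n) (s m - s n))) < sqrt e"
        using cauchy[of "sqrt e"] by auto
      then show "\<exists>K. \<forall>m\<ge>K. \<forall>n\<ge>K. sqnorm N (v m - v n) < e"
        by (intro exI[of _ K]) (simp add: v(2) norm v(1))
    qed
    then obtain l where l: "l \<in> L2 N" "(\<lambda>n. sqnorm N (v n - l)) \<longlonglongrightarrow> 0" by auto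
    have lc: "l \<in> cyclic \<xi>"
    proof (rule cyclic.limit[OF l(1)])
      fix e :: real assume "0 < e"
      then obtain n where "sqnorm N (v n - l) < e"
        using order_tendstoD(2)[OF l(2)] by (auto simp: eventually_sequentially)
      then show "\<exists>s. s \<in> cyclic \<xi> \<and> sqnorm N (l - s) < e"
        using v by (auto simp: sqnorm_minus_commute[of N l])
    qed
    show "\<exists>l\<in>matrix_coeff \<xi> ` cyclic \<xi>. (\<lambda>n. sqrt (Re (coeff_inner (s n - l) (s n - l)))) \<longlonglongrightarrow> 0"
      using lc tendsto_real_sqrt[OF l(2)] by (intro bexI[of _ "matrix_coeff \<xi> l"]) (auto simp: v(2) norm)
  qed
qed

lemma unitary_representation_coeff:
  assumes cont: "\<And>g\<^sub>0. ((\<lambda>g. sqnorm N (koop g \<xi> - koop g\<^sub>0 \<xi>)) \<longlongrightarrow> 0) (at g\<^sub>0)"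
  shows "unitary_representation (\<lambda>c a k. c * a k) (matrix_coeff \<xi> ` cyclic \<xi>) coeff_inner (\<lambda>g a k. a (- g + k))"
  unfolding unitary_representation_def
proof (intro conjI allI ballI complex_hilbert_space_coeff)
  note L = cyclic_L2[OF _ \<xi>]
  have inv: "(\<lambda>k. a (- g + k)) \<in> matrix_coeff \<xi> ` cyclic \<xi>" if "a \<in> matrix_coeff \<xi> ` cyclic \<xi>" for g a
    using that by (auto simp: L cyclic_koop \<xi> simp flip: coeff_koop)
  fix g :: 'g
  show "bij_betw (\<lambda>a k. a (- g + k)) (matrix_coeff \<xi> ` cyclic \<xi>) (matrix_coeff \<xi> ` cyclic \<xi>)"
    by (rule bij_betwI[where g = "\<lambda>a k. a (g + k)"])
       (use inv inv[where g = "- g"] in \<open>auto simp flip: add.assoc\<close>)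
  fix a b assume "a \<in> matrix_coeff \<xi> ` cyclic \<xi>" "b \<in> matrix_coeff \<xi> ` cyclic \<xi>"
  then obtain v w where "v \<in> cyclic \<xi>" "w \<in> cyclic \<xi>" "a = matrix_coeff \<xi> v" "b = matrix_coeff \<xi> w" by auto
  then show "coeff_inner (\<lambda>k. a (- g + k)) (\<lambda>k. b (- g + k)) = coeff_inner a b"
    by (simp add: coeff_inner L cyclic_koop \<xi> inner2_koop flip: coeff_koop)
next
  fix a and g\<^sub>0 :: 'g assume "a \<in> matrix_coeff \<xi> ` cyclic \<xi>"
  then obtain v where v: "v \<in> cyclic \<xi>" "a = matrix_coeff \<xi> v" by auto
  have "ip_norm coeff_inner ((\<lambda>k. a (- g + k)) - (\<lambda>k. a (- g\<^sub>0 + k))) = sqrt (sqnorm N (koop g v - koop g\<^sub>0 v))" for g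
    using v by (simp add: cyclic_L2 \<xi> koop_L2 cyclic_koop cyclic_diff coeff_norm flip: coeff_koop coeff_diff)
  then show "((\<lambda>g. ip_norm coeff_inner ((\<lambda>k. a (- g + k)) - (\<lambda>k. a (- g\<^sub>0 + k)))) \<longlongrightarrow> 0) (at g\<^sub>0)"
    using tendsto_real_sqrt[OF cyclic_continuous[OF v(1) \<xi> cont]] by simp
qed (auto simp: minus_add add.assoc simp del: add_uminus_conv_diff)

end

text \<open>
  Property (T) turns almost invariant vectors into invariant ones. That the invariant vector can be
  found in the cyclic subspace of the almost invariant one is what makes this a spectral gap: the
  former inherits every orthogonality relation that holds along the orbit of the latter.
\<close>

lemma kazhdan_invariant_vector:
  assumes Q: "kazhdan_pair Q \<epsilon>" and \<xi>: "\<xi> \<in> L2 N"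
    and cont: "\<And>g\<^sub>0. ((\<lambda>g. sqnorm N (koop g \<xi> - koop g\<^sub>0 \<xi>)) \<longlongrightarrow> 0) (at g\<^sub>0)"
    and nz: "sqnorm N \<xi> \<noteq> 0"
    and inv: "\<And>g. g \<in> Q \<Longrightarrow> sqnorm N (koop g \<xi> - \<xi>) < \<epsilon>\<^sup>2 * sqnorm N \<xi>"
  shows "\<exists>\<eta>\<in>cyclic \<xi>. sqnorm N \<eta> \<noteq> 0 \<and> (\<forall>g. AE y in N. koop g \<eta> y = \<eta> y)"
proof -
  note L = cyclic_L2[OF _ \<xi>]
  have \<xi>c: "\<xi> \<in> cyclic \<xi>"
    by (rule cyclic_cong[OF \<xi> cyclic.orbit[of 0] \<xi>]) (use koop_0[of \<xi>] in auto)
  have zero: "matrix_coeff \<xi> v \<noteq> 0 \<longleftrightarrow> sqnorm N v \<noteq> 0" if "v \<in> cyclic \<xi>" for v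
  proof -
    have "matrix_coeff \<xi> 0 = 0" by (auto simp: matrix_coeff_def inner2_def)
    then have "matrix_coeff \<xi> v = 0 \<longleftrightarrow> (AE y in N. v y = 0)"
      using coeff_eq_iff[OF \<xi> that cyclic_zero] by simp
    then show ?thesis using that by (simp add: sqnorm_eq_0_iff L)
  qed
  have "\<exists>\<eta>\<in>matrix_coeff \<xi> ` cyclic \<xi>. \<eta> \<noteq> 0 \<and> (\<forall>g. (\<lambda>k. \<eta> (- g + k)) = \<eta>)"
  proof (rule kazhdan_pairD[OF Q unitary_representation_coeff[OF \<xi>]])
    show "\<exists>\<zeta>\<in>matrix_coeff \<xi> ` cyclic \<xi>. \<zeta> \<noteq> 0 \<and>
      (\<forall>g\<in>Q. ip_norm (coeff_inner \<xi>) ((\<lambda>k. \<zeta> (- g + k)) - \<zeta>) < \<epsilon> * ip_norm (coeff_inner \<xi>) \<zeta>)"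
    proof (rule bexI[of _ "matrix_coeff \<xi> \<xi>"], intro conjI ballI)
      show "matrix_coeff \<xi> \<xi> \<noteq> 0" using zero[OF \<xi>c] nz by simp
      fix g assume "g \<in> Q"
      then have "sqrt (sqnorm N (koop g \<xi> - \<xi>)) < sqrt (\<epsilon>\<^sup>2 * sqnorm N \<xi>)" using inv by simp
      also have "\<dots> = \<epsilon> * sqrt (sqnorm N \<xi>)" using kazhdan_pair_pos[OF Q] by (simp add: real_sqrt_mult)
      finally show "ip_norm (coeff_inner \<xi>) ((\<lambda>k. matrix_coeff \<xi> \<xi> (- g + k)) - matrix_coeff \<xi> \<xi>)
          < \<epsilon> * ip_norm (coeff_inner \<xi>) (matrix_coeff \<xi> \<xi>)"
        using \<xi>c by (simp add: coeff_norm[OF \<xi>] \<xi> koop_L2 cyclic_diff cyclic_koop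
            flip: coeff_koop[OF \<xi>] coeff_diff[OF \<xi>])
    qed (use \<xi>c in auto)
  qed (use cont in auto)
  then obtain \<eta> where \<eta>: "\<eta> \<in> cyclic \<xi>" "matrix_coeff \<xi> \<eta> \<noteq> 0" "\<And>g. (\<lambda>k. matrix_coeff \<xi> \<eta> (- g + k)) = matrix_coeff \<xi> \<eta>"
    by auto
  have "AE y in N. koop g \<eta> y = \<eta> y" for g
    using \<eta>(3)[of g] \<eta>(1) by (simp add: L cyclic_koop \<xi> coeff_eq_iff[OF \<xi>] flip: coeff_koop[OF \<xi>])
  then show "\<exists>\<eta>\<in>cyclic \<xi>. sqnorm N \<eta> \<noteq> 0 \<and> (\<forall>g. AE y in N. koop g \<eta> y = \<eta> y)"
    using \<eta> zero by blast
qed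

end

section \<open>Ergodic actions on finite measure spaces\<close>

locale ergodic_twisted_action = twisted_action N \<theta> T + finite_measure N
  for N :: "'y measure" and \<theta> :: "'g::topological_group_add \<Rightarrow> 'y \<Rightarrow> complex" and T :: "'g \<Rightarrow> 'y \<Rightarrow> 'y" +
  assumes ergodic: "\<And>A. A \<in> sets N \<Longrightarrow> (\<And>g. AE y in N. T g y \<in> A \<longleftrightarrow> y \<in> A) \<Longrightarrow>
     emeasure N A = 0 \<or> emeasure N (space N - A) = 0"
begin

lemma ergodic_AE:
  assumes [measurable]: "Measurable.pred N P" and inv: "\<And>g. AE y in N. P (T g y) \<longleftrightarrow> P y"
  shows "(AE y in N. P y) \<or> (AE y in N. \<not> P y)"
proof -
  let ?A = "{y \<in> space N. P y}"
  have "emeasure N ?A = 0 \<or> emeasure N (space N - ?A) = 0"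
  proof (rule ergodic)
    fix g show "AE y in N. (T g y \<in> ?A) = (y \<in> ?A)"
      using inv[of g] AE_space
      by eventually_elim (use measurable_space[OF T_measurable] in auto)
  qed measurable
  then have "?A \<in> null_sets N \<or> space N - ?A \<in> null_sets N" by (auto simp: null_sets_def)
  then show ?thesis
  proof
    assume "?A \<in> null_sets N"
    then show ?thesis by (intro disjI2 AE_I'[of ?A]) auto
  next
    assume "space N - ?A \<in> null_sets N"
    then show ?thesis by (intro disjI1 AE_I'[of "space N - ?A"]) auto
  qed
qed

text \<open>
  The sublevel sets of an invariant function are null or conull; the constant is the least upper bound that
  holds almost everywhere.
\<close>

lemma invariant_real_AE_const:
  fixes f :: "'y \<Rightarrow> real"
  assumes f[measurable]: "f \<in> borel_measurable N" and inv: "\<And>g. AE y in N. f (T g y) = f y"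
  shows "\<exists>c. AE y in N. f y = c"
proof (cases "AE y in N. False")
  case True
  then show ?thesis by (auto elim: AE_mp)
next
  case nontrivial: False
  define R where "R = {r. AE y in N. f y \<le> r}"
  have dich: "(AE y in N. f y \<le> r) \<or> (AE y in N. \<not> f y \<le> r)" for r
  proof (rule ergodic_AE)
    show "AE y in N. (f (T g y) \<le> r) = (f y \<le> r)" for g
      using inv[of g] by eventually_elim simp
  qed simp
  have "\<exists>n. real n \<in> R"
  proof (rule ccontr)
    assume "\<not> ?thesis"
    then have "AE y in N. \<forall>n. \<not> f y \<le> real n"
      unfolding AE_all_countable R_def using dich by auto
    then have "AE y in N. False"
      by eventually_elim (meson real_arch_simple)
    with nontrivial show False ..
  qed
  then have ne: "R \<noteq> {}" by auto
  have "\<exists>n. - real n \<notin> R"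
  proof (rule ccontr)
    assume "\<not> ?thesis"
    then have "AE y in N. \<forall>n. f y \<le> - real n"
      unfolding AE_all_countable R_def by auto
    then have "AE y in N. False"
    proof eventually_elim
      case (elim y)
      obtain n where "- f y < real n" using reals_Archimedean2 by blast
      with elim[rule_format, of n] show False by simp
    qed
    with nontrivial show False ..
  qed
  then obtain n where n: "- real n \<notin> R" by auto
  have up: "r' \<in> R" if "r \<in> R" "r \<le> r'" for r r'
    using that unfolding R_def by (auto elim!: AE_mp)
  have bdd: "bdd_below R"
  proof (rule bdd_belowI[of _ "- real n"])
    show "- real n \<le> r" if "r \<in> R" for r
      using n up[OF that, of "- real n"] by linarith
  qed
  define c where "c = Inf R"
  have "AE y in N. f y \<le> c + 1 / real (Suc k)" for k
  proof -
    have "\<exists>r\<in>R. r < c + 1 / real (Suc k)"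
      using ne by (intro cInf_lessD) (auto simp: c_def)
    then show ?thesis using up unfolding R_def by (metis less_imp_le mem_Collect_eq)
  qed
  moreover have "AE y in N. \<not> f y \<le> c - 1 / real (Suc k)" for k
  proof -
    have "c - 1 / real (Suc k) \<notin> R"
    proof
      assume "c - 1 / real (Suc k) \<in> R"
      then have "c \<le> c - 1 / real (Suc k)" unfolding c_def by (rule cInf_lower[OF _ bdd])
      then show False by simp
    qed
    then show ?thesis using dich unfolding R_def by auto
  qed
  ultimately have "AE y in N. \<forall>k. f y \<le> c + 1 / real (Suc k) \<and> \<not> f y \<le> c - 1 / real (Suc k)"
    unfolding AE_all_countable by (auto intro: AE_conjI)
  then have "AE y in N. f y = c"
  proof eventually_elim
    case (elim y)
    have "\<bar>f y - c\<bar> \<le> e" if e: "0 < e" for e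
    proof -
      obtain k where "1 / real (Suc k) < e" using nat_approx_posE[OF e] by auto
      with elim[rule_format, of k] show ?thesis by (auto simp: abs_le_iff)
    qed
    then have "\<bar>f y - c\<bar> \<le> 0" by (rule field_le_epsilon[of _ 0, simplified])
    then show ?case by simp
  qed
  then show ?thesis ..
qed

lemma invariant_complex_AE_const:
  fixes f :: "'y \<Rightarrow> complex"
  assumes f[measurable]: "f \<in> borel_measurable N" and inv: "\<And>g. AE y in N. f (T g y) = f y"
  shows "\<exists>c. AE y in N. f y = c"
proof -
  have "\<exists>c. AE y in N. Re (f y) = c"
  proof (rule invariant_real_AE_const)
    show "AE y in N. Re (f (T g y)) = Re (f y)" for g
      using inv[of g] by eventually_elim simp
  qed simp
  moreover have "\<exists>c. AE y in N. Im (f y) = c"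
  proof (rule invariant_real_AE_const)
    show "AE y in N. Im (f (T g y)) = Im (f y)" for g
      using inv[of g] by eventually_elim simp
  qed simp
  ultimately obtain a b where "AE y in N. Re (f y) = a" "AE y in N. Im (f y) = b" by auto
  then have "AE y in N. f y = Complex a b" by eventually_elim (simp add: complex_eq_iff)
  then show ?thesis ..
qed

lemma koop_invariant_norm_AE_const:
  assumes f[measurable]: "f \<in> borel_measurable N" and inv: "\<And>g. AE y in N. koop g f y = f y"
  shows "\<exists>c. AE y in N. norm (f y) = c"
proof (rule invariant_real_AE_const)
  fix g show "AE y in N. norm (f (T g y)) = norm (f y)"
    using inv[of g] AE_space by eventually_elim (metis norm_koop)
qed simp

text \<open>
  Ergodicity makes the space of invariant vectors at most one-dimensional, spanned by a function
  \<open>w\<close> of constant modulus: the quotient of two of them is an invariant scalar function. Subtracting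
  from \<open>F\<close> its projection onto \<open>w\<close> leaves a vector whose whole cyclic subspace is orthogonal to
  \<open>w\<close> and hence contains no invariant vector.
\<close>

lemma spectral_gap:
  assumes Q: "kazhdan_pair Q \<epsilon>" and F: "F \<in> L2 N"
    and cont: "\<And>g\<^sub>0. ((\<lambda>g. sqnorm N (koop g F - koop g\<^sub>0 F)) \<longlongrightarrow> 0) (at g\<^sub>0)"
    and B: "0 \<le> B" "\<And>g. g \<in> Q \<Longrightarrow> sqnorm N (koop g F - F) \<le> B"
  shows "\<exists>c\<in>L2 N. (\<exists>\<kappa>. AE y in N. norm (c y) = \<kappa>) \<and> sqnorm N (F - c) \<le> B / \<epsilon>\<^sup>2"
proof -
  have \<epsilon>: "0 < \<epsilon>" by (rule kazhdan_pair_pos[OF Q])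
  have gap: "sqnorm N (F - c) \<le> B / \<epsilon>\<^sup>2"
    if c: "c \<in> L2 N" "\<And>g. AE y in N. koop g c y = c y"
      and none: "\<And>\<eta>. \<eta> \<in> cyclic (F - c) \<Longrightarrow> (\<And>g. AE y in N. koop g \<eta> y = \<eta> y) \<Longrightarrow> sqnorm N \<eta> = 0" for c
  proof (rule ccontr)
    assume "\<not> ?thesis"
    then have big: "B < \<epsilon>\<^sup>2 * sqnorm N (F - c)" using \<epsilon> by (simp add: field_simps)
    have r: "F - c \<in> L2 N" by (intro L2_diff F c)
    have eq: "sqnorm N (koop g (F - c) - koop k (F - c)) = sqnorm N (koop g F - koop k F)" for g k
    proof (rule sqnorm_cong_AE)
      show "AE y in N. (koop g (F - c) - koop k (F - c)) y = (koop g F - koop k F) y"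
        using c(2)[of g] c(2)[of k] by eventually_elim (simp add: koop_diff)
    qed (intro L2_diff koop_L2 r F c)+
    have eq': "sqnorm N (koop g (F - c) - (F - c)) = sqnorm N (koop g F - F)" for g
    proof (rule sqnorm_cong_AE)
      show "AE y in N. (koop g (F - c) - (F - c)) y = (koop g F - F) y"
        using c(2)[of g] by eventually_elim (simp add: koop_diff)
    qed (intro L2_diff koop_L2 r F c)+
    have "\<exists>\<eta>\<in>cyclic (F - c). sqnorm N \<eta> \<noteq> 0 \<and> (\<forall>g. AE y in N. koop g \<eta> y = \<eta> y)"
    proof (rule kazhdan_invariant_vector[OF Q r])
      show "((\<lambda>g. sqnorm N (koop g (F - c) - koop g\<^sub>0 (F - c))) \<longlongrightarrow> 0) (at g\<^sub>0)" for g\<^sub>0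
        unfolding eq by (rule cont)
      show "sqnorm N (F - c) \<noteq> 0" using big B(1) by auto
      show "sqnorm N (koop g (F - c) - (F - c)) < \<epsilon>\<^sup>2 * sqnorm N (F - c)" if "g \<in> Q" for g
        unfolding eq' using B(2)[OF that] big by simp
    qed
    with none show False by blast
  qed
  show ?thesis
  proof (cases "\<exists>w\<in>L2 N. sqnorm N w \<noteq> 0 \<and> (\<forall>g. AE y in N. koop g w y = w y)")
    case False
    have "sqnorm N (F - 0) \<le> B / \<epsilon>\<^sup>2"
    proof (rule gap)
      fix \<eta> assume "\<eta> \<in> cyclic (F - 0)" "\<And>g. AE y in N. koop g \<eta> y = \<eta> y"
      with False cyclic_L2[of \<eta> F] F show "sqnorm N \<eta> = 0" by auto
    qed (auto simp: L2_zero koop_def)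
    then show ?thesis by (intro bexI[of _ 0]) (auto simp: L2_zero)
  next
    case True
    then obtain w where w: "w \<in> L2 N" "sqnorm N w \<noteq> 0" and wi: "\<And>g. AE y in N. koop g w y = w y"
      by auto
    have [measurable]: "w \<in> borel_measurable N" using w by (simp add: L2_def)
    obtain \<kappa> where \<kappa>: "AE y in N. norm (w y) = \<kappa>"
      using koop_invariant_norm_AE_const[OF _ wi] by auto
    define a where "a = inner2 N F w / of_real (sqnorm N w)"
    define c where "c = (\<lambda>y. a * w y)"
    have c: "c \<in> L2 N" unfolding c_def by (intro L2_scale w)
    have "inner2 N (F - c) w = 0"
    proof -
      have "inner2 N F w = inner2 N (F - c) w + inner2 N c w"
        using inner2_add_left[of "F - c" N c w] c F w by (simp add: L2_diff)
      moreover have "inner2 N c w = inner2 N F w"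
        unfolding c_def inner2_scale_left inner2_self a_def using w(2) by simp
      ultimately show ?thesis by simp
    qed
    then have orth: "inner2 N w (F - c) = 0" by (subst inner2_cnj) simp
    have "sqnorm N (F - c) \<le> B / \<epsilon>\<^sup>2"
    proof (rule gap[OF c])
      show "AE y in N. koop g c y = c y" for g
        using wi[of g] unfolding c_def koop_scale by eventually_elim simp
      fix \<eta> assume \<eta>: "\<eta> \<in> cyclic (F - c)" and \<eta>i: "\<And>g. AE y in N. koop g \<eta> y = \<eta> y"
      have \<eta>L: "\<eta> \<in> L2 N" using \<eta> by (rule cyclic_L2) (intro L2_diff F c)
      then have [measurable]: "\<eta> \<in> borel_measurable N" by (simp add: L2_def)
      have "inner2 N w \<eta> = 0"
      proof (rule cyclic_orthogonal[OF \<eta> _ w(1)])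
        fix k
        have "inner2 N w (koop k (F - c)) = inner2 N (koop k w) (koop k (F - c))"
          using wi[of k] w c F by (intro inner2_cong_AE) (auto intro: koop_L2 L2_diff elim: AE_mp)
        then show "inner2 N w (koop k (F - c)) = 0"
          using orth w c F by (simp add: inner2_koop L2_diff)
      qed (intro L2_diff F c)
      moreover obtain d where d: "AE y in N. w y * cnj (\<eta> y) = d"
      proof -
        have "\<exists>d. AE y in N. w y * cnj (\<eta> y) = d"
        proof (rule invariant_complex_AE_const)
          fix g
          show "AE y in N. w (T g y) * cnj (\<eta> (T g y)) = w y * cnj (\<eta> y)"
            using wi[of g] \<eta>i[of g] AE_space
          proof eventually_elim
            case (elim y)
            have "w y * cnj (\<eta> y) = (\<theta> g y * cnj (\<theta> g y)) * (w (T g y) * cnj (\<eta> (T g y)))"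
              unfolding elim(1,2)[symmetric] by (simp add: koop_def)
            also have "\<theta> g y * cnj (\<theta> g y) = 1"
              using \<theta>_norm[OF elim(3), of g] by (simp flip: complex_norm_square)
            finally show ?case by simp
          qed
        qed simp
        with that show thesis by auto
      qed
      moreover have "inner2 N w \<eta> = (LINT y|N. d)"
        unfolding inner2_def using d by (intro integral_cong_AE) auto
      ultimately have "measure N (space N) *\<^sub>R d = 0" by simp
      moreover have "measure N (space N) \<noteq> 0"
      proof
        assume "measure N (space N) = 0"
        then have "AE y in N. False"
          by (intro AE_I[of N _ "space N"]) (auto simp: emeasure_eq_measure)
        then have "AE y in N. w y = 0" by (auto elim: AE_mp)
        with w show False by (simp add: sqnorm_eq_0_iff)
      qed
      ultimately have "d = 0" by simp
      have "\<kappa> \<noteq> 0"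
      proof
        assume "\<kappa> = 0"
        then have "AE y in N. w y = 0" using \<kappa> by auto
        with w show False by (simp add: sqnorm_eq_0_iff)
      qed
      have "AE y in N. \<eta> y = 0"
        using d \<kappa> by eventually_elim (use \<open>d = 0\<close> \<open>\<kappa> \<noteq> 0\<close> in auto)
      then show "sqnorm N \<eta> = 0" using \<eta>L by (simp add: sqnorm_eq_0_iff)
    qed
    moreover have "AE y in N. norm (c y) = norm a * \<kappa>"
      using \<kappa> by eventually_elim (simp add: c_def norm_mult)
    ultimately show ?thesis using c by blast
  qed
qed

end

section \<open>Rigid motions of the plane\<close>

lemma nn_integral_lborel_translate:
  fixes f :: "complex \<Rightarrow> ennreal"
  assumes [measurable]: "f \<in> borel_measurable borel"
  shows "(\<integral>\<^sup>+z. f (z + t) \<partial>lborel) = (\<integral>\<^sup>+z. f z \<partial>lborel)"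
proof -
  have "(\<integral>\<^sup>+z. f z \<partial>lborel) = (\<integral>\<^sup>+z. f z \<partial>distr lborel borel ((+) t))"
    by (simp only: lborel_distr_plus)
  also have "\<dots> = (\<integral>\<^sup>+z. f (t + z) \<partial>lborel)" by (subst nn_integral_distr) auto
  finally show ?thesis by (simp add: add.commute)
qed

lemma nn_integral_lborel_reflect:
  fixes f :: "complex \<Rightarrow> ennreal"
  assumes [measurable]: "f \<in> borel_measurable borel"
  shows "(\<integral>\<^sup>+z. f (t - z) \<partial>lborel) = (\<integral>\<^sup>+z. f z \<partial>lborel)"
proof -
  have "(\<integral>\<^sup>+z. f z \<partial>lborel)
      = (\<integral>\<^sup>+z. f z \<partial>density (distr lborel borel (\<lambda>x. t + (-1) *\<^sub>R x)) (\<lambda>_. ennreal (\<bar>-1::real\<bar>^DIM(complex))))"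
    by (subst lborel_affine[of "-1" t]) auto
  also have "\<dots> = (\<integral>\<^sup>+z. f (t - z) \<partial>lborel)"
    by (simp add: density_1 nn_integral_distr)
  finally show ?thesis by simp
qed

text \<open>
  The image of Lebesgue measure under a rotation is again translation invariant, so it is a multiple
  of Lebesgue measure (the Fubini argument for uniqueness of Haar measure); discs centred at \<open>0\<close>
  show that the factor is \<open>1\<close>.
\<close>

lemma emeasure_lborel_rotate:
  fixes u :: complex
  assumes u: "norm u = 1" and A: "A \<in> sets borel"
  shows "emeasure lborel ((\<lambda>z. u * z) -` A) = emeasure lborel A"
proof -
  have u0: "u \<noteq> 0" using u by auto
  have [measurable]: "A \<in> sets borel" by fact
  define D where "D = ball (0::complex) 1"
  have [measurable]: "D \<in> sets borel" by (simp add: D_def)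
  have Dpos: "0 < emeasure lborel D" "emeasure lborel D < \<infinity>"
    unfolding D_def by (simp_all add: emeasure_ball unit_ball_vol_pos emeasure_lborel_ball_finite ennreal_less_top)
  have rotD: "indicator D (u * z) = (indicator D z :: ennreal)" for z
    using u by (auto simp: D_def indicator_def norm_mult)
  define f where "f z y = indicator A (u * z) * (indicator D (y + u * z) :: ennreal)" for z y
  have [measurable]: "case_prod f \<in> borel_measurable (borel \<Otimes>\<^sub>M borel)"
    unfolding f_def split_beta' by measurable
  have fm: "case_prod f \<in> borel_measurable (lborel \<Otimes>\<^sub>M lborel)"
    by (simp add: cong: measurable_cong_sets sets_pair_measure_cong)
  have "emeasure lborel ((\<lambda>z. u * z) -` A) * emeasure lborel D = (\<integral>\<^sup>+z. \<integral>\<^sup>+y. f z y \<partial>lborel \<partial>lborel)"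
  proof -
    have "(\<integral>\<^sup>+y. f z y \<partial>lborel) = indicator ((\<lambda>z. u * z) -` A) z * emeasure lborel D" for z
    proof -
      have "(\<integral>\<^sup>+y. indicator D (y + u * z) \<partial>lborel) = emeasure lborel D"
        by (subst nn_integral_lborel_translate) simp_all
      then show ?thesis
        by (simp add: f_def nn_integral_cmult) (simp add: indicator_def)
    qed
    moreover have "(\<lambda>z. u * z) -` A \<in> sets borel"
      using measurable_sets[of "\<lambda>z. u * z" borel borel A] by simp
    ultimately show ?thesis by (simp add: nn_integral_multc)
  qed
  also have "\<dots> = (\<integral>\<^sup>+y. \<integral>\<^sup>+z. f z y \<partial>lborel \<partial>lborel)"
    using lborel_pair.Fubini'[OF fm] by simp
  also have "\<dots> = (\<integral>\<^sup>+y. \<integral>\<^sup>+z. f (z + - (y / u)) y \<partial>lborel \<partial>lborel)"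
    unfolding f_def by (subst nn_integral_lborel_translate) auto
  also have "\<dots> = (\<integral>\<^sup>+y. \<integral>\<^sup>+z. indicator A (u * z - y) * indicator D z \<partial>lborel \<partial>lborel)"
    using u0 by (simp add: f_def rotD right_diff_distrib)
  also have "\<dots> = (\<integral>\<^sup>+z. \<integral>\<^sup>+y. indicator A (u * z - y) * indicator D z \<partial>lborel \<partial>lborel)"
    by (rule lborel_pair.Fubini') (simp add: split_beta' cong: measurable_cong_sets sets_pair_measure_cong)
  also have "\<dots> = (\<integral>\<^sup>+z. emeasure lborel A * indicator D z \<partial>lborel)"
    by (simp add: nn_integral_multc nn_integral_lborel_reflect)
  also have "\<dots> = emeasure lborel A * emeasure lborel D"
    by (simp add: nn_integral_cmult)
  finally have "emeasure lborel ((\<lambda>z. u * z) -` A) * emeasure lborel D / emeasure lborel D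
      = emeasure lborel A * emeasure lborel D / emeasure lborel D" by (rule arg_cong)
  then show ?thesis
    using Dpos by (simp add: mult_divide_eq_ennreal)
qed

lemma lborel_distr_rigid:
  fixes u b :: complex
  assumes u: "norm u = 1"
  shows "distr lborel borel (\<lambda>z. u * (z - b)) = lborel"
proof (rule measure_eqI)
  fix A assume "A \<in> sets (distr lborel borel (\<lambda>z. u * (z - b)))"
  then have [measurable]: "A \<in> sets borel" by simp
  have [measurable]: "(\<lambda>z. u * z) -` A \<in> sets borel"
    using measurable_sets[of "\<lambda>z. u * z" borel borel A] by simp
  have "emeasure (distr lborel borel (\<lambda>z. u * (z - b))) A = (\<integral>\<^sup>+z. indicator A (u * (z - b)) \<partial>lborel)"
    by (subst nn_integral_distr[where f = "indicator A" and M' = borel, symmetric]) auto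
  also have "\<dots> = (\<integral>\<^sup>+z. indicator ((\<lambda>z. u * z) -` A) (z + - b) \<partial>lborel)"
    by (simp add: indicator_def)
  also have "\<dots> = (\<integral>\<^sup>+z. indicator ((\<lambda>z. u * z) -` A) z \<partial>lborel)"
    by (rule nn_integral_lborel_translate) simp
  also have "\<dots> = emeasure lborel A" by (simp add: emeasure_lborel_rotate u)
  finally show "emeasure (distr lborel borel (\<lambda>z. u * (z - b))) A = emeasure lborel A" .
qed simp

lemma emeasure_disc: "0 \<le> r \<Longrightarrow> emeasure lborel (ball (c::complex) r) = ennreal (pi * r\<^sup>2)"
  by (simp add: emeasure_ball unit_ball_vol_2)

text \<open>
  Discs of large radius \<open>R\<close> are almost invariant under translation: a shift by \<open>d\<close> changes a portion of
  relative size at most \<open>4 d / R\<close>.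
\<close>

lemma emeasure_disc_symmetric_difference:
  fixes a b :: complex
  assumes R: "0 < R"
  shows "emeasure lborel ((ball a R - ball b R) \<union> (ball b R - ball a R)) \<le> ennreal (4 * pi * R * dist a b)"
proof -
  have half: "emeasure lborel (ball a R - ball b R) \<le> ennreal (2 * pi * R * dist a b)" for a b :: complex
  proof (cases "dist a b \<le> R")
    case True
    have sub: "ball b (R - dist a b) \<subseteq> ball b R" "ball b (R - dist a b) \<subseteq> ball a R"
    proof -
      show "ball b (R - dist a b) \<subseteq> ball b R" by (rule subset_ball) simp
      show "ball b (R - dist a b) \<subseteq> ball a R"
      proof
        fix x assume "x \<in> ball b (R - dist a b)"
        then show "x \<in> ball a R" using dist_triangle[of a x b] by simp
      qed
    qed
    have "emeasure lborel (ball a R - ball b R) \<le> emeasure lborel (ball a R - ball b (R - dist a b))"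
      using sub by (intro emeasure_mono) auto
    also have "\<dots> = emeasure lborel (ball a R) - emeasure lborel (ball b (R - dist a b))"
      using sub by (intro emeasure_Diff) (auto simp: emeasure_disc True)
    also have "\<dots> = ennreal (pi * R\<^sup>2 - pi * (R - dist a b)\<^sup>2)"
      using R True by (simp add: emeasure_disc ennreal_minus)
    also have "\<dots> \<le> ennreal (2 * pi * R * dist a b)"
    proof (rule ennreal_leI)
      have "pi * R\<^sup>2 - pi * (R - dist a b)\<^sup>2 = 2 * pi * R * dist a b - pi * (dist a b)\<^sup>2"
        by (simp add: power2_eq_square algebra_simps)
      then show "pi * R\<^sup>2 - pi * (R - dist a b)\<^sup>2 \<le> 2 * pi * R * dist a b" by simp
    qed
    finally show ?thesis .
  next
    case False
    have "emeasure lborel (ball a R - ball b R) \<le> emeasure lborel (ball a R)"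
      by (intro emeasure_mono) auto
    also have "\<dots> = ennreal (pi * R * R)" using R by (simp add: emeasure_disc power2_eq_square mult.assoc)
    also have "\<dots> \<le> ennreal (2 * pi * R * dist a b)"
    proof (rule ennreal_leI)
      have "pi * R * R \<le> pi * R * dist a b" using False R by (intro mult_left_mono) auto
      also have "\<dots> \<le> 2 * (pi * R * dist a b)" using R by simp
      finally show "pi * R * R \<le> 2 * pi * R * dist a b" by (simp add: mult.assoc)
    qed
    finally show ?thesis .
  qed
  have "emeasure lborel ((ball a R - ball b R) \<union> (ball b R - ball a R))
      \<le> emeasure lborel (ball a R - ball b R) + emeasure lborel (ball b R - ball a R)"
    by (intro emeasure_subadditive) auto
  also have "\<dots> \<le> ennreal (2 * pi * R * dist a b) + ennreal (2 * pi * R * dist a b)"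
    using half[of a b] half[of b a] by (intro add_mono) (simp_all add: dist_commute)
  also have "\<dots> = ennreal (4 * pi * R * dist a b)"
    using R by (simp flip: ennreal_plus)
  finally show ?thesis .
qed

section \<open>The affine action on the plane bundle\<close>

locale affine_twisted_action = ergodic_twisted_action N \<theta> T
  for N :: "'y measure" and \<theta> :: "'g::topological_group_add \<Rightarrow> 'y \<Rightarrow> complex" and T :: "'g \<Rightarrow> 'y \<Rightarrow> 'y" +
  fixes b :: "'g \<Rightarrow> 'y \<Rightarrow> complex"
  assumes b_integrable: "\<And>g. integrable N (b g)"
    and b_add: "\<And>g k. AE x in N. b (g + k) x = b g x + koop g (b k) x"
    and b_continuous: "\<And>g\<^sub>0. ((\<lambda>g. LINT x|N. norm (b g x - b g\<^sub>0 x)) \<longlongrightarrow> 0) (at g\<^sub>0)"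
begin

lemma b_measurable [measurable]: "b g \<in> borel_measurable N"
  using b_integrable by auto

lemma b_0: "AE x in N. b 0 x = 0"
proof -
  have "AE x in N. b 0 x = b 0 x + koop 0 (b 0) x" using b_add[of 0 0] by simp
  then show ?thesis using koop_0[of "b 0"] by eventually_elim simp
qed

text \<open>
  The inverse of the isometry \<open>w \<mapsto> \<theta> g x * w + b g x\<close>. A primitive of \<open>b\<close> is the same as a measurable
  section of the bundle \<open>N \<times> \<complex>\<close> that is invariant under the resulting skew product.
\<close>

definition rigid :: "'g \<Rightarrow> 'y \<Rightarrow> complex \<Rightarrow> complex" where
  "rigid g x z = cnj (\<theta> g x) * (z - b g x)"

definition skew :: "'g \<Rightarrow> 'y \<times> complex \<Rightarrow> 'y \<times> complex" where
  "skew g = (\<lambda>(x, z). (T g x, rigid g x z))"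

abbreviation plane_bundle :: "('y \<times> complex) measure" where
  "plane_bundle \<equiv> N \<Otimes>\<^sub>M lborel"

lemma pair_sigma_finite_bundle: "pair_sigma_finite N lborel"
  by (intro pair_sigma_finite.intro sigma_finite_measure_axioms sigma_finite_lborel)

lemma measurable_bundle: "measurable plane_bundle X = measurable (N \<Otimes>\<^sub>M borel) X"
  by (intro measurable_cong_sets sets_pair_measure_cong) auto

lemma measurable_into_bundle: "measurable X plane_bundle = measurable X (N \<Otimes>\<^sub>M borel)"
  by (intro measurable_cong_sets sets_pair_measure_cong) auto

lemma rigid_measurable [measurable]: "rigid g x \<in> borel_measurable borel"
  unfolding rigid_def by measurable

lemma skew_measurable [measurable]: "skew g \<in> measurable plane_bundle plane_bundle"
  unfolding skew_def rigid_def measurable_bundle measurable_into_bundle by measurable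

lemma cnj_\<theta>: "x \<in> space N \<Longrightarrow> cnj (\<theta> g x) * \<theta> g x = 1"
  using \<theta>_norm[of x g] by (subst mult.commute) (simp flip: complex_norm_square)

lemma rigid_inverse: "x \<in> space N \<Longrightarrow> \<theta> g x * rigid g x z + b g x = z"
  using cnj_\<theta>[of x g] unfolding rigid_def
  by (simp add: mult.assoc[symmetric] mult.commute[of "\<theta> g x" "cnj _"])

lemma distr_rigid: "x \<in> space N \<Longrightarrow> distr lborel borel (rigid g x) = lborel"
  unfolding rigid_def by (rule lborel_distr_rigid) (simp add: \<theta>_norm)

lemma dist_rigid: "x \<in> space N \<Longrightarrow> dist (rigid g x y) (rigid g x z) = dist y z"
  unfolding rigid_def dist_norm by (simp add: \<theta>_norm norm_mult flip: right_diff_distrib)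

lemma nn_integral_rigid:
  assumes "x \<in> space N" "f \<in> borel_measurable borel"
  shows "(\<integral>\<^sup>+z. f (rigid g x z) \<partial>lborel) = (\<integral>\<^sup>+z. f z \<partial>lborel)"
  using nn_integral_distr[of "rigid g x" lborel borel f] assms by (simp add: distr_rigid)

lemma AE_bundleI:
  assumes "AE x in N. Q x"
  shows "AE p in plane_bundle. Q (fst p)"
proof -
  obtain A where A: "A \<in> null_sets N" "{x \<in> space N. \<not> Q x} \<subseteq> A"
    using assms by (auto elim!: AE_E)
  interpret pair_sigma_finite N lborel by (rule pair_sigma_finite_bundle)
  have "A \<times> UNIV \<in> null_sets plane_bundle"
    using A(1) by (auto simp: null_sets_def lborel.emeasure_pair_measure_Times)
  then show ?thesis by (rule AE_I') (use A(2) in \<open>auto simp: space_pair_measure\<close>)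
qed

lemma distr_skew: "distr plane_bundle plane_bundle (skew g) = plane_bundle"
proof (rule measure_eqI)
  interpret pair_sigma_finite N lborel by (rule pair_sigma_finite_bundle)
  fix A assume "A \<in> sets (distr plane_bundle plane_bundle (skew g))"
  then have A[measurable]: "A \<in> sets plane_bundle" unfolding sets_distr .
  have sec[measurable]: "Pair x -` A \<in> sets borel" for x
    using sets_Pair1[OF A, of x] unfolding sets_lborel .
  have "emeasure (distr plane_bundle plane_bundle (skew g)) A = emeasure plane_bundle (skew g -` A \<inter> space plane_bundle)"
    by (rule emeasure_distr[OF skew_measurable A])
  also have "\<dots> = (\<integral>\<^sup>+x. emeasure lborel (Pair x -` (skew g -` A \<inter> space plane_bundle)) \<partial>N)"
    by (rule lborel.emeasure_pair_measure_alt) (rule measurable_sets[OF skew_measurable A])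
  also have "\<dots> = (\<integral>\<^sup>+x. emeasure lborel (Pair (T g x) -` A) \<partial>N)"
  proof (rule nn_integral_cong)
    fix x assume x: "x \<in> space N"
    then have "Pair x -` (skew g -` A \<inter> space plane_bundle) = rigid g x -` (Pair (T g x) -` A)"
      by (auto simp: skew_def space_pair_measure)
    moreover have "emeasure lborel (rigid g x -` (Pair (T g x) -` A)) = emeasure (distr lborel borel (rigid g x)) (Pair (T g x) -` A)"
      by (subst emeasure_distr) auto
    ultimately show "emeasure lborel (Pair x -` (skew g -` A \<inter> space plane_bundle)) = emeasure lborel (Pair (T g x) -` A)"
      by (simp add: distr_rigid[OF x])
  qed
  also have "\<dots> = (\<integral>\<^sup>+x. emeasure lborel (Pair x -` A) \<partial>distr N N (T g))"
    by (subst nn_integral_distr) (auto intro: lborel.measurable_emeasure_Pair)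
  also have "\<dots> = emeasure plane_bundle A"
    unfolding T_preserves by (rule lborel.emeasure_pair_measure_alt[OF A, symmetric])
  finally show "emeasure (distr plane_bundle plane_bundle (skew g)) A = emeasure plane_bundle A" .
qed simp

sublocale skew: twisted_action plane_bundle "\<lambda>_ _. 1" skew
proof
  show "AE p in plane_bundle. skew 0 p = p"
    using AE_bundleI[OF T_0] AE_bundleI[OF \<theta>_0] AE_bundleI[OF b_0]
    by eventually_elim (simp add: skew_def rigid_def split_beta)
  fix g k
  have "AE p in plane_bundle. b (g + k) (fst p) = b g (fst p) + koop g (b k) (fst p)"
    by (rule AE_bundleI[OF b_add])
  then show "AE p in plane_bundle. skew (g + k) p = skew k (skew g p)"
    using AE_bundleI[OF T_add[of g k]] AE_bundleI[OF \<theta>_add[of g k]] AE_space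
  proof eventually_elim
    case (elim p)
    then have x: "fst p \<in> space N" by (auto simp: space_pair_measure)
    have "cnj (\<theta> g (fst p)) * koop g (b k) (fst p) = b k (T g (fst p))"
      using cnj_\<theta>[OF x, of g] by (simp add: koop_def flip: mult.assoc)
    then have "rigid (g + k) (fst p) (snd p) = rigid k (T g (fst p)) (rigid g (fst p) (snd p))"
      unfolding rigid_def elim(1,3)
      by (simp add: algebra_simps)
    then show ?case using elim(2) by (simp add: skew_def split_beta)
  qed
qed (auto simp: distr_skew)

text \<open>The indicator of the disc bundle of radius \<open>R\<close>, an almost invariant vector when \<open>R\<close> is large.\<close>

definition disc :: "real \<Rightarrow> 'y \<times> complex \<Rightarrow> complex" where
  "disc R = (\<lambda>(x, z). indicator (ball 0 R) z)"

lemma disc_measurable [measurable]: "disc R \<in> borel_measurable plane_bundle"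
  unfolding disc_def split_beta' measurable_bundle
  by (rule measurable_compose[OF measurable_snd borel_measurable_indicator]) simp

lemma nn_integral_disc:
  assumes "0 \<le> R"
  shows "(\<integral>\<^sup>+p. ennreal ((norm (disc R p))\<^sup>2) \<partial>plane_bundle) = ennreal (pi * R\<^sup>2 * measure N (space N))"
proof -
  interpret pair_sigma_finite N lborel by (rule pair_sigma_finite_bundle)
  have "(\<integral>\<^sup>+p. ennreal ((norm (disc R p))\<^sup>2) \<partial>plane_bundle) = (\<integral>\<^sup>+x. \<integral>\<^sup>+z. ennreal ((norm (disc R (x, z)))\<^sup>2) \<partial>lborel \<partial>N)"
    by (rule lborel.nn_integral_fst[symmetric]) measurable
  also have "\<dots> = (\<integral>\<^sup>+x. \<integral>\<^sup>+z. indicator (ball (0::complex) R) z \<partial>lborel \<partial>N)"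
  proof -
    have "ennreal ((norm (disc R (x, z)))\<^sup>2) = indicator (ball 0 R) z" for x z
      by (simp add: disc_def split: split_indicator)
    then show ?thesis by simp
  qed
  also have "\<dots> = ennreal (pi * R\<^sup>2) * emeasure N (space N)"
    using assms by (simp add: emeasure_disc)
  also have "\<dots> = ennreal (pi * R\<^sup>2 * measure N (space N))"
    by (simp add: emeasure_eq_measure ennreal_mult)
  finally show ?thesis .
qed

lemma disc_L2: "0 \<le> R \<Longrightarrow> disc R \<in> L2 plane_bundle"
  by (rule L2I_nn_integral) (simp_all add: nn_integral_disc)

lemma sqnorm_disc: "0 \<le> R \<Longrightarrow> sqnorm plane_bundle (disc R) = pi * R\<^sup>2 * measure N (space N)"
  using sqnorm_nn_integral[OF disc_L2, of R] by (simp add: nn_integral_disc)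

lemma koop_disc:
  assumes "x \<in> space N"
  shows "skew.koop g (disc R) (x, z) = indicator (ball (b g x) R) z"
proof -
  have "norm (rigid g x z) = dist (b g x) z"
    using assms by (simp add: rigid_def norm_mult \<theta>_norm dist_norm norm_minus_commute)
  then show ?thesis by (simp add: skew.koop_def disc_def skew_def indicator_def)
qed

lemma sqnorm_koop_disc_diff:
  assumes R: "0 < R"
  shows "sqnorm plane_bundle (skew.koop g (disc R) - skew.koop k (disc R)) \<le> 4 * pi * R * (LINT x|N. norm (b g x - b k x))"
proof -
  interpret pair_sigma_finite N lborel by (rule pair_sigma_finite_bundle)
  let ?v = "skew.koop g (disc R) - skew.koop k (disc R)"
  have L: "?v \<in> L2 plane_bundle"
    using R by (intro L2_diff skew.koop_L2 disc_L2) auto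
  then have [measurable]: "?v \<in> borel_measurable plane_bundle" by (simp add: L2_def)
  have "ennreal (sqnorm plane_bundle ?v) = (\<integral>\<^sup>+p. ennreal ((norm (?v p))\<^sup>2) \<partial>plane_bundle)"
    by (simp only: sqnorm_nn_integral[OF L])
  also have "\<dots> = (\<integral>\<^sup>+x. \<integral>\<^sup>+z. ennreal ((norm (?v (x, z)))\<^sup>2) \<partial>lborel \<partial>N)"
    by (rule lborel.nn_integral_fst[symmetric]) measurable
  also have "\<dots> \<le> (\<integral>\<^sup>+x. ennreal (4 * pi * R * norm (b g x - b k x)) \<partial>N)"
  proof (rule nn_integral_mono)
    fix x assume x: "x \<in> space N"
    let ?A = "ball (b g x) R" and ?B = "ball (b k x) R"
    have "(\<integral>\<^sup>+z. ennreal ((norm (?v (x, z)))\<^sup>2) \<partial>lborel)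
        = (\<integral>\<^sup>+z. indicator ((?A - ?B) \<union> (?B - ?A)) z \<partial>lborel)"
      by (intro nn_integral_cong) (auto simp: koop_disc[OF x] indicator_def)
    also have "\<dots> = emeasure lborel ((?A - ?B) \<union> (?B - ?A))" by simp
    also have "\<dots> \<le> ennreal (4 * pi * R * norm (b g x - b k x))"
      using emeasure_disc_symmetric_difference[OF R] by (simp add: dist_norm)
    finally show "(\<integral>\<^sup>+z. ennreal ((norm (?v (x, z)))\<^sup>2) \<partial>lborel) \<le> ennreal (4 * pi * R * norm (b g x - b k x))" .
  qed
  also have "\<dots> = ennreal (LINT x|N. 4 * pi * R * norm (b g x - b k x))"
    using R by (intro nn_integral_eq_integral integrable_mult_right integrable_norm
        Bochner_Integration.integrable_diff b_integrable) auto
  finally show ?thesis using R by simp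
qed

lemma bounded_on_compact:
  fixes Q :: "'g set"
  assumes "compact Q"
  shows "\<exists>B>0. \<forall>g\<in>Q. (LINT x|N. norm (b g x)) \<le> B"
proof -
  obtain B where "\<forall>g\<in>Q. (LINT x|N. norm (b g x) powr 1) \<le> B"
    using integral_powr_bounded_on_compact[OF assms, of 1 b N] b_integrable b_continuous
    by (auto simp: Lp_def)
  then show ?thesis by (intro exI[of _ "max B 1"]) (auto simp: le_max_iff_disj)
qed

lemma exists_invariant_density:
  fixes Q :: "'g set"
  assumes Q: "kazhdan_pair Q \<epsilon>" and pos: "measure N (space N) \<noteq> 0"
  shows "\<exists>\<eta>\<in>L2 plane_bundle. sqnorm plane_bundle \<eta> \<noteq> 0 \<and> (\<forall>g. AE p in plane_bundle. \<eta> (skew g p) = \<eta> p)"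
proof -
  have \<epsilon>: "0 < \<epsilon>" by (rule kazhdan_pair_pos[OF Q])
  have m: "0 < measure N (space N)" using pos by (simp add: zero_less_measure_iff)
  obtain B where B: "0 < B" "\<And>g. g \<in> Q \<Longrightarrow> (LINT x|N. norm (b g x)) \<le> B"
    using bounded_on_compact[OF kazhdan_pair_compact[OF Q]] by auto
  \<comment> \<open>With this radius \<open>4 * pi * R * B\<close>, which bounds the displacement of the disc bundle, is half of
    \<open>\<epsilon>\<^sup>2\<close> times its squared norm.\<close>
  define R where "R = 8 * B / (\<epsilon>\<^sup>2 * measure N (space N))"
  have R: "0 < R" unfolding R_def using B(1) m \<epsilon> by (intro divide_pos_pos mult_pos_pos zero_less_power) auto
  have "\<exists>\<eta>\<in>skew.cyclic (disc R). sqnorm plane_bundle \<eta> \<noteq> 0 \<and> (\<forall>g. AE p in plane_bundle. skew.koop g \<eta> p = \<eta> p)"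
  proof (rule skew.kazhdan_invariant_vector[OF Q])
    show "disc R \<in> L2 plane_bundle" using R by (intro disc_L2) simp
    show "sqnorm plane_bundle (disc R) \<noteq> 0" using R m by (simp add: sqnorm_disc)
    fix g\<^sub>0
    have "((\<lambda>g. 4 * pi * R * (LINT x|N. norm (b g x - b g\<^sub>0 x))) \<longlongrightarrow> 4 * pi * R * 0) (at g\<^sub>0)"
      by (intro tendsto_intros b_continuous)
    then have lim: "((\<lambda>g. 4 * pi * R * (LINT x|N. norm (b g x - b g\<^sub>0 x))) \<longlongrightarrow> 0) (at g\<^sub>0)"
      by simp
    show "((\<lambda>g. sqnorm plane_bundle (skew.koop g (disc R) - skew.koop g\<^sub>0 (disc R))) \<longlongrightarrow> 0) (at g\<^sub>0)"
      by (rule Lim_null_comparison[OF _ lim]) (simp add: sqnorm_koop_disc_diff[OF R])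
  next
    fix g assume g: "g \<in> Q"
    have "sqnorm plane_bundle (skew.koop g (disc R) - disc R) = sqnorm plane_bundle (skew.koop g (disc R) - skew.koop 0 (disc R))"
    proof (rule sqnorm_cong_AE)
      show "AE p in plane_bundle. (skew.koop g (disc R) - disc R) p = (skew.koop g (disc R) - skew.koop 0 (disc R)) p"
        using skew.koop_0[of "disc R"] by eventually_elim simp
    qed (use R in \<open>auto intro!: L2_diff skew.koop_L2 disc_L2\<close>)
    also have "\<dots> \<le> 4 * pi * R * (LINT x|N. norm (b g x - b 0 x))"
      by (rule sqnorm_koop_disc_diff[OF R])
    also have "(LINT x|N. norm (b g x - b 0 x)) = (LINT x|N. norm (b g x))"
    proof (rule integral_cong_AE)
      show "AE x in N. norm (b g x - b 0 x) = norm (b g x)"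
        using b_0 by eventually_elim simp
    qed measurable
    also have "4 * pi * R * (LINT x|N. norm (b g x)) \<le> 4 * pi * R * B"
      using B(2)[OF g] R by simp
    also have "\<dots> < \<epsilon>\<^sup>2 * (pi * R\<^sup>2 * measure N (space N))"
    proof -
      have "\<epsilon>\<^sup>2 * (pi * R\<^sup>2 * measure N (space N)) = pi * R * (R * (\<epsilon>\<^sup>2 * measure N (space N)))"
        by (simp add: power2_eq_square algebra_simps)
      also have "R * (\<epsilon>\<^sup>2 * measure N (space N)) = 8 * B"
        using \<epsilon> m by (simp add: R_def)
      finally show ?thesis using R B by simp
    qed
    finally show "sqnorm plane_bundle (skew.koop g (disc R) - disc R) < \<epsilon>\<^sup>2 * sqnorm plane_bundle (disc R)"
      by (simp only: sqnorm_disc[OF less_imp_le[OF R]])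
  qed
  then obtain \<eta> where "\<eta> \<in> skew.cyclic (disc R)" "sqnorm plane_bundle \<eta> \<noteq> 0" "\<And>g. AE p in plane_bundle. skew.koop g \<eta> p = \<eta> p"
    by auto
  moreover from this(1) have "\<eta> \<in> L2 plane_bundle" by (rule skew.cyclic_L2) (use R in \<open>simp add: disc_L2\<close>)
  ultimately show ?thesis by (auto simp: skew.koop_def)
qed

end

context affine_twisted_action
begin

text \<open>
  A measurable equivariant field of finite densities \<open>w (x, _)\<close> on the plane yields an equivariant
  section. The densities need not have a barycentre, so each is first replaced by a bounded set: the
  centres of those discs of a fixed radius \<open>R\<close> that carry more than two thirds of the mass. Two such
  discs intersect, which bounds the set; for large \<open>R\<close> it has positive area for some, hence by
  ergodicity for almost every \<open>x\<close>. Its centroid is the section.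
\<close>

lemma equivariant_section:
  assumes w[measurable]: "w \<in> borel_measurable (N \<Otimes>\<^sub>M borel)"
    and w_inv: "\<And>g. AE x in N. AE z in lborel. w (T g x, rigid g x z) = (w (x, z) :: ennreal)"
    and \<kappa>: "0 < \<kappa>" "AE x in N. (\<integral>\<^sup>+z. w (x, z) \<partial>lborel) = ennreal \<kappa>"
    and pos: "measure N (space N) \<noteq> 0"
  shows "\<exists>f\<in>borel_measurable N. \<forall>g. AE x in N. b g x = f x - koop g f x"
proof -
  define c where "c = 2 * \<kappa> / 3"
  have c: "0 < c" "c < \<kappa>" "\<kappa> < c + c" using \<kappa> by (auto simp: c_def)
  have nontrivial: "\<not> (AE x in N. False)"
    using pos by (subst AE_iff_null) (auto simp: null_sets_def emeasure_eq_measure)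
  have w_sec[measurable]: "(\<lambda>z. w (x, z)) \<in> borel_measurable borel" if "x \<in> space N" for x
    using measurable_compose[OF measurable_Pair1' w] that by simp
  have "\<exists>n. \<not> (AE x in N. (\<integral>\<^sup>+z. w (x, z) * indicator (ball 0 (real n)) z \<partial>lborel) \<le> ennreal c)"
  proof (rule ccontr)
    assume "\<not> ?thesis"
    then have "AE x in N. \<forall>n. (\<integral>\<^sup>+z. w (x, z) * indicator (ball 0 (real n)) z \<partial>lborel) \<le> ennreal c"
      unfolding AE_all_countable by blast
    then have "AE x in N. False"
      using \<kappa>(2) AE_space
    proof eventually_elim
      case (elim x)
      have "(SUP n. w (x, z) * indicator (ball 0 (real n)) z) = w (x, z)" for z :: complex
      proof (rule antisym)
        obtain n where "norm z < real n" using reals_Archimedean2 by blast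
        then show "w (x, z) \<le> (SUP n. w (x, z) * indicator (ball 0 (real n)) z)"
          by (intro SUP_upper2[of n]) auto
      qed (auto intro!: SUP_least simp: indicator_def)
      then have "(\<integral>\<^sup>+z. w (x, z) \<partial>lborel) = (\<integral>\<^sup>+z. (SUP n. w (x, z) * indicator (ball 0 (real n)) z) \<partial>lborel)"
        by simp
      also have "\<dots> = (SUP n. \<integral>\<^sup>+z. w (x, z) * indicator (ball 0 (real n)) z \<partial>lborel)"
      proof (rule nn_integral_monotone_convergence_SUP)
        show "incseq (\<lambda>n z. w (x, z) * indicator (ball 0 (real n)) z)"
          by (auto simp: incseq_def le_fun_def indicator_def)
        show "(\<lambda>z. w (x, z) * indicator (ball 0 (real n)) z) \<in> borel_measurable lborel" for n
          using w_sec[OF elim(3)]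
          by (intro borel_measurable_times_ennreal borel_measurable_indicator) simp_all
      qed
      also have "\<dots> \<le> ennreal c" using elim(1) by (intro SUP_least) auto
      finally show False using elim(2) c by simp
    qed
    with nontrivial show False ..
  qed
  then obtain n where n: "\<not> (AE x in N. (\<integral>\<^sup>+z. w (x, z) * indicator (ball 0 (real n)) z \<partial>lborel) \<le> ennreal c)"
    by auto
  \<comment> \<open>The disc of radius \<open>R\<close> about any point of the unit disc contains the disc of radius \<open>n\<close> about \<open>0\<close>, so
    that whenever the latter has mass above \<open>c\<close>, the set of centres has at least the area of the unit disc.\<close>
  define R where "R = real n + 1"
  define u where "u x y = (\<integral>\<^sup>+z. (if dist y z < R then w (x, z) else 0) \<partial>lborel)" for x and y :: complex
  define V where "V x = (LINT y|lborel. (if ennreal c < u x y then 1 else 0 :: real))" for x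
  define C where "C x = (LINT y|lborel. (if ennreal c < u x y then y else 0))" for x
  have [measurable]: "(\<lambda>p. u (fst p) (snd p)) \<in> borel_measurable (N \<Otimes>\<^sub>M borel)"
  proof -
    have "(\<lambda>q. if dist (snd (fst q)) (snd q) < R then w (fst (fst q), snd q) else 0)
        \<in> borel_measurable ((N \<Otimes>\<^sub>M borel) \<Otimes>\<^sub>M borel)"
      by measurable
    then have "case_prod (\<lambda>p z. if dist (snd p) z < R then w (fst p, z) else 0)
        \<in> borel_measurable ((N \<Otimes>\<^sub>M borel) \<Otimes>\<^sub>M lborel)"
      by (simp add: split_beta' cong: measurable_cong_sets sets_pair_measure_cong)
    then show ?thesis unfolding u_def by (rule lborel.borel_measurable_nn_integral)
  qed
  have u_sec: "u x \<in> borel_measurable borel" if "x \<in> space N" for x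
    using measurable_compose[OF measurable_Pair1'[OF that], of "\<lambda>p. u (fst p) (snd p)" borel borel] by simp
  have V_meas[measurable]: "V \<in> borel_measurable N"
  proof -
    have "(\<lambda>q. if ennreal c < u (fst q) (snd q) then 1 else 0 :: real) \<in> borel_measurable (N \<Otimes>\<^sub>M borel)"
      by measurable
    then have "case_prod (\<lambda>x y. if ennreal c < u x y then 1 else 0 :: real) \<in> borel_measurable (N \<Otimes>\<^sub>M lborel)"
      by (simp add: split_beta' cong: measurable_cong_sets sets_pair_measure_cong)
    then show ?thesis unfolding V_def by (rule lborel.borel_measurable_lebesgue_integral)
  qed
  have C_meas[measurable]: "C \<in> borel_measurable N"
  proof -
    have "(\<lambda>q. if ennreal c < u (fst q) (snd q) then snd q else 0) \<in> borel_measurable (N \<Otimes>\<^sub>M borel)"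
      by measurable
    then have "case_prod (\<lambda>x y. if ennreal c < u x y then y else 0) \<in> borel_measurable (N \<Otimes>\<^sub>M lborel)"
      by (simp add: split_beta' cong: measurable_cong_sets sets_pair_measure_cong)
    then show ?thesis unfolding C_def by (rule lborel.borel_measurable_lebesgue_integral)
  qed
  have close: "dist y y' < 2 * R"
    if x: "x \<in> space N" "(\<integral>\<^sup>+z. w (x, z) \<partial>lborel) = ennreal \<kappa>" and y: "ennreal c < u x y" "ennreal c < u x y'" for x y y'
  proof (rule ccontr)
    assume far: "\<not> dist y y' < 2 * R"
    have [measurable]: "(\<lambda>z. w (x, z)) \<in> borel_measurable borel" using x(1) by (rule w_sec)
    have "ennreal c + ennreal c \<le> u x y + u x y'" using y by (intro add_mono) auto
    also have "\<dots> = (\<integral>\<^sup>+z. (if dist y z < R then w (x, z) else 0) + (if dist y' z < R then w (x, z) else 0) \<partial>lborel)"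
      unfolding u_def by (subst nn_integral_add) auto
    also have "\<dots> \<le> (\<integral>\<^sup>+z. w (x, z) \<partial>lborel)"
    proof (rule nn_integral_mono)
      fix z :: complex
      have "\<not> (dist y z < R \<and> dist y' z < R)"
        using far dist_triangle2[of y y' z] by auto
      then show "(if dist y z < R then w (x, z) else 0) + (if dist y' z < R then w (x, z) else 0) \<le> w (x, z)"
        by auto
    qed
    finally show False using x(2) c by (simp flip: ennreal_plus)
  qed
  have int: "integrable lborel (\<lambda>y. if ennreal c < u x y then 1 else 0 :: real)"
            "integrable lborel (\<lambda>y. if ennreal c < u x y then y else 0)"
    if x: "x \<in> space N" "(\<integral>\<^sup>+z. w (x, z) \<partial>lborel) = ennreal \<kappa>" for x
  proof -
    have [measurable]: "u x \<in> borel_measurable borel" using x(1) by (rule u_sec)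
    obtain y0 where y0: "ennreal c < u x y \<Longrightarrow> y \<in> ball y0 (2 * R)" for y
    proof (cases "\<exists>y0. ennreal c < u x y0")
      case True
      then obtain y0 where "ennreal c < u x y0" by auto
      with close[OF x] show thesis by (intro that[of y0]) auto
    qed (use that[of 0] in auto)
    define L where "L = norm y0 + 2 * R + 1"
    have ind: "integrable lborel (\<lambda>y. L * indicator (ball y0 (2 * R)) y)"
      by (intro integrable_mult_right integrable_real_indicator) (auto simp: emeasure_lborel_ball_finite[unfolded infinity_ennreal_def])
    have bd: "norm y \<le> L" "1 \<le> L" if "ennreal c < u x y" for y
    proof -
      have d: "dist y0 y < 2 * R" using y0[OF that] by simp
      moreover have "norm y \<le> norm y0 + dist y0 y"
        using norm_triangle_sub[of y y0] by (simp add: dist_norm norm_minus_commute)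
      ultimately show "norm y \<le> L" by (simp add: L_def)
      have "0 \<le> dist y0 y" by simp
      with d have "0 \<le> R" by linarith
      then show "1 \<le> L" by (simp add: L_def)
    qed
    show "integrable lborel (\<lambda>y. if ennreal c < u x y then 1 else 0 :: real)"
    proof (rule Bochner_Integration.integrable_bound[OF ind], measurable, rule AE_I2)
      fix y show "norm (if ennreal c < u x y then 1 else 0 :: real) \<le> norm (L * indicator (ball y0 (2 * R)) y)"
        using y0[of y] bd[of y] by (cases "ennreal c < u x y") auto
    qed
    show "integrable lborel (\<lambda>y. if ennreal c < u x y then y else 0)"
    proof (rule Bochner_Integration.integrable_bound[OF ind], measurable, rule AE_I2)
      fix y show "norm (if ennreal c < u x y then y else 0) \<le> norm (L * indicator (ball y0 (2 * R)) y)"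
        using y0[of y] bd[of y] by (cases "ennreal c < u x y") auto
    qed
  qed
  have equi: "AE x in N. \<forall>y. u (T g x) (rigid g x y) = u x y" for g
    using w_inv[of g] AE_space
  proof eventually_elim
    case (elim x)
    have Tx: "T g x \<in> space N" using measurable_space[OF T_measurable elim(2)] .
    show ?case
    proof
      fix y
      have "(\<integral>\<^sup>+z. (if dist (rigid g x y) (rigid g x z) < R then w (T g x, rigid g x z) else 0) \<partial>lborel)
          = (\<integral>\<^sup>+z. (if dist (rigid g x y) z < R then w (T g x, z) else 0) \<partial>lborel)"
        by (rule nn_integral_rigid[OF elim(2)]) (use w_sec[OF Tx] in measurable)
      moreover have "u x y
          = (\<integral>\<^sup>+z. (if dist (rigid g x y) (rigid g x z) < R then w (T g x, rigid g x z) else 0) \<partial>lborel)"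
        unfolding u_def
        by (rule nn_integral_cong_AE) (use elim in \<open>auto elim!: eventually_mono simp: dist_rigid\<close>)
      ultimately show "u (T g x) (rigid g x y) = u x y" by (simp add: u_def)
    qed
  qed
  have V_inv: "AE x in N. V (T g x) = V x" for g
    using equi[of g] AE_space
  proof eventually_elim
    case (elim x)
    have [measurable]: "u (T g x) \<in> borel_measurable borel"
      using measurable_space[OF T_measurable elim(2)] by (rule u_sec)
    have "V (T g x) = (LINT y|distr lborel borel (rigid g x). (if ennreal c < u (T g x) y then 1 else 0))"
      unfolding V_def distr_rigid[OF elim(2)] ..
    also have "\<dots> = (LINT y|lborel. (if ennreal c < u (T g x) (rigid g x y) then 1 else 0))"
      by (rule integral_distr) auto
    also have "\<dots> = V x" using elim(1) by (simp add: V_def)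
    finally show ?case .
  qed
  obtain \<nu> where \<nu>: "AE x in N. V x = \<nu>"
    using invariant_real_AE_const[OF V_meas V_inv] by auto
  have "\<nu> \<noteq> 0"
  proof
    assume "\<nu> = 0"
    have "AE x in N. (\<integral>\<^sup>+z. w (x, z) * indicator (ball 0 (real n)) z \<partial>lborel) \<le> ennreal c"
      using \<nu> \<kappa>(2) AE_space
    proof eventually_elim
      case (elim x)
      have [measurable]: "u x \<in> borel_measurable borel" "(\<lambda>z. w (x, z)) \<in> borel_measurable borel"
        using elim by (auto intro: u_sec w_sec)
      show ?case
      proof (rule ccontr)
        assume big: "\<not> ?case"
        have "ennreal c < u x y" if "y \<in> ball 0 1" for y
        proof -
          have "(\<integral>\<^sup>+z. w (x, z) * indicator (ball 0 (real n)) z \<partial>lborel) \<le> u x y"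
            unfolding u_def
          proof (rule nn_integral_mono)
            fix z :: complex
            have "dist y z < R" if "norm z < real n"
              using that \<open>y \<in> ball 0 1\<close> norm_triangle_ineq4[of y z] by (simp add: R_def dist_norm)
            then show "w (x, z) * indicator (ball 0 (real n)) z \<le> (if dist y z < R then w (x, z) else 0)"
              by (auto simp: indicator_def)
          qed
          with big show ?thesis by simp
        qed
        moreover have "integrable lborel (indicator (ball (0::complex) 1) :: complex \<Rightarrow> real)"
          by (intro integrable_real_indicator) (auto simp: emeasure_lborel_ball_finite[unfolded infinity_ennreal_def])
        ultimately have "(LINT y|lborel. indicator (ball (0::complex) 1) y) \<le> V x"
          unfolding V_def using int(1)[OF elim(3,2)]
          by (intro integral_mono) (auto split: split_indicator)
        then have "measure lborel (ball (0::complex) 1) \<le> 0"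
          using elim(1) \<open>\<nu> = 0\<close> by simp
        moreover have "measure lborel (ball (0::complex) 1) = pi"
          by (simp add: measure_def emeasure_disc)
        ultimately show False using pi_gt_zero by linarith
      qed
    qed
    with n show False ..
  qed
  have C_equi: "AE x in N. C x = \<theta> g x * C (T g x) + b g x * \<nu>" for g
    using equi[of g] AE_space AE_T[OF \<nu>, of g] AE_T[OF \<kappa>(2), of g]
  proof eventually_elim
    case (elim x)
    have Tx: "T g x \<in> space N" using measurable_space[OF T_measurable elim(2)] .
    have [measurable]: "u (T g x) \<in> borel_measurable borel" by (rule u_sec[OF Tx])
    let ?F = "\<lambda>y. if ennreal c < u (T g x) y then \<theta> g x * y + b g x else 0"
    have "C x = (LINT y|lborel. ?F (rigid g x y))"
      unfolding C_def using elim(1,2) by (intro Bochner_Integration.integral_cong) (auto simp: rigid_inverse)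
    also have "\<dots> = (LINT y|distr lborel borel (rigid g x). ?F y)"
      by (rule integral_distr[symmetric]) auto
    also have "\<dots> = (LINT y|lborel. \<theta> g x * (if ennreal c < u (T g x) y then y else 0)
        + b g x * complex_of_real (if ennreal c < u (T g x) y then 1 else 0))"
      unfolding distr_rigid[OF elim(2)] by (intro Bochner_Integration.integral_cong) auto
    also have "\<dots> = \<theta> g x * C (T g x) + b g x * complex_of_real (V (T g x))"
      unfolding C_def V_def using int[OF Tx elim(4)]
      by (subst Bochner_Integration.integral_add[OF integrable_mult_right integrable_mult_right[OF integrable_of_real]])
         (simp_all only: integral_mult_right_zero integral_complex_of_real)
    finally show ?case using elim(3) by simp
  qed
  define f where "f x = C x / complex_of_real \<nu>" for x
  have "f \<in> borel_measurable N" unfolding f_def by measurable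
  moreover have "AE x in N. b g x = f x - koop g f x" for g
    using C_equi[of g] by eventually_elim (use \<open>\<nu> \<noteq> 0\<close> in \<open>simp add: f_def koop_def field_simps\<close>)
  ultimately show ?thesis by blast
qed

text \<open>
  For a group with property (T) a cocycle with values in \<open>L\<^sub>1\<close> has a measurable primitive: the squared
  modulus of an invariant vector in \<open>L\<^sub>2\<close> of the plane bundle is an equivariant field of densities.
\<close>

lemma exists_primitive:
  assumes Q: "kazhdan_pair (Q :: 'g set) \<epsilon>" and pos: "measure N (space N) \<noteq> 0"
  shows "\<exists>f\<in>borel_measurable N. \<forall>g. AE x in N. b g x = f x - koop g f x"
proof -
  interpret pair_sigma_finite N lborel by (rule pair_sigma_finite_bundle)
  obtain \<eta> where \<eta>: "\<eta> \<in> L2 plane_bundle" "sqnorm plane_bundle \<eta> \<noteq> 0"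
      and inv: "\<And>g. AE p in plane_bundle. \<eta> (skew g p) = \<eta> p"
    using exists_invariant_density[OF assms] by auto
  define w where "w p = ennreal ((norm (\<eta> p))\<^sup>2)" for p
  have "\<eta> \<in> borel_measurable plane_bundle" using \<eta> by (simp add: L2_def)
  then have [measurable]: "\<eta> \<in> borel_measurable (N \<Otimes>\<^sub>M borel)" unfolding measurable_bundle .
  have w[measurable]: "w \<in> borel_measurable (N \<Otimes>\<^sub>M borel)" unfolding w_def by measurable
  then have w': "w \<in> borel_measurable plane_bundle" unfolding measurable_bundle .
  have w_inv: "AE x in N. AE z in lborel. w (T g x, rigid g x z) = w (x, z)" for g
    using AE_pair[OF inv[of g]]
    by (auto elim!: eventually_mono simp: skew_def w_def)
  define m where "m x = (\<integral>\<^sup>+z. w (x, z) \<partial>lborel)" for x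
  have m_meas[measurable]: "m \<in> borel_measurable N"
    unfolding m_def by (rule lborel.borel_measurable_nn_integral_fst[OF w'])
  have "(\<integral>\<^sup>+x. m x \<partial>N) = (\<integral>\<^sup>+p. w p \<partial>plane_bundle)"
    unfolding m_def by (rule lborel.nn_integral_fst[OF w'])
  also have "\<dots> = ennreal (sqnorm plane_bundle \<eta>)"
    unfolding w_def by (rule sqnorm_nn_integral[OF \<eta>(1)])
  finally have m_int: "(\<integral>\<^sup>+x. m x \<partial>N) = ennreal (sqnorm plane_bundle \<eta>)" .
  then have fin: "AE x in N. m x \<noteq> \<infinity>" by (intro nn_integral_PInf_AE) auto
  have "AE x in N. enn2real (m (T g x)) = enn2real (m x)" for g
    using w_inv[of g] AE_space
  proof eventually_elim
    case (elim x)
    have "m (T g x) = (\<integral>\<^sup>+z. w (T g x, rigid g x z) \<partial>lborel)"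
      unfolding m_def
    proof (rule nn_integral_rigid[OF elim(2), symmetric])
      show "(\<lambda>z. w (T g x, z)) \<in> borel_measurable borel"
        using measurable_compose[OF measurable_Pair1'[OF measurable_space[OF T_measurable elim(2)]] w] by simp
    qed
    also have "\<dots> = m x" unfolding m_def by (rule nn_integral_cong_AE) (rule elim)
    finally show ?case by simp
  qed
  then obtain \<kappa> where "AE x in N. enn2real (m x) = \<kappa>"
    using invariant_real_AE_const[of "\<lambda>x. enn2real (m x)"] by auto
  with fin have \<kappa>: "AE x in N. m x = ennreal \<kappa>"
    by eventually_elim (metis ennreal_enn2real infinity_ennreal_def top.not_eq_extremum)
  have "0 < \<kappa>"
  proof (rule ccontr)
    assume "\<not> 0 < \<kappa>"
    then have "AE x in N. m x = 0" using \<kappa> by (auto elim!: eventually_mono simp: ennreal_neg)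
    then have "(\<integral>\<^sup>+x. m x \<partial>N) = 0" by (simp add: nn_integral_0_iff_AE)
    with m_int \<eta>(2) sqnorm_nonneg[of plane_bundle \<eta>] show False by simp
  qed
  with equivariant_section[OF w w_inv _ \<kappa>[unfolded m_def] pos] show ?thesis by auto
qed

end

section \<open>Radial powers\<close>

text \<open>The Mazur map is a pointwise operation: \<open>mazur p q f\<close> is \<open>rpow (p / q) \<circ> f\<close>.\<close>

definition rpow :: "real \<Rightarrow> complex \<Rightarrow> complex" where
  "rpow s z = sgn z * of_real (norm z powr s)"

lemma rpow_0 [simp]: "rpow s 0 = 0"
  by (simp add: rpow_def)

lemma norm_rpow: "norm (rpow s z) = norm z powr s"
  by (cases "z = 0") (simp_all add: rpow_def norm_mult norm_sgn)

lemma norm_rpow_powr: "norm (rpow s z) powr t = norm z powr (s * t)"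
  by (simp add: norm_rpow powr_powr)

lemma norm_rpow_half_sq: "(norm (rpow (q / 2) z))\<^sup>2 = norm z powr q"
  by (simp add: norm_rpow power2_eq_square flip: powr_add)

lemma rpow_mult_unit: "norm u = 1 \<Longrightarrow> rpow s (u * z) = u * rpow s z"
  by (simp add: rpow_def sgn_mult norm_mult) (simp add: sgn_div_norm)

lemma rpow_scaleR: "0 \<le> t \<Longrightarrow> rpow s (t *\<^sub>R z) = (t powr s) *\<^sub>R rpow s z"
  by (cases "t = 0") (simp_all add: rpow_def sgn_scaleR powr_mult, simp add: scaleR_conv_of_real)

lemma rpow_rpow:
  assumes "0 < t"
  shows "rpow s (rpow t z) = rpow (t * s) z"
proof (cases "z = 0")
  case False
  have "sgn (rpow t z) = sgn z"
    using False by (simp add: rpow_def sgn_mult sgn_of_real sgn_sgn)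
  then show ?thesis by (simp add: rpow_def[of s] norm_rpow powr_powr) (simp add: rpow_def)
qed simp

lemma rpow_1 [simp]: "rpow 1 z = z"
  by (cases "z = 0") (simp_all add: rpow_def sgn_div_norm scaleR_conv_of_real)

lemma powr_diff_le:
  fixes r t s :: real
  assumes "0 \<le> t" "t \<le> r" "0 < s" "s \<le> 1"
  shows "r powr s - t powr s \<le> (r - t) powr s"
proof (cases "r = 0")
  case False
  then have r: "0 < r" using assms by auto
  have frac: "a \<le> a powr s" if "0 \<le> a" "a \<le> 1" for a :: real
  proof (cases "a = 0")
    case False
    then have "a powr 1 \<le> a powr s" using that assms by (intro powr_mono') auto
    then show ?thesis using that by simp
  qed simp
  have "1 = (r - t) / r + t / r" using r by (simp add: field_simps)
  also have "\<dots> \<le> ((r - t) / r) powr s + (t / r) powr s"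
    using assms r by (intro add_mono frac) auto
  also have "\<dots> = ((r - t) powr s + t powr s) / r powr s"
    using assms r by (simp add: powr_divide add_divide_distrib)
  finally show ?thesis using r by (simp add: field_simps)
qed (use assms in auto)

text \<open>
  The difference splits into a radial part, controlled by subadditivity of \<open>t \<mapsto> t\<^sup>s\<close>, and an angular
  part. The latter is \<open>t\<^sup>s * e\<close> with \<open>e \<le> 2\<close> and \<open>t * e \<le> 2 * norm (z - w)\<close>, where \<open>t\<close> is the smaller
  modulus.
\<close>

lemma rpow_holder:
  assumes s: "0 < s" "s \<le> 1"
  shows "norm (rpow s z - rpow s w) \<le> 3 * norm (z - w) powr s"
proof -
  have main: "norm (rpow s z - rpow s w) \<le> 3 * norm (z - w) powr s" if le: "norm w \<le> norm z" for z w
  proof (cases "w = 0")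
    case True
    then show ?thesis by (simp add: norm_rpow)
  next
    case False
    define r t d where "r = norm z" and "t = norm w" and "d = norm (z - w)"
    have rt: "0 < t" "t \<le> r" "z \<noteq> 0" using False le by (auto simp: r_def t_def)
    have d: "r - t \<le> d" unfolding r_def t_def d_def by (rule norm_triangle_ineq2)
    define e where "e = norm (sgn z - sgn w)"
    have "norm (sgn z - sgn w) \<le> norm (sgn z) + norm (sgn w)" by (rule norm_triangle_ineq4)
    then have e: "0 \<le> e" "e \<le> 2" using rt False by (auto simp: e_def norm_sgn)
    have te: "t * e \<le> 2 * d"
    proof -
      have "of_real t * (sgn z - sgn w) = (z - w) - of_real (r - t) * sgn z"
        using rt False by (simp add: t_def r_def sgn_div_norm scaleR_conv_of_real field_simps)
      then have "norm (of_real t * (sgn z - sgn w)) = norm ((z - w) - of_real (r - t) * sgn z)"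
        by simp
      then have "t * e = norm ((z - w) - of_real (r - t) * sgn z)"
        using rt by (simp add: e_def norm_mult del: of_real_diff)
      also have "\<dots> \<le> norm (z - w) + norm (of_real (r - t) * sgn z)" by (rule norm_triangle_ineq4)
      also have "norm (of_real (r - t) * sgn z) = r - t"
        using rt by (simp add: norm_mult norm_sgn del: of_real_diff)
      finally show ?thesis using d by (simp add: d_def)
    qed
    have "rpow s z - rpow s w = of_real (r powr s - t powr s) * sgn z + of_real (t powr s) * (sgn z - sgn w)"
      by (simp add: rpow_def r_def t_def algebra_simps)
    then have "norm (rpow s z - rpow s w) \<le> norm (of_real (r powr s - t powr s) * sgn z) + norm (of_real (t powr s) * (sgn z - sgn w))"
      by (simp only: norm_triangle_ineq)
    also have "\<dots> = (r powr s - t powr s) + t powr s * e"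
      using rt s by (simp add: norm_mult norm_sgn e_def powr_mono2 del: of_real_diff)
    also have "r powr s - t powr s \<le> d powr s"
      using powr_diff_le[of t r s] powr_mono2[of s "r - t" d] rt d s by linarith
    also have "t powr s * e \<le> 2 * d powr s"
    proof -
      have "t powr s * e = (t * e) powr s * e powr (1 - s)"
        using rt e by (cases "e = 0") (simp_all add: powr_mult flip: powr_add)
      also have "\<dots> \<le> (2 * d) powr s * 2 powr (1 - s)"
      proof (rule mult_mono)
        show "(t * e) powr s \<le> (2 * d) powr s" using te e rt s by (intro powr_mono2) auto
        show "e powr (1 - s) \<le> 2 powr (1 - s)" using e s by (intro powr_mono2) auto
      qed auto
      also have "\<dots> = 2 * d powr s"
        by (simp add: powr_mult d_def powr_diff)
      finally show ?thesis .
    qed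
    finally show ?thesis by (simp add: d_def)
  qed
  show ?thesis
  proof (cases "norm w \<le> norm z")
    case False
    then show ?thesis using main[of z w] by (simp add: norm_minus_commute)
  qed (rule main)
qed

lemma continuous_on_rpow:
  assumes s: "0 < s"
  shows "continuous_on A (rpow s)"
proof (cases "s \<le> 1")
  case True
  have "(rpow s \<longlongrightarrow> rpow s z) (at z within A)" for z
  proof -
    have "((\<lambda>w. 3 * norm (w - z) powr s) \<longlongrightarrow> 3 * norm (z - z) powr s) (at z within A)"
      using s by (intro tendsto_intros tendsto_powr') auto
    then have "((\<lambda>w. 3 * norm (w - z) powr s) \<longlongrightarrow> 0) (at z within A)" using s by simp
    then have "((\<lambda>w. rpow s w - rpow s z) \<longlongrightarrow> 0) (at z within A)"
      by (rule Lim_null_comparison[OF always_eventually[OF allI], rotated]) (rule rpow_holder[OF s True])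
    then show ?thesis by (rule LIM_zero_cancel)
  qed
  then show ?thesis by (simp add: continuous_on_def)
next
  case False
  have eq: "rpow s = (\<lambda>z. z * of_real (norm z powr (s - 1)))"
  proof
    fix z show "rpow s z = z * of_real (norm z powr (s - 1))"
      by (cases "z = 0") (simp_all add: rpow_def sgn_div_norm scaleR_conv_of_real powr_diff field_simps)
  qed
  show ?thesis unfolding eq using False
    by (intro continuous_intros continuous_on_powr') auto
qed

lemma rpow_measurable [measurable (raw)]:
  "0 < s \<Longrightarrow> f \<in> borel_measurable N \<Longrightarrow> (\<lambda>x. rpow s (f x)) \<in> borel_measurable N"
  by (rule measurable_compose[OF _ borel_measurable_continuous_onI[OF continuous_on_rpow]])

text \<open>
  For every exponent, the Mazur map towards \<open>L\<^sub>2\<close> satisfies a Hoelder estimate up to an arbitrarily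
  small multiple of the total mass. Both sides are homogeneous of degree \<open>q\<close>, so it is enough to
  use uniform continuity on the unit ball.
\<close>

lemma rpow_almost_holder:
  fixes q \<delta> :: real
  assumes q: "0 < q" and \<delta>: "0 < \<delta>"
  shows "\<exists>C\<ge>0. \<forall>z w. (norm (rpow (q / 2) z - rpow (q / 2) w))\<^sup>2
      \<le> \<delta> * (norm z powr q + norm w powr q) + C * norm (z - w) powr q"
proof -
  have "uniformly_continuous_on (cball 0 1) (rpow (q / 2))"
    using q by (intro compact_uniformly_continuous continuous_on_rpow) auto
  then obtain \<eta> where \<eta>: "0 < \<eta>" and unif: "\<And>z w. norm z \<le> 1 \<Longrightarrow> norm w \<le> 1 \<Longrightarrow> norm (z - w) < \<eta> \<Longrightarrow>
      norm (rpow (q / 2) z - rpow (q / 2) w) < sqrt \<delta>"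
    using \<delta> unfolding uniformly_continuous_on_def
    by (metis (no_types, lifting) dist_norm mem_cball_0 real_sqrt_gt_zero)
  define C where "C = 4 / \<eta> powr q"
  have C: "0 \<le> C" by (simp add: C_def)
  have unit: "(norm (rpow (q / 2) z - rpow (q / 2) w))\<^sup>2
      \<le> \<delta> * (norm z powr q + norm w powr q) + C * norm (z - w) powr q"
    if zw: "norm z \<le> 1" "norm w \<le> 1" "norm z = 1 \<or> norm w = 1" for z w
  proof (cases "norm (z - w) < \<eta>")
    case True
    then have "(norm (rpow (q / 2) z - rpow (q / 2) w))\<^sup>2 \<le> (sqrt \<delta>)\<^sup>2"
      using unif[OF zw(1,2)] by (intro power_mono) auto
    also have "\<dots> \<le> \<delta> * (norm z powr q + norm w powr q)"
      using zw(3) \<delta> by (auto simp: distrib_left)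
    also have "\<dots> \<le> \<delta> * (norm z powr q + norm w powr q) + C * norm (z - w) powr q"
      using C by simp
    finally show ?thesis .
  next
    case False
    have "norm (rpow (q / 2) z - rpow (q / 2) w) \<le> norm (rpow (q / 2) z) + norm (rpow (q / 2) w)"
      by (rule norm_triangle_ineq4)
    also have "\<dots> \<le> 1 + 1"
      unfolding norm_rpow using zw q by (intro add_mono powr_le1) auto
    finally have "(norm (rpow (q / 2) z - rpow (q / 2) w))\<^sup>2 \<le> 2\<^sup>2"
      by (intro power_mono) auto
    also have "\<dots> = C * \<eta> powr q" using \<eta> by (simp add: C_def)
    also have "\<dots> \<le> C * norm (z - w) powr q"
      using False C \<eta> q by (intro mult_left_mono powr_mono2) auto
    also have "\<dots> \<le> \<delta> * (norm z powr q + norm w powr q) + C * norm (z - w) powr q"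
      using \<delta> by (simp add: add_nonneg_nonneg)
    finally show ?thesis .
  qed
  have "(norm (rpow (q / 2) z - rpow (q / 2) w))\<^sup>2
      \<le> \<delta> * (norm z powr q + norm w powr q) + C * norm (z - w) powr q" for z w
  proof (cases "z = 0 \<and> w = 0")
    case False
    define t where "t = max (norm z) (norm w)"
    have t: "0 < t" using False by (auto simp: t_def less_max_iff_disj)
    define z' w' where "z' = z /\<^sub>R t" and "w' = w /\<^sub>R t"
    have zw: "z = t *\<^sub>R z'" "w = t *\<^sub>R w'" using t by (auto simp: z'_def w'_def)
    have max1: "norm z' = 1 \<or> norm w' = 1"
      using t by (cases "norm w \<le> norm z") (auto simp: z'_def w'_def t_def max_def)
    have n: "norm z' \<le> 1" "norm w' \<le> 1"
      using t by (auto simp: z'_def w'_def field_simps) (auto simp: t_def)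
    have tq: "(t powr (q / 2))\<^sup>2 = t powr q" by (simp add: power2_eq_square flip: powr_add)
    have "(norm (rpow (q / 2) z - rpow (q / 2) w))\<^sup>2 = t powr q * (norm (rpow (q / 2) z' - rpow (q / 2) w'))\<^sup>2"
      unfolding zw using t by (simp add: rpow_scaleR power_mult_distrib tq flip: scaleR_diff_right)
    also have "\<dots> \<le> t powr q * (\<delta> * (norm z' powr q + norm w' powr q) + C * norm (z' - w') powr q)"
      using unit[OF n max1] by (intro mult_left_mono) auto
    also have "\<dots> = \<delta> * (norm z powr q + norm w powr q) + C * norm (z - w) powr q"
      unfolding zw using t
      by (simp add: powr_mult algebra_simps flip: scaleR_diff_right)
    finally show ?thesis .
  qed simp
  with C show ?thesis by blast
qed

text \<open>Bounded Lipschitz maps that commute with rotations and approximate the identity as \<open>e\<close> tends to \<open>0\<close>.\<close>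

definition damp :: "real \<Rightarrow> complex \<Rightarrow> complex" where
  "damp e z = z /\<^sub>R (1 + e * norm z)"

lemma damp_pos: "0 \<le> e \<Longrightarrow> 0 < 1 + e * norm z"
  by (simp add: add_pos_nonneg)

lemma damp_mult_unit: "norm u = 1 \<Longrightarrow> damp e (u * z) = u * damp e z"
  by (simp add: damp_def norm_mult scaleR_conv_of_real)

lemma norm_damp_le: "0 \<le> e \<Longrightarrow> norm (damp e z) \<le> norm z"
  using damp_pos[of e z] by (simp add: damp_def field_simps)

lemma norm_damp_bound:
  assumes "0 < e"
  shows "norm (damp e z) \<le> 1 / e"
  using assms damp_pos[of e z] by (simp add: damp_def field_simps)

lemma damp_lipschitz:
  assumes e: "0 \<le> e"
  shows "norm (damp e z - damp e w) \<le> 2 * norm (z - w)"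
proof -
  define a b where "a = 1 + e * norm z" and "b = 1 + e * norm w"
  have ab: "0 < a" "0 < b" "1 \<le> a" "e * norm w \<le> b" using e by (auto simp: a_def b_def damp_pos)
  have "damp e z - damp e w = (z - w) /\<^sub>R a - ((a - b) / (a * b)) *\<^sub>R w"
  proof -
    have "(a - b) / (a * b) = inverse b - inverse a" using ab by (simp add: field_simps)
    moreover have "damp e z - damp e w = (z - w) /\<^sub>R a - (inverse b - inverse a) *\<^sub>R w"
      by (simp add: damp_def a_def b_def scaleR_diff_left scaleR_diff_right)
    ultimately show ?thesis by simp
  qed
  then have "norm (damp e z - damp e w) \<le> norm ((z - w) /\<^sub>R a) + norm (((a - b) / (a * b)) *\<^sub>R w)"
    by (simp only: norm_triangle_ineq4)
  also have "norm ((z - w) /\<^sub>R a) \<le> norm (z - w)"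
  proof -
    have "inverse a \<le> 1" using ab by (simp add: inverse_le_1_iff)
    then have "inverse a * norm (z - w) \<le> 1 * norm (z - w)" by (intro mult_right_mono) auto
    then show ?thesis unfolding norm_scaleR using ab by simp
  qed
  also have "norm (((a - b) / (a * b)) *\<^sub>R w) \<le> norm (z - w)"
  proof -
    have "\<bar>a - b\<bar> = e * \<bar>norm z - norm w\<bar>" using e by (simp add: a_def b_def abs_mult flip: right_diff_distrib)
    also have "\<dots> \<le> e * norm (z - w)" using e by (intro mult_left_mono norm_triangle_ineq3)
    finally have "\<bar>a - b\<bar> * norm w \<le> e * norm (z - w) * norm w" by (intro mult_right_mono) auto
    also have "\<dots> = norm (z - w) * (e * norm w)" by simp
    also have "\<dots> \<le> norm (z - w) * (a * b)"
    proof (rule mult_left_mono)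
      have "1 * b \<le> a * b" using ab by (intro mult_right_mono) auto
      then show "e * norm w \<le> a * b" using ab by linarith
    qed simp
    finally show ?thesis using ab by (simp add: abs_mult field_simps)
  qed
  finally show ?thesis by simp
qed

lemma damp_tendsto: "(\<lambda>n. damp (1 / real (Suc n)) z) \<longlonglongrightarrow> z"
proof -
  have "(\<lambda>n. 1 / real (Suc n)) \<longlonglongrightarrow> 0" by (rule LIMSEQ_Suc[OF lim_1_over_n])
  then have "(\<lambda>n. damp (1 / real (Suc n)) z) \<longlonglongrightarrow> z /\<^sub>R (1 + 0 * norm z)"
    unfolding damp_def by (intro tendsto_intros) auto
  then show ?thesis by simp
qed

lemma damp_measurable [measurable (raw)]:
  assumes "0 \<le> e" "f \<in> borel_measurable N"
  shows "(\<lambda>x. damp e (f x)) \<in> borel_measurable N"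
proof (rule measurable_compose[OF assms(2) borel_measurable_continuous_onI])
  show "continuous_on UNIV (damp e)"
  proof -
    have "1 + e * norm z \<noteq> 0" for z :: complex
      using damp_pos[OF assms(1), of z] by linarith
    then show ?thesis unfolding damp_def by (intro continuous_intros) auto
  qed
qed

section \<open>Integrability of primitives\<close>

context twisted_action
begin

lemma koop_rpow: "x \<in> space N \<Longrightarrow> koop g (\<lambda>x. rpow s (f x)) x = rpow s (koop g f x)"
  by (simp add: koop_def rpow_mult_unit \<theta>_norm)

lemma koop_damp: "x \<in> space N \<Longrightarrow> koop g (\<lambda>x. damp e (f x)) x = damp e (koop g f x)"
  by (simp add: koop_def damp_mult_unit \<theta>_norm)

end

context ergodic_twisted_action
begin

text \<open>
  Let \<open>F\<close> be the image in \<open>L\<^sub>2\<close> of a bounded approximation of \<open>f\<close> under the Mazur map. The displacement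
  of \<open>F\<close> is bounded by a small multiple of \<open>\<parallel>F\<parallel>\<^sup>2\<close> plus a constant. By the spectral gap \<open>F\<close> is as close
  to a vector \<open>c\<close> of constant modulus, and that modulus is controlled because \<open>f\<close> is bounded on a set
  of positive measure. So \<open>\<parallel>F\<parallel>\<^sup>2\<close> is at most \<open>\<parallel>F\<parallel>\<^sup>2 / 2\<close> plus a constant that does not depend on
  the approximation.
\<close>

lemma primitive_in_Lp:
  fixes Q :: "'g set"
  assumes Q: "kazhdan_pair Q \<epsilon>" and q: "0 < q" and pos: "measure N (space N) \<noteq> 0"
    and f[measurable]: "f \<in> borel_measurable N"
    and disp: "\<And>g k. (\<lambda>x. koop g f x - koop k f x) \<in> Lp q N"
    and cont: "\<And>g\<^sub>0. ((\<lambda>g. LINT x|N. norm (koop g f x - koop g\<^sub>0 f x) powr q) \<longlongrightarrow> 0) (at g\<^sub>0)"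
    and bound: "\<And>g. g \<in> Q \<Longrightarrow> (LINT x|N. norm (koop g f x - koop 0 f x) powr q) \<le> B"
  shows "f \<in> Lp q N"
proof -
  have \<epsilon>: "0 < \<epsilon>" by (rule kazhdan_pair_pos[OF Q])
  define m where "m = measure N (space N)"
  have m: "0 < m" using pos by (simp add: m_def zero_less_measure_iff)
  obtain K where K: "0 \<le> K" "measure N {x \<in> space N. norm (f x) \<le> K} \<noteq> 0"
  proof -
    have "\<exists>n. measure N {x \<in> space N. norm (f x) \<le> real n} \<noteq> 0"
    proof (rule ccontr)
      assume "\<not> ?thesis"
      then have "AE x in N. \<not> norm (f x) \<le> real n" for n
        by (subst AE_iff_null) (auto simp: null_sets_def emeasure_eq_measure)
      then have "AE x in N. \<forall>n. \<not> norm (f x) \<le> real n" by (simp add: AE_all_countable)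
      then have "AE x in N. False" by eventually_elim (meson real_arch_simple)
      then have "emeasure N (space N) = 0" by (subst (asm) AE_iff_null) (auto simp: null_sets_def)
      with pos show False by (simp add: measure_def)
    qed
    then show thesis using that by (meson of_nat_0_le_iff)
  qed
  define E where "E = {x \<in> space N. norm (f x) \<le> K}"
  define a where "a = measure N E"
  have E[measurable]: "E \<in> sets N" by (simp add: E_def)
  have a: "0 < a" using K by (simp add: a_def E_def zero_less_measure_iff)
  define B' where "B' = max B 0"
  \<comment> \<open>A displacement bound \<open>X\<close> will contribute \<open>L * X\<close> to the bound on \<open>sqnorm N (F n)\<close>; as \<open>X\<close> contains
    \<open>2 * \<delta> * sqnorm N (F n)\<close>, the choice of \<open>\<delta>\<close> lets half of \<open>sqnorm N (F n)\<close> be absorbed.\<close>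
  define L where "L = (4 * m / a + 2) / \<epsilon>\<^sup>2"
  have L: "0 < L" unfolding L_def using m a \<epsilon> by (intro divide_pos_pos add_nonneg_pos) auto
  define \<delta> where "\<delta> = 1 / (4 * L)"
  have \<delta>: "0 < \<delta>" "L * (2 * \<delta>) = 1 / 2" using L by (auto simp: \<delta>_def)
  obtain C where C: "0 \<le> C" "\<And>z w. (norm (rpow (q / 2) z - rpow (q / 2) w))\<^sup>2
      \<le> \<delta> * (norm z powr q + norm w powr q) + C * norm (z - w) powr q"
    using rpow_almost_holder[OF q \<delta>(1)] by blast
  define A where "A = 8 * K powr q * m + 2 * (L * (C * (2 powr q * B')))"
  define F where "F n x = rpow (q / 2) (damp (1 / real (Suc n)) (f x))" for n x
  have Fm[measurable]: "F n \<in> borel_measurable N" for n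
    unfolding F_def using q by (intro rpow_measurable damp_measurable f) auto
  have FL: "F n \<in> L2 N" for n
  proof -
    have "integrable N (\<lambda>x. (norm (F n x))\<^sup>2)"
    proof (rule Bochner_Integration.integrable_bound[OF integrable_const])
      show "AE x in N. norm ((norm (F n x))\<^sup>2) \<le> norm (real (Suc n) powr q)"
        unfolding F_def norm_rpow_half_sq
      proof (rule AE_I2)
        fix x
        have "norm (damp (1 / real (Suc n)) (f x)) powr q \<le> (real (Suc n)) powr q"
          using norm_damp_bound[of "1 / real (Suc n)" "f x"] q by (intro powr_mono2) auto
        then show "norm (norm (damp (1 / real (Suc n)) (f x)) powr q) \<le> norm (real (Suc n) powr q)" by simp
      qed
    qed simp
    then show ?thesis by (simp add: L2_def)
  qed
  have step: "sqnorm N (koop g (F n) - koop k (F n))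
      \<le> d * (2 * sqnorm N (F n)) + D * (2 powr q * (LINT x|N. norm (koop g f x - koop k f x) powr q))"
    if D: "0 \<le> D" "\<And>z w. (norm (rpow (q / 2) z - rpow (q / 2) w))\<^sup>2
      \<le> d * (norm z powr q + norm w powr q) + D * norm (z - w) powr q" for n g k d D
  proof -
    have sq: "(norm (F n y))\<^sup>2 = norm (damp (1 / real (Suc n)) (f y)) powr q" for y
      by (simp add: F_def norm_rpow_half_sq)
    have "sqnorm N (koop g (F n) - koop k (F n))
        \<le> (LINT x|N. d * ((norm (koop g (F n) x))\<^sup>2 + (norm (koop k (F n) x))\<^sup>2)
            + D * (2 powr q * norm (koop g f x - koop k f x) powr q))"
      unfolding sqnorm_def
    proof (rule integral_mono)
      fix x assume x: "x \<in> space N"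
      let ?z = "damp (1 / real (Suc n)) (koop g f x)" and ?w = "damp (1 / real (Suc n)) (koop k f x)"
      have eq: "koop g' (F n) x = rpow (q / 2) (damp (1 / real (Suc n)) (koop g' f x))" for g'
        unfolding F_def using x by (simp add: koop_rpow koop_damp)
      have "(norm ((koop g (F n) - koop k (F n)) x))\<^sup>2
          \<le> d * (norm ?z powr q + norm ?w powr q) + D * norm (?z - ?w) powr q"
        unfolding fun_diff_def eq by (rule D(2))
      also have "norm (?z - ?w) powr q \<le> (2 * norm (koop g f x - koop k f x)) powr q"
        using q by (intro powr_mono2 damp_lipschitz) auto
      finally show "(norm ((koop g (F n) - koop k (F n)) x))\<^sup>2
          \<le> d * ((norm (koop g (F n) x))\<^sup>2 + (norm (koop k (F n) x))\<^sup>2)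
            + D * (2 powr q * norm (koop g f x - koop k f x) powr q)"
        using D(1) unfolding eq norm_rpow_half_sq by (simp add: powr_mult mult_left_mono)
    next
      show "integrable N (\<lambda>x. (norm ((koop g (F n) - koop k (F n)) x))\<^sup>2)"
        by (intro L2_integrable L2_diff koop_L2 FL)
      show "integrable N (\<lambda>x. d * ((norm (koop g (F n) x))\<^sup>2 + (norm (koop k (F n) x))\<^sup>2)
          + D * (2 powr q * norm (koop g f x - koop k f x) powr q))"
        by (intro integrable_mult_right Bochner_Integration.integrable_add L2_integrable koop_L2 FL
            Lp_integrable disp)
    qed
    also have "\<dots> = d * (sqnorm N (koop g (F n)) + sqnorm N (koop k (F n)))
        + D * (2 powr q * (LINT x|N. norm (koop g f x - koop k f x) powr q))"
      using L2_integrable[OF koop_L2[OF FL]] Lp_integrable[OF disp] by (simp add: sqnorm_def)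
    finally show ?thesis using FL by (simp add: sqnorm_koop)
  qed
  have main: "sqnorm N (F n) \<le> A" for n
  proof -
    define X where "X = \<delta> * (2 * sqnorm N (F n)) + C * (2 powr q * B')"
    have X: "0 \<le> X" using \<delta> C(1) by (simp add: X_def B'_def)
    have F0: "AE x in N. koop 0 (F n) x = F n x" by (rule koop_0)
    have "\<exists>c\<in>L2 N. (\<exists>\<kappa>. AE x in N. norm (c x) = \<kappa>) \<and> sqnorm N (F n - c) \<le> X / \<epsilon>\<^sup>2"
    proof (rule spectral_gap[OF Q FL _ X])
      fix g assume g: "g \<in> Q"
      have "sqnorm N (koop g (F n) - F n) = sqnorm N (koop g (F n) - koop 0 (F n))"
      proof (rule sqnorm_cong_AE)
        show "AE x in N. (koop g (F n) - F n) x = (koop g (F n) - koop 0 (F n)) x"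
          using F0 by eventually_elim simp
      qed (intro L2_diff koop_L2 FL)+
      also have "\<dots> \<le> \<delta> * (2 * sqnorm N (F n)) + C * (2 powr q * (LINT x|N. norm (koop g f x - koop 0 f x) powr q))"
        by (rule step[OF C])
      also have "\<dots> \<le> X"
        unfolding X_def using C(1) bound[OF g] by (intro add_left_mono mult_left_mono) (auto simp: B'_def)
      finally show "sqnorm N (koop g (F n) - F n) \<le> X" .
    next
      fix g\<^sub>0
      show "((\<lambda>g. sqnorm N (koop g (F n) - koop g\<^sub>0 (F n))) \<longlongrightarrow> 0) (at g\<^sub>0)"
      proof (rule tendstoI)
        fix e :: real assume e: "0 < e"
        define d where "d = e / (4 * (sqnorm N (F n) + 1))"
        have d: "0 < d" using e by (simp add: d_def add_nonneg_pos)
        have d2: "d * (2 * sqnorm N (F n)) \<le> e / 2"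
          unfolding d_def using e add_nonneg_pos[OF sqnorm_nonneg[of N "F n"] zero_less_one]
          by (simp add: field_simps)
        obtain D where D: "0 \<le> D" "\<And>z w. (norm (rpow (q / 2) z - rpow (q / 2) w))\<^sup>2
            \<le> d * (norm z powr q + norm w powr q) + D * norm (z - w) powr q"
          using rpow_almost_holder[OF q d] by blast
        have "((\<lambda>g. D * (2 powr q * (LINT x|N. norm (koop g f x - koop g\<^sub>0 f x) powr q))) \<longlongrightarrow> D * (2 powr q * 0)) (at g\<^sub>0)"
          by (intro tendsto_intros cont)
        then have "eventually (\<lambda>g. D * (2 powr q * (LINT x|N. norm (koop g f x - koop g\<^sub>0 f x) powr q)) < e / 2) (at g\<^sub>0)"
          using e by (intro order_tendstoD(2)) auto
        then show "eventually (\<lambda>g. dist (sqnorm N (koop g (F n) - koop g\<^sub>0 (F n))) 0 < e) (at g\<^sub>0)"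
        proof eventually_elim
          case (elim g)
          with step[OF D, of g n g\<^sub>0] d2 show ?case by simp
        qed
      qed
    qed
    then obtain c \<kappa> where c: "c \<in> L2 N" "AE x in N. norm (c x) = \<kappa>" "sqnorm N (F n - c) \<le> X / \<epsilon>\<^sup>2"
      by auto
    have Fc: "F n - c \<in> L2 N" by (intro L2_diff FL c)
    have [measurable]: "c \<in> borel_measurable N" using c by (simp add: L2_def)
    have \<kappa>bound: "\<kappa>\<^sup>2 * a \<le> 2 * K powr q * a + 2 * (X / \<epsilon>\<^sup>2)"
    proof -
      have "\<kappa>\<^sup>2 * a = (LINT x|N. \<kappa>\<^sup>2 * indicator E x)" by (simp add: a_def)
      also have "\<dots> \<le> (LINT x|N. 2 * K powr q * indicator E x + 2 * (norm ((F n - c) x))\<^sup>2)"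
      proof (rule integral_mono_AE)
        show "AE x in N. \<kappa>\<^sup>2 * indicator E x \<le> 2 * K powr q * indicator E x + 2 * (norm ((F n - c) x))\<^sup>2"
          using c(2)
        proof eventually_elim
          case (elim x)
          show ?case
          proof (cases "x \<in> E")
            case True
            have "\<kappa>\<^sup>2 = (norm (F n x + - (F n - c) x))\<^sup>2" using elim by simp
            also have "\<dots> \<le> 2 * (norm (F n x))\<^sup>2 + 2 * (norm (- (F n - c) x))\<^sup>2" by (rule norm_add_sq_le)
            also have "(norm (F n x))\<^sup>2 \<le> K powr q"
              unfolding F_def norm_rpow_half_sq
              using True q norm_damp_le[of "1 / real (Suc n)" "f x"] by (intro powr_mono2) (auto simp: E_def)
            finally show ?thesis using True by (simp add: norm_minus_commute)
          qed simp
        qed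
      qed (use L2_integrable[OF Fc] in \<open>auto simp: emeasure_eq_measure intro!: integrable_mult_right integrable_real_indicator\<close>)
      also have "\<dots> = 2 * K powr q * a + 2 * sqnorm N (F n - c)"
        using L2_integrable[OF Fc] by (simp add: a_def sqnorm_def emeasure_eq_measure)
      finally show ?thesis using c(3) by linarith
    qed
    have "sqnorm N c = (LINT x|N. \<kappa>\<^sup>2)"
      unfolding sqnorm_def using c(2) by (intro integral_cong_AE) (auto elim!: eventually_mono)
    then have cm: "sqnorm N c = \<kappa>\<^sup>2 * m" by (simp add: m_def)
    have "\<kappa>\<^sup>2 \<le> 2 * K powr q + 2 * (X / \<epsilon>\<^sup>2) / a"
    proof -
      have "\<kappa>\<^sup>2 \<le> (2 * K powr q * a + 2 * (X / \<epsilon>\<^sup>2)) / a"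
        using \<kappa>bound a by (simp add: pos_le_divide_eq)
      then show ?thesis using a by (simp add: add_divide_distrib)
    qed
    then have "sqnorm N c \<le> (2 * K powr q + 2 * (X / \<epsilon>\<^sup>2) / a) * m"
      unfolding cm using m by (intro mult_right_mono) auto
    moreover have "sqnorm N (F n) \<le> 2 * sqnorm N c + 2 * sqnorm N (F n - c)"
      using sqnorm_add_le[OF c(1) Fc] by simp
    ultimately have "sqnorm N (F n) \<le> 2 * ((2 * K powr q + 2 * (X / \<epsilon>\<^sup>2) / a) * m) + 2 * (X / \<epsilon>\<^sup>2)"
      using c(3) by linarith
    also have "\<dots> = 4 * K powr q * m + L * X"
      unfolding L_def using a \<epsilon> by (simp add: field_simps)
    also have "\<dots> = 4 * K powr q * m + (L * (2 * \<delta>)) * sqnorm N (F n) + L * (C * (2 powr q * B'))"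
      unfolding X_def by (simp add: algebra_simps)
    finally show ?thesis unfolding \<delta>(2) A_def by linarith
  qed
  have "(\<lambda>x. rpow (q / 2) (f x)) \<in> L2 N"
  proof (rule L2_fatou(1)[OF FL])
    show "(\<lambda>x. rpow (q / 2) (f x)) \<in> borel_measurable N" using q by (intro rpow_measurable) auto
    show "AE x in N. (\<lambda>n. F n x) \<longlonglongrightarrow> rpow (q / 2) (f x)"
    proof (rule AE_I2)
      fix x
      have "isCont (rpow (q / 2)) (f x)"
        using continuous_on_rpow[of "q / 2" UNIV] q by (simp add: continuous_on_eq_continuous_at)
      then show "(\<lambda>n. F n x) \<longlonglongrightarrow> rpow (q / 2) (f x)"
        unfolding F_def by (rule isCont_tendsto_compose[OF _ damp_tendsto])
    qed
    show "eventually (\<lambda>n. sqnorm N (F n) \<le> A) sequentially" using main by simp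
  qed
  then show ?thesis by (simp add: L2_def Lp_def norm_rpow_half_sq)
qed

section \<open>Cocycles for different exponents\<close>

lemma cocycles_mono:
  assumes q: "0 < q" "q \<le> q'" and b: "b \<in> cocycles q' N koop"
  shows "b \<in> cocycles q N koop"
proof -
  have bL: "b g \<in> Lp q' N" for g using b by (simp add: cocycles_def)
  have "Lp_continuous q' N b" using b by (simp add: cocycles_def)
  then have "((\<lambda>g. LINT x|N. norm (b g x - b g\<^sub>0 x) powr q') \<longlongrightarrow> 0) (at g\<^sub>0)" for g\<^sub>0
    using q by (simp add: Lp_continuous_iff)
  then have "((\<lambda>g. LINT x|N. norm (b g x - b g\<^sub>0 x) powr q) \<longlongrightarrow> 0) (at g\<^sub>0)" for g\<^sub>0
    using q bL by (intro integral_powr_tendsto_0_mono[OF q, of "\<lambda>g x. b g x - b g\<^sub>0 x"] Lp_diff) auto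
  then have "Lp_continuous q N b" using q by (simp add: Lp_continuous_iff)
  with b bL q show ?thesis by (auto simp: cocycles_def intro: Lp_mono)
qed

text \<open>
  A cocycle with exponent \<open>q\<close> is also one with exponent \<open>q\<^sub>1\<close> and so has a primitive \<open>f\<close> in \<open>L\<^sub>q\<^sub>1\<close>. The Mazur map turns \<open>f\<close> into a function with displacements in
  \<open>L\<^sub>q\<^sub>2\<close>, which differs from one in \<open>L\<^sub>q\<^sub>2\<close> by an invariant, hence bounded, function.
\<close>

lemma cocycles_trivial_between:
  assumes q: "0 < q1" "q1 \<le> q" "q \<le> q2"
    and triv: "cocycles q1 N koop \<subseteq> coboundaries q1 N koop" "cocycles q2 N koop \<subseteq> coboundaries q2 N koop"
  shows "cocycles q N koop \<subseteq> coboundaries q N koop"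
proof
  fix b assume b: "b \<in> cocycles q N koop"
  have "b \<in> cocycles q1 N koop" using q b by (intro cocycles_mono[of q1 q]) auto
  then obtain f where f: "f \<in> Lp q1 N" and bf: "\<And>g. AE x in N. b g x = f x - koop g f x"
    using triv(1) by (auto simp: coboundaries_def ae_eq_def)
  have [measurable]: "f \<in> borel_measurable N" using f by (simp add: Lp_def)
  have bL: "b g \<in> Lp q N" for g using b by (simp add: cocycles_def)
  have [measurable]: "b g \<in> borel_measurable N" for g using bL by (auto simp: Lp_def)
  have bcont: "((\<lambda>g. LINT x|N. norm (b g x - b g\<^sub>0 x) powr q) \<longlongrightarrow> 0) (at g\<^sub>0)" for g\<^sub>0
    using b q by (simp add: cocycles_def Lp_continuous_iff)
  define s where "s = q / q2"
  have s: "0 < s" "s \<le> 1" "s * q2 = q" using q by (auto simp: s_def)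
  define F where "F x = rpow s (f x)" for x
  have Fm[measurable]: "F \<in> borel_measurable N" unfolding F_def using s by measurable
  define b' where "b' g x = F x - koop g F x" for g x
  have b'm[measurable]: "b' g \<in> borel_measurable N" for g unfolding b'_def by measurable
  have holder: "norm (rpow s z - rpow s w) powr q2 \<le> 3 powr q2 * norm (z - w) powr q" for z w
  proof -
    have "norm (rpow s z - rpow s w) powr q2 \<le> (3 * norm (z - w) powr s) powr q2"
      using rpow_holder[OF s(1,2), of z w] q by (intro powr_mono2) auto
    then show ?thesis by (simp add: powr_mult powr_powr s(3))
  qed
  have b'_diff: "AE x in N. norm (b' g x - b' k x) powr q2 \<le> 3 powr q2 * norm (b g x - b k x) powr q" for g k
    using bf[of g] bf[of k] AE_space
  proof eventually_elim
    case (elim x)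
    have "b' g x - b' k x = rpow s (koop k f x) - rpow s (koop g f x)"
      unfolding b'_def F_def using elim(3) by (simp add: koop_rpow)
    then show ?case using holder[of "koop k f x" "koop g f x"] elim by simp
  qed
  have b'L: "b' g \<in> Lp q2 N" for g
  proof (rule LpI_bound)
    show "integrable N (\<lambda>x. 3 powr q2 * norm (b g x) powr q)"
      using Lp_integrable[OF bL] by simp
    show "AE x in N. norm (b' g x) powr q2 \<le> 3 powr q2 * norm (b g x) powr q"
      using bf[of g] AE_space
    proof eventually_elim
      case (elim x)
      have "b' g x = rpow s (f x) - rpow s (koop g f x)"
        unfolding b'_def F_def using elim(2) by (simp add: koop_rpow)
      then show ?case using holder[of "f x" "koop g f x"] elim by simp
    qed
  qed simp
  have "b' \<in> cocycles q2 N koop"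
    unfolding cocycles_def mem_Collect_eq
  proof (intro conjI allI b'L)
    have "((\<lambda>g. LINT x|N. norm (b' g x - b' g\<^sub>0 x) powr q2) \<longlongrightarrow> 0) (at g\<^sub>0)" for g\<^sub>0
    proof (rule Lim_null_comparison)
      have "((\<lambda>g. 3 powr q2 * (LINT x|N. norm (b g x - b g\<^sub>0 x) powr q)) \<longlongrightarrow> 3 powr q2 * 0) (at g\<^sub>0)"
        by (intro tendsto_intros bcont)
      then show "((\<lambda>g. 3 powr q2 * (LINT x|N. norm (b g x - b g\<^sub>0 x) powr q)) \<longlongrightarrow> 0) (at g\<^sub>0)" by simp
      have "(LINT x|N. norm (b' g x - b' g\<^sub>0 x) powr q2) \<le> (LINT x|N. 3 powr q2 * norm (b g x - b g\<^sub>0 x) powr q)" for g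
      proof (rule integral_mono_AE[OF _ _ b'_diff])
        show "integrable N (\<lambda>x. norm (b' g x - b' g\<^sub>0 x) powr q2)"
          using q by (intro Lp_integrable Lp_diff b'L) auto
        show "integrable N (\<lambda>x. 3 powr q2 * norm (b g x - b g\<^sub>0 x) powr q)"
          using q by (intro integrable_mult_right Lp_integrable Lp_diff bL) auto
      qed
      then show "eventually (\<lambda>g. norm (LINT x|N. norm (b' g x - b' g\<^sub>0 x) powr q2)
          \<le> 3 powr q2 * (LINT x|N. norm (b g x - b g\<^sub>0 x) powr q)) (at g\<^sub>0)"
        by (intro always_eventually) simp
    qed
    then show "Lp_continuous q2 N b'" using q by (simp add: Lp_continuous_iff)
    fix g k
    show "ae_eq N (b' (g + k)) (\<lambda>x. b' g x + koop g (b' k) x)"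
      unfolding ae_eq_def using koop_add[of g k F]
    proof eventually_elim
      case (elim x)
      then show ?case by (simp add: b'_def koop_def right_diff_distrib)
    qed
  qed
  then obtain f' where f': "f' \<in> Lp q2 N" and b'f': "\<And>g. AE x in N. b' g x = f' x - koop g f' x"
    using triv(2) by (auto simp: coboundaries_def ae_eq_def)
  have [measurable]: "f' \<in> borel_measurable N" using f' by (simp add: Lp_def)
  have "AE x in N. koop g (\<lambda>x. F x - f' x) x = F x - f' x" for g
    using b'f'[of g] by eventually_elim (simp add: b'_def koop_def algebra_simps)
  then obtain \<kappa> where \<kappa>: "AE x in N. norm (F x - f' x) = \<kappa>"
    using koop_invariant_norm_AE_const[of "\<lambda>x. F x - f' x"] by auto
  have "(\<lambda>x. F x - f' x) \<in> Lp q2 N"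
    by (rule LpI_bound[where g = "\<lambda>_. \<kappa> powr q2"]) (use \<kappa> in \<open>auto elim!: eventually_mono\<close>)
  then have "(\<lambda>x. (F x - f' x) + f' x) \<in> Lp q2 N" using q f' by (intro Lp_add) auto
  then have "f \<in> Lp q N" by (simp add: Lp_def F_def norm_rpow_powr s(3))
  with b bf show "b \<in> coboundaries q N koop" by (auto simp: coboundaries_def ae_eq_def)
qed

text \<open>
  The cocycle is integrable because the exponent is at least \<open>1\<close> and the measure is finite, so it has a
  measurable primitive, whose displacements are differences of values of the cocycle.
\<close>

lemma cocycles_trivial_if_kazhdan_pair:
  fixes Q :: "'g set"
  assumes Q: "kazhdan_pair Q \<epsilon>" and q: "1 \<le> q"
  shows "cocycles q N koop \<subseteq> coboundaries q N koop"
proof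
  fix b assume b: "b \<in> cocycles q N koop"
  have bL: "b g \<in> Lp q N" for g using b by (simp add: cocycles_def)
  have bcont: "((\<lambda>g. LINT x|N. norm (b g x - b g\<^sub>0 x) powr q) \<longlongrightarrow> 0) (at g\<^sub>0)" for g\<^sub>0
    using b q by (simp add: cocycles_def Lp_continuous_iff)
  have "\<exists>f\<in>Lp q N. \<forall>g. AE x in N. b g x = f x - koop g f x"
  proof (cases "measure N (space N) = 0")
    case True
    then have "AE x in N. P x" for P
      by (intro AE_I[of N _ "space N"]) (auto simp: emeasure_eq_measure)
    then show ?thesis using bL by blast
  next
    case pos: False
    have "b \<in> cocycles 1 N koop" using q b by (intro cocycles_mono[of 1 q]) auto
    then have b1: "\<And>g. b g \<in> Lp 1 N" "Lp_continuous 1 N b"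
        "\<And>g k. AE x in N. b (g + k) x = b g x + koop g (b k) x"
      by (auto simp: cocycles_def ae_eq_def)
    interpret affine_twisted_action N \<theta> T b
    proof
      show "integrable N (b g)" for g
        using b1(1)[of g] by (auto simp: Lp_def integrable_norm_iff)
      show "((\<lambda>g. LINT x|N. norm (b g x - b g\<^sub>0 x)) \<longlongrightarrow> 0) (at g\<^sub>0)" for g\<^sub>0
        using b1(2) by (simp add: Lp_continuous_iff)
    qed (rule b1(3))
    obtain f where f[measurable]: "f \<in> borel_measurable N" and bf: "\<And>g. AE x in N. b g x = f x - koop g f x"
      using exists_primitive[OF Q pos] by auto
    have diff: "AE x in N. norm (koop g f x - koop k f x) powr q = norm (b g x - b k x) powr q" for g k
      using bf[of g] bf[of k] by eventually_elim (simp add: norm_minus_commute)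
    have int: "(LINT x|N. norm (koop g f x - koop k f x) powr q) = (LINT x|N. norm (b g x - b k x) powr q)" for g k
      by (rule integral_cong_AE[OF _ _ diff]) measurable
    have int0: "(LINT x|N. norm (koop g f x - koop 0 f x) powr q) = (LINT x|N. norm (b g x) powr q)" for g
    proof -
      have "(LINT x|N. norm (b g x - b 0 x) powr q) = (LINT x|N. norm (b g x) powr q)"
        by (rule integral_cong_AE) (use b_0 in \<open>auto elim!: eventually_mono\<close>)
      then show ?thesis by (simp add: int)
    qed
    obtain B where B: "\<And>g. g \<in> Q \<Longrightarrow> (LINT x|N. norm (b g x) powr q) \<le> B"
      using integral_powr_bounded_on_compact[OF kazhdan_pair_compact[OF Q] _ bL bcont] q by auto
    have "f \<in> Lp q N"
    proof (rule primitive_in_Lp[OF Q _ pos f])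
      show "(\<lambda>x. koop g f x - koop k f x) \<in> Lp q N" for g k
      proof (rule Lp_cong_AE)
        show "(\<lambda>x. b k x - b g x) \<in> Lp q N" using q by (intro Lp_diff bL) auto
        show "AE x in N. b k x - b g x = koop g f x - koop k f x"
          using bf[of g] bf[of k] by eventually_elim simp
      qed measurable
      show "((\<lambda>g. LINT x|N. norm (koop g f x - koop g\<^sub>0 f x) powr q) \<longlongrightarrow> 0) (at g\<^sub>0)" for g\<^sub>0
        unfolding int by (rule bcont)
      show "(LINT x|N. norm (koop g f x - koop 0 f x) powr q) \<le> B" if "g \<in> Q" for g
        unfolding int0 by (rule B[OF that])
    qed (use q in auto)
    with bf show ?thesis by blast
  qed
  with b show "b \<in> coboundaries q N koop" by (auto simp: coboundaries_def ae_eq_def)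
qed

end

section \<open>First cohomology and the Mazur map\<close>

lemma cocycles_cong:
  assumes "\<And>g f. f \<in> Lp q M \<Longrightarrow> ae_eq M (\<rho> g f) (\<rho>' g f)"
  shows "cocycles q M \<rho> = cocycles q M \<rho>'"
proof -
  have "cocycles q M \<rho> \<subseteq> cocycles q M \<rho>'"
    if eq: "\<And>g f. f \<in> Lp q M \<Longrightarrow> AE x in M. \<rho> g f x = \<rho>' g f x" for \<rho> \<rho>'
  proof
    fix b assume b: "b \<in> cocycles q M \<rho>"
    have "AE x in M. b (g + k) x = b g x + \<rho>' g (b k) x" for g k
    proof -
      have "AE x in M. b (g + k) x = b g x + \<rho> g (b k) x" "b k \<in> Lp q M"
        using b by (auto simp: cocycles_def ae_eq_def)
      with eq[of "b k" g] show ?thesis by (auto elim: AE_mp)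
    qed
    with b show "b \<in> cocycles q M \<rho>'" by (auto simp: cocycles_def ae_eq_def)
  qed
  from this[of \<rho> \<rho>'] this[of \<rho>' \<rho>] show ?thesis
    using assms by (auto simp: ae_eq_def eq_commute)
qed

lemma coboundaries_cong:
  assumes eq: "\<And>g f. f \<in> Lp q M \<Longrightarrow> ae_eq M (\<rho> g f) (\<rho>' g f)"
  shows "coboundaries q M \<rho> = coboundaries q M \<rho>'"
proof -
  have "(AE x in M. b x = f x - \<rho> g f x) \<longleftrightarrow> (AE x in M. b x = f x - \<rho>' g f x)" if "f \<in> Lp q M" for b f g
    using eq[OF that, of g] unfolding ae_eq_def by (intro AE_cong_simp iffI) (auto elim: AE_mp)
  moreover have "cocycles q M \<rho> = cocycles q M \<rho>'" by (rule cocycles_cong) (rule assms)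
  ultimately show ?thesis by (simp add: coboundaries_def ae_eq_def cong: bex_cong)
qed

lemma H1_cong:
  assumes "\<And>g f. f \<in> Lp q M \<Longrightarrow> ae_eq M (\<rho> g f) (\<rho>' g f)"
  shows "H1 q M \<rho> = H1 q M \<rho>'"
proof -
  have "cocycles q M \<rho> = cocycles q M \<rho>'" by (rule cocycles_cong) (rule assms)
  moreover have "coboundaries q M \<rho> = coboundaries q M \<rho>'" by (rule coboundaries_cong) (rule assms)
  ultimately show ?thesis by (simp only: H1_def)
qed

context twisted_action
begin

lemma cocycles_diff:
  assumes q: "0 < q" and b: "b \<in> cocycles q N koop" and c: "c \<in> cocycles q N koop"
  shows "(\<lambda>g x. b g x - c g x) \<in> cocycles q N koop"
  unfolding cocycles_def mem_Collect_eq
proof (intro conjI allI)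
  have L: "b g \<in> Lp q N" "c g \<in> Lp q N" for g using b c by (auto simp: cocycles_def)
  then show "(\<lambda>x. b g x - c g x) \<in> Lp q N" for g using q by (intro Lp_diff) auto
  have cont: "((\<lambda>g. LINT x|N. norm (b g x - b g\<^sub>0 x) powr q) \<longlongrightarrow> 0) (at g\<^sub>0)"
      "((\<lambda>g. LINT x|N. norm (c g x - c g\<^sub>0 x) powr q) \<longlongrightarrow> 0) (at g\<^sub>0)" for g\<^sub>0
    using b c q by (auto simp: cocycles_def Lp_continuous_iff)
  have "((\<lambda>g. LINT x|N. norm ((b g x - c g x) - (b g\<^sub>0 x - c g\<^sub>0 x)) powr q) \<longlongrightarrow> 0) (at g\<^sub>0)" for g\<^sub>0
  proof (rule Lim_null_comparison)
    let ?J = "\<lambda>g. 2 powr q * ((LINT x|N. norm (b g x - b g\<^sub>0 x) powr q) + (LINT x|N. norm (c g x - c g\<^sub>0 x) powr q))"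
    have "(?J \<longlongrightarrow> 2 powr q * (0 + 0)) (at g\<^sub>0)" by (intro tendsto_intros cont)
    then show "(?J \<longlongrightarrow> 0) (at g\<^sub>0)" by simp
    have "(LINT x|N. norm ((b g x - c g x) - (b g\<^sub>0 x - c g\<^sub>0 x)) powr q) \<le> ?J g" for g
    proof -
      have d: "(\<lambda>x. b g x - b g\<^sub>0 x) \<in> Lp q N" "(\<lambda>x. c g x - c g\<^sub>0 x) \<in> Lp q N"
        using q L by (auto intro: Lp_diff)
      have "(\<lambda>x. (b g x - b g\<^sub>0 x) - (c g x - c g\<^sub>0 x)) \<in> Lp q N" using q by (intro Lp_diff d) auto
      moreover have eq: "(b g x - c g x) - (b g\<^sub>0 x - c g\<^sub>0 x) = (b g x - b g\<^sub>0 x) - (c g x - c g\<^sub>0 x)" for x by simp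
      ultimately have "(LINT x|N. norm ((b g x - c g x) - (b g\<^sub>0 x - c g\<^sub>0 x)) powr q)
          \<le> (LINT x|N. 2 powr q * (norm (b g x - b g\<^sub>0 x) powr q + norm (c g x - c g\<^sub>0 x) powr q))"
        unfolding eq using q d L
        by (intro integral_mono norm_diff_powr_le integrable_mult_right Bochner_Integration.integrable_add) (auto simp: Lp_def)
      also have "\<dots> = ?J g" using d by (simp add: Lp_def)
      finally show ?thesis .
    qed
    then show "eventually (\<lambda>g. norm (LINT x|N. norm ((b g x - c g x) - (b g\<^sub>0 x - c g\<^sub>0 x)) powr q) \<le> ?J g) (at g\<^sub>0)"
      by (intro always_eventually) simp
  qed
  then show "Lp_continuous q N (\<lambda>g x. b g x - c g x)" using q by (simp add: Lp_continuous_iff)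
  fix g k
  have "AE x in N. b (g + k) x = b g x + koop g (b k) x" "AE x in N. c (g + k) x = c g x + koop g (c k) x"
    using b c by (auto simp: cocycles_def ae_eq_def)
  then show "ae_eq N (\<lambda>x. b (g + k) x - c (g + k) x)
      (\<lambda>x. b g x - c g x + koop g (\<lambda>x. b k x - c k x) x)"
    unfolding ae_eq_def by eventually_elim (simp add: koop_def algebra_simps)
qed

lemma zero_coboundary: "(\<lambda>_ _. 0) \<in> coboundaries q N koop"
proof -
  have "(\<lambda>_. 0) \<in> Lp q N" by (simp add: Lp_def)
  moreover from this have "(\<lambda>_ _. 0) \<in> cocycles q N koop"
    by (simp add: cocycles_def Lp_continuous_def Lp_norm_def ae_eq_def koop_def)
  ultimately show ?thesis
    by (auto simp: coboundaries_def ae_eq_def koop_def intro!: bexI[of _ "\<lambda>_. 0"])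
qed

lemma H1_trivial_iff:
  assumes q: "0 < q"
  shows "H1 q N koop = {coboundaries q N koop} \<longleftrightarrow> cocycles q N koop \<subseteq> coboundaries q N koop"
proof -
  let ?Z = "cocycles q N koop" and ?B = "coboundaries q N koop"
  let ?r = "{(b, c). b \<in> ?Z \<and> c \<in> ?Z \<and> (\<lambda>g x. b g x - c g x) \<in> ?B}"
  have BZ: "?B \<subseteq> ?Z" by (auto simp: coboundaries_def)
  have "?Z // ?r = {?B}" if sub: "?Z \<subseteq> ?B"
  proof -
    have ZB: "?Z = ?B" using sub BZ by (rule subset_antisym)
    have "(b, c) \<in> ?r \<longleftrightarrow> c \<in> ?B" if "b \<in> ?Z" for b c
      using that cocycles_diff[OF q that, of c] unfolding ZB by blast
    then have "?r `` {b} = ?B" if "b \<in> ?Z" for b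
      using that by blast
    moreover have "(\<lambda>_ _. 0) \<in> ?Z" using zero_coboundary BZ by blast
    ultimately show ?thesis unfolding quotient_def by blast
  qed
  moreover have "?Z \<subseteq> ?B" if trivial: "?Z // ?r = {?B}"
  proof
    fix b assume b: "b \<in> ?Z"
    have "?r `` {b} \<in> ?Z // ?r" by (rule quotientI[OF b])
    then have "?r `` {b} = ?B" unfolding trivial by (rule singletonD)
    moreover have "b \<in> ?r `` {b}" using b zero_coboundary by simp
    ultimately show "b \<in> ?B" by blast
  qed
  ultimately show ?thesis unfolding H1_def by blast
qed

end

section \<open>Measure-preserving Banach--Lamperti representations\<close>

text \<open>A countable base of a Hausdorff topology separates points.\<close>

lemma standard_borel_separating:
  assumes "standard_borel M"
  obtains \<B> where "countable \<B>" "\<B> \<subseteq> sets M"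
    "\<And>x y. x \<in> space M \<Longrightarrow> y \<in> space M \<Longrightarrow> (\<And>A. A \<in> \<B> \<Longrightarrow> x \<in> A \<longleftrightarrow> y \<in> A) \<Longrightarrow> x = y"
proof -
  obtain T where T: "completely_metrizable_space T" "second_countable T" "topspace T = space M"
      "sets M = sigma_sets (space M) {U. openin T U}"
    using assms by (auto simp: standard_borel_def)
  obtain \<B> where \<B>: "countable \<B>" "\<And>V. V \<in> \<B> \<Longrightarrow> openin T V"
      "\<And>U x. openin T U \<Longrightarrow> x \<in> U \<Longrightarrow> \<exists>V\<in>\<B>. x \<in> V \<and> V \<subseteq> U"
    using T(2) unfolding second_countable_def by metis
  have H: "Hausdorff_space T"
    using T(1) by (intro metrizable_imp_Hausdorff_space completely_metrizable_imp_metrizable_space)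
  show thesis
  proof (rule that[OF \<B>(1)])
    show "\<B> \<subseteq> sets M" using \<B>(2) by (auto simp: T(4))
    fix x y assume xy: "x \<in> space M" "y \<in> space M" "\<And>A. A \<in> \<B> \<Longrightarrow> x \<in> A \<longleftrightarrow> y \<in> A"
    show "x = y"
    proof (rule ccontr)
      assume "x \<noteq> y"
      then obtain U V where "openin T U" "openin T V" "x \<in> U" "y \<in> V" "disjnt U V"
        using H xy(1,2) T(3) unfolding Hausdorff_space_def by metis
      with \<B>(3)[of U x] xy(3) show False by (auto simp: disjnt_iff)
    qed
  qed
qed

lemma pullback_measure_preserving:
  assumes cp: "class_preserving M \<phi>" and mp: "distr M M \<phi> = M"
  shows "pullback_measure M \<phi> = M"
proof -
  have m: "\<phi> \<in> measurable M M" "the_inv_into (space M) \<phi> \<in> measurable M M" and bij: "bij_betw \<phi> (space M) (space M)"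
    using cp by (auto simp: class_preserving_def)
  have "pullback_measure M \<phi> = distr (distr M M \<phi>) M (the_inv_into (space M) \<phi>)"
    unfolding pullback_measure_def mp ..
  also have "\<dots> = distr M M (the_inv_into (space M) \<phi> \<circ> \<phi>)"
    using m by (rule distr_distr[rotated])
  also have "\<dots> = distr M M (\<lambda>x. x)"
    using bij by (intro distr_cong) (auto simp: bij_betw_def the_inv_into_f_f)
  finally show ?thesis by (simp add: distr_id2)
qed

text \<open>In the measure-preserving case the density in the Banach--Lamperti formula is \<open>1\<close>.\<close>

lemma BL_form_koop:
  assumes "finite_measure M" and BL: "BL_form p M U h \<phi>" and mp: "distr M M \<phi> = M" and f: "f \<in> Lp p M"
  shows "AE x in M. U f x = h x * f (\<phi> x)"
proof -
  interpret finite_measure M by fact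
  have "pullback_measure M \<phi> = M"
    using BL mp by (intro pullback_measure_preserving) (auto simp: BL_form_def)
  moreover have "AE x in M. RN_deriv M M x = 1"
    using RN_deriv_unique[of "\<lambda>_. 1" M] by (auto simp: density_1 elim!: eventually_mono)
  moreover have "AE x in M. U f x = h x * of_real (enn2real (RN_deriv M (pullback_measure M \<phi>) x) powr (1 / p)) * f (\<phi> x)"
    using BL f by (simp add: BL_form_def ae_eq_def)
  ultimately show ?thesis by (auto elim: AE_mp)
qed

text \<open>
  The homomorphism property holds for classes of functions only. Testing it on constants and on a
  countable separating family of indicators shows that multiplier and transformation satisfy their
  cocycle identities almost everywhere.
\<close>

lemma BL_representation_ergodic_twisted_action:
  fixes \<pi> :: "'g::topological_group_add \<Rightarrow> ('x \<Rightarrow> complex) \<Rightarrow> ('x \<Rightarrow> complex)"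
  assumes sb: "standard_borel M" and fin: "finite_measure M"
    and BL: "BL_representation p M \<pi> h \<phi>"
    and mp: "measure_preserving_action M \<phi>" and erg: "ergodic_action M \<phi>"
  shows "ergodic_twisted_action M h \<phi>"
proof -
  interpret finite_measure M by fact
  have form: "BL_form p M (\<pi> g) (h g) (\<phi> g)" for g
    using BL by (simp add: BL_representation_def)
  have pres: "distr M M (\<phi> g) = M" and [measurable]: "\<phi> g \<in> measurable M M" for g
    using mp by (auto simp: measure_preserving_action_def)
  have [measurable]: "h g \<in> borel_measurable M" and h1: "x \<in> space M \<Longrightarrow> norm (h g x) = 1"
    and bij: "bij_betw (\<phi> g) (space M) (space M)" for g x
    using form[of g] by (auto simp: BL_form_def class_preserving_def)
  have \<phi>_space: "\<phi> g x \<in> space M" if "x \<in> space M" for g x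
    using that bij[of g] by (auto simp: bij_betw_def)
  have koop: "AE x in M. \<pi> g f x = h g x * f (\<phi> g x)" if "f \<in> Lp p M" for g f
    by (rule BL_form_koop[OF fin form pres that])
  have AE_\<phi>: "AE x in M. P (\<phi> g x)" if "AE x in M. P x" for P g
  proof (rule AE_distrD[of "\<phi> g" M M])
    show "AE x in distr M M (\<phi> g). P x" unfolding pres by (rule that)
  qed measurable
  have OR: "orthogonal_representation p M \<pi>" using BL by (simp add: BL_representation_def)
  have mult: "AE x in M. h (g + k) x * f (\<phi> (g + k) x) = h g x * (h k (\<phi> g x) * f (\<phi> k (\<phi> g x)))"
    if f: "f \<in> Lp p M" for g k f
  proof -
    let ?K = "\<lambda>x. h k x * f (\<phi> k x)"
    have [measurable]: "f \<in> borel_measurable M" using f by (simp add: Lp_def)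
    have \<pi>f: "\<pi> k f \<in> Lp p M" using OR f by (simp add: orthogonal_representation_def Lp_isometry_def)
    have K: "?K \<in> Lp p M" by (rule Lp_cong_AE[OF \<pi>f _ koop[OF f]]) measurable
    have "AE x in M. \<pi> g (\<pi> k f) x = \<pi> g ?K x"
      using OR \<pi>f K koop[OF f, of k] by (simp add: orthogonal_representation_def Lp_isometry_def ae_eq_def)
    moreover have "AE x in M. \<pi> (g + k) f x = \<pi> g (\<pi> k f) x"
      using OR f by (simp add: orthogonal_representation_def ae_eq_def)
    ultimately show ?thesis
      using koop[OF f, of "g + k"] koop[OF K, of g] by eventually_elim simp
  qed
  have h_add: "AE x in M. h (g + k) x = h g x * h k (\<phi> g x)" for g k
    using mult[of "\<lambda>_. 1" g k] by (simp add: Lp_def)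
  have \<phi>_add: "AE x in M. \<phi> (g + k) x = \<phi> k (\<phi> g x)" for g k
  proof -
    obtain \<B> where \<B>: "countable \<B>" "\<B> \<subseteq> sets M"
      "\<And>x y. x \<in> space M \<Longrightarrow> y \<in> space M \<Longrightarrow> (\<And>A. A \<in> \<B> \<Longrightarrow> x \<in> A \<longleftrightarrow> y \<in> A) \<Longrightarrow> x = y"
      using standard_borel_separating[OF sb] by blast
    have "AE x in M. \<forall>A\<in>\<B>. \<phi> (g + k) x \<in> A \<longleftrightarrow> \<phi> k (\<phi> g x) \<in> A"
      unfolding AE_ball_countable[OF \<B>(1)]
    proof
      fix A assume "A \<in> \<B>"
      then have [measurable]: "A \<in> sets M" using \<B> by auto
      have "(indicator A :: 'x \<Rightarrow> complex) \<in> Lp p M"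
      proof (rule LpI_bound)
        show "AE x in M. norm (indicator A x :: complex) powr p \<le> 1"
          by (auto simp: indicator_def)
      qed auto
      from mult[OF this, of g k] AE_space show "AE x in M. \<phi> (g + k) x \<in> A \<longleftrightarrow> \<phi> k (\<phi> g x) \<in> A"
      proof eventually_elim
        case (elim x)
        have "\<phi> g x \<in> space M" using elim(2) by (rule \<phi>_space)
        then have "norm (h (g + k) x) = 1" "norm (h g x) = 1" "norm (h k (\<phi> g x)) = 1"
          using elim(2) by (simp_all add: h1)
        then have "h (g + k) x \<noteq> 0" "h g x \<noteq> 0" "h k (\<phi> g x) \<noteq> 0"
          by (metis norm_zero zero_neq_one)+
        with elim(1) show ?case by (auto split: split_indicator_asm)
      qed
    qed
    with AE_space show ?thesis
    proof eventually_elim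
      case (elim x)
      show ?case
      proof (rule \<B>(3))
        show "\<phi> (g + k) x \<in> space M" "\<phi> k (\<phi> g x) \<in> space M"
          using elim(1) by (intro \<phi>_space; assumption)+
      qed (use elim in blast)
    qed
  qed
  \<comment> \<open>The identities below hold because \<open>\<phi> 0\<close> is idempotent and injective, and \<open>h 0\<close> is idempotent and
    nowhere zero.\<close>
  have \<phi>_0: "AE x in M. \<phi> 0 x = x"
    using \<phi>_add[of 0 0] AE_space
  proof eventually_elim
    case (elim x)
    have "\<phi> 0 x \<in> space M" using elim(2) by (rule \<phi>_space)
    then show ?case using elim bij[of 0] by (auto simp: bij_betw_def inj_on_def)
  qed
  have h_0: "AE x in M. h 0 x = 1"
    using h_add[of 0 0] \<phi>_0 AE_space
  proof eventually_elim
    case (elim x)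
    then have "h 0 x * h 0 x = h 0 x * 1" "h 0 x \<noteq> 0" using h1[of x 0] by auto
    then show ?case by (simp only: mult_cancel_left) simp
  qed
  show ?thesis
  proof
    show "emeasure M A = 0 \<or> emeasure M (space M - A) = 0"
      if "A \<in> sets M" "\<And>g. AE x in M. \<phi> g x \<in> A \<longleftrightarrow> x \<in> A" for A
      using erg that unfolding ergodic_action_def by blast
    show "\<phi> g \<in> measurable M M" "h g \<in> borel_measurable M" for g by measurable
    show "norm (h g x) = 1" if "x \<in> space M" for g x by (rule h1[OF that])
  qed (rule pres \<phi>_0 h_0 \<phi>_add h_add)+
qed

lemma mazur_conj_koop:
  assumes fin: "finite_measure M" and BL: "BL_representation p M \<pi> h \<phi>"
    and mp: "measure_preserving_action M \<phi>"
    and p: "0 < p" and q: "0 < q" and f: "f \<in> Lp q M"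
  shows "AE x in M. mazur_conj p q \<pi> g f x = h g x * f (\<phi> g x)"
proof -
  have mazur: "mazur r s f = (\<lambda>x. rpow (r / s) (f x))" for r s and f :: "'a \<Rightarrow> complex"
    by (simp add: mazur_def rpow_def fun_eq_iff)
  have form: "BL_form p M (\<pi> g) (h g) (\<phi> g)" and pres: "distr M M (\<phi> g) = M"
    using BL mp by (auto simp: BL_representation_def measure_preserving_action_def)
  have [measurable]: "f \<in> borel_measurable M" using f by (simp add: Lp_def)
  have "(\<lambda>x. rpow (q / p) (f x)) \<in> Lp p M"
    using f p q by (simp add: Lp_def norm_rpow_powr)
  from BL_form_koop[OF fin form pres this] AE_space show ?thesis
  proof eventually_elim
    case (elim x)
    have "norm (h g x) = 1" using form elim(2) by (simp add: BL_form_def)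
    then show ?case
      using elim(1) p q by (simp add: mazur_conj_def mazur rpow_mult_unit rpow_rpow)
  qed
qed

theorem theorem3:
  fixes M :: "'x measure" and p :: real
    and \<pi> :: "'g::{topological_group_add, t2_space, second_countable_topology} \<Rightarrow>
              ('x \<Rightarrow> complex) \<Rightarrow> ('x \<Rightarrow> complex)"
    and h :: "'g \<Rightarrow> 'x \<Rightarrow> complex" and \<phi> :: "'g \<Rightarrow> 'x \<Rightarrow> 'x"
  assumes "locally_compact_space (euclidean :: 'g topology)"
    and "standard_borel M" and "finite_measure M"
    and "1 \<le> p"
    and "BL_representation p M \<pi> h \<phi>"
    and "measure_preserving_action M \<phi>"
    and "ergodic_action M \<phi>"
  shows "(fixed_point_spectrum p M \<pi> = {} \<or> is_interval (fixed_point_spectrum p M \<pi>)) \<and>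
         (property_T TYPE('g) \<longrightarrow>
            (\<exists>p\<^sub>c>2. fixed_point_spectrum p M \<pi> = {1..p\<^sub>c}) \<or> fixed_point_spectrum p M \<pi> = {1..})"
proof -
  interpret ergodic_twisted_action M h \<phi>
    by (rule BL_representation_ergodic_twisted_action[OF assms(2,3,5,6,7)])
  have spectrum: "q \<in> fixed_point_spectrum p M \<pi> \<longleftrightarrow>
      1 \<le> q \<and> cocycles q M koop \<subseteq> coboundaries q M koop" for q
  proof (cases "1 \<le> q")
    case True
    have eq: "ae_eq M (mazur_conj p q \<pi> g f) (koop g f)" if "f \<in> Lp q M" for g f
      unfolding ae_eq_def koop_def
      using mazur_conj_koop[OF assms(3,5,6) _ _ that] True assms(4) by simp
    have "H1 q M (mazur_conj p q \<pi>) = H1 q M koop"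
      "coboundaries q M (mazur_conj p q \<pi>) = coboundaries q M koop"
      by (intro H1_cong coboundaries_cong eq; assumption)+
    with True show ?thesis by (simp add: fixed_point_spectrum_def H1_trivial_iff)
  qed (simp add: fixed_point_spectrum_def)
  have "is_interval (fixed_point_spectrum p M \<pi>)"
    unfolding is_interval_1
  proof (intro allI impI ballI)
    fix q1 q2 q assume "q1 \<in> fixed_point_spectrum p M \<pi>" "q2 \<in> fixed_point_spectrum p M \<pi>" "q1 \<le> q \<and> q \<le> q2"
    then show "q \<in> fixed_point_spectrum p M \<pi>"
      unfolding spectrum using cocycles_trivial_between[of q1 q q2] by auto
  qed
  moreover have "fixed_point_spectrum p M \<pi> = {1..}" if T: "property_T TYPE('g)"
  proof -
    obtain Q :: "'g set" and \<epsilon> where "kazhdan_pair Q \<epsilon>"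
      using T unfolding property_T_iff_kazhdan_pair by blast
    then show ?thesis using cocycles_trivial_if_kazhdan_pair by (auto simp: spectrum)
  qed
  ultimately show ?thesis by blast
qed

end
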